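(* Let $G$ be a bipartite graph. Then $\mathrm{Ind}(G)$ is Buchsbaum if and only if either $G$ is the complete bipartite graph $\mathcal{K}_{n,n}$ for some $n\ge 1$, or $\mathrm{Ind}(G)$ is Cohen-Macaulay.
   Context: $\mathrm{Ind}(G)$ is the simplicial complex of independent sets of $G$. A simplicial complex is Cohen-Macaulay (resp. Buchsbaum) if its Stanley–Reisner ring over a field $K$ is Cohen-Macaulay (resp. Buchsbaum). $\mathcal{K}_{m,n}$ is the bipartite graph with parts of sizes $m$ and $n$ in which every vertex of one part is adjacent to every vertex of the other. *)

theory Defs
  imports Main "HOL-Library.Poly_Mapping"
begin

type_synonym ('a, 'k) mpoly = "('a \<Rightarrow>\<^sub>0 nat) \<Rightarrow>\<^sub>0 'k"

definition var :: "'a \<Rightarrow> ('a, 'k::comm_ring_1) mpoly" where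
  "var v = Poly_Mapping.single (Poly_Mapping.single v 1) 1"

definition mono_deg :: "('a \<Rightarrow>\<^sub>0 nat) \<Rightarrow> nat" where
  "mono_deg m = sum (Poly_Mapping.lookup m) (Poly_Mapping.keys m)"

definition homog_pos :: "('a, 'k::comm_ring_1) mpoly \<Rightarrow> bool" where
  "homog_pos p \<longleftrightarrow> (\<exists>d>0. \<forall>m \<in> Poly_Mapping.keys p. mono_deg m = d)"

definition is_ideal :: "'r::comm_ring_1 set \<Rightarrow> bool" where
  "is_ideal I \<longleftrightarrow> 0 \<in> I \<and> (\<forall>a\<in>I. \<forall>b\<in>I. a + b \<in> I) \<and> (\<forall>a\<in>I. \<forall>r. r * a \<in> I)"

definition gen_ideal :: "'r::comm_ring_1 set \<Rightarrow> 'r set" where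
  "gen_ideal X = \<Inter>{I. is_ideal I \<and> X \<subseteq> I}"

definition prime_ideal :: "'r::comm_ring_1 set \<Rightarrow> bool" where
  "prime_ideal P \<longleftrightarrow> is_ideal P \<and> P \<noteq> UNIV \<and> (\<forall>a b. a * b \<in> P \<longrightarrow> a \<in> P \<or> b \<in> P)"

definition colon :: "'r::comm_ring_1 set \<Rightarrow> 'r set \<Rightarrow> 'r set" where
  "colon J K = {g. \<forall>h\<in>K. g * h \<in> J}"

definition radical :: "'r::comm_ring_1 set \<Rightarrow> 'r set" where
  "radical J = {f. \<exists>k. f ^ k \<in> J}"

definition max_homog :: "'k::comm_ring_1 itself \<Rightarrow> ('a, 'k) mpoly set" where
  "max_homog _ = gen_ideal (range var)"

section \<open>The quotient ring R = S / I, handled through ideals of S containing I\<close>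

definition krull_dim_quot :: "'r::comm_ring_1 set \<Rightarrow> nat" where
  "krull_dim_quot I = Sup {n. \<exists>P :: nat \<Rightarrow> 'r set.
      (\<forall>i\<le>n. prime_ideal (P i) \<and> I \<subseteq> P i) \<and> (\<forall>i<n. P i \<subset> P (Suc i))}"

text \<open>Ideal of S generated by I and the first i elements of the list th
(its image in R is (th_1,...,th_i) R).\<close>
definition pre_ideal :: "'r::comm_ring_1 set \<Rightarrow> 'r list \<Rightarrow> nat \<Rightarrow> 'r set" where
  "pre_ideal I th i = gen_ideal (I \<union> set (take i th))"

text \<open>Homogeneous system of parameters of R = S/I: dim R homogeneous elements of positive
degree generating an m-primary ideal of R.\<close>
definition hsop :: "'k::comm_ring_1 itself \<Rightarrow> ('a, 'k) mpoly set \<Rightarrow> ('a, 'k) mpoly list \<Rightarrow> bool" where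
  "hsop K I th \<longleftrightarrow> length th = krull_dim_quot I \<and> (\<forall>t\<in>set th. homog_pos t)
      \<and> radical (pre_ideal I th (length th)) = max_homog K"

definition regular_seq :: "'r::comm_ring_1 set \<Rightarrow> 'r list \<Rightarrow> bool" where
  "regular_seq I th \<longleftrightarrow> (\<forall>i<length th. colon (pre_ideal I th i) {th ! i} = pre_ideal I th i)
      \<and> pre_ideal I th (length th) \<noteq> UNIV"

definition weak_seq :: "'k::comm_ring_1 itself \<Rightarrow> ('a, 'k) mpoly set \<Rightarrow> ('a, 'k) mpoly list \<Rightarrow> bool" where
  "weak_seq K I th \<longleftrightarrow> (\<forall>i<length th.
      colon (pre_ideal I th i) {th ! i} = colon (pre_ideal I th i) (max_homog K))"

text \<open>Graded ring R = S/I Cohen-Macaulay: depth R = dim R, i.e. there is a (homogeneous)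
R-regular sequence in m of length dim R (depth <= dim always holds).\<close>
definition cohen_macaulay_quot :: "'k::comm_ring_1 itself \<Rightarrow> ('a, 'k) mpoly set \<Rightarrow> bool" where
  "cohen_macaulay_quot K I \<longleftrightarrow> (\<exists>th. length th = krull_dim_quot I
      \<and> (\<forall>t\<in>set th. homog_pos t) \<and> regular_seq I th)"

definition buchsbaum_quot :: "'k::comm_ring_1 itself \<Rightarrow> ('a, 'k) mpoly set \<Rightarrow> bool" where
  "buchsbaum_quot K I \<longleftrightarrow> (\<forall>th. hsop K I th \<longrightarrow> weak_seq K I th)"

definition SR_ideal :: "'k::comm_ring_1 itself \<Rightarrow> 'a::finite set set \<Rightarrow> ('a, 'k) mpoly set" where
  "SR_ideal K D = gen_ideal {(\<Prod>v\<in>F. var v) | F. F \<notin> D}"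

definition cohen_macaulay_cx :: "'k::field itself \<Rightarrow> 'a::finite set set \<Rightarrow> bool" where
  "cohen_macaulay_cx K D \<longleftrightarrow> cohen_macaulay_quot K (SR_ideal K D)"

definition buchsbaum_cx :: "'k::field itself \<Rightarrow> 'a::finite set set \<Rightarrow> bool" where
  "buchsbaum_cx K D \<longleftrightarrow> buchsbaum_quot K (SR_ideal K D)"

definition simple_graph :: "('a \<Rightarrow> 'a \<Rightarrow> bool) \<Rightarrow> bool" where
  "simple_graph E \<longleftrightarrow> (\<forall>u v. E u v \<longrightarrow> E v u) \<and> (\<forall>u. \<not> E u u)"

definition bipartite :: "('a \<Rightarrow> 'a \<Rightarrow> bool) \<Rightarrow> bool" where
  "bipartite E \<longleftrightarrow> (\<exists>A. \<forall>u v. E u v \<longrightarrow> (u \<in> A \<longleftrightarrow> v \<notin> A))"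

definition Ind :: "('a \<Rightarrow> 'a \<Rightarrow> bool) \<Rightarrow> 'a set set" where
  "Ind E = {S. \<forall>u\<in>S. \<forall>v\<in>S. \<not> E u v}"

definition is_complete_bipartite_nn :: "('a \<Rightarrow> 'a \<Rightarrow> bool) \<Rightarrow> nat \<Rightarrow> bool" where
  "is_complete_bipartite_nn E n \<longleftrightarrow> (\<exists>A. card A = n \<and> card (- A) = n
      \<and> (\<forall>u v. E u v \<longleftrightarrow> (u \<in> A \<longleftrightarrow> v \<notin> A)))"

end

theory Submission
  imports Defs "HOL-Library.FuncSet"
begin

text \<open>
  A Buchsbaum complex is pure: for a facet \<open>F\<close> of non-maximal size the sum of the top-dimensional face
  monomials is a parameter annihilating \<open>x\<^sub>F\<close>. Hence a bipartite \<open>G\<close> with Buchsbaum independence complex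
  is well-covered, Hall's theorem gives a perfect matching \<open>\<mu>\<close> off the isolated vertices, and purity
  makes \<open>i \<le> j \<longleftrightarrow> {i, \<mu> j} \<in> G\<close> a preorder. If it is antisymmetric, the elements \<open>x\<^sub>i - x\<^bsub>\<mu> i\<^esub>\<close> together
  with the isolated vertices form a regular sequence, since every partial quotient is defined by a
  monomial ideal. If \<open>i \<noteq> j\<close> are equivalent, the parameters \<open>x\<^sub>i - x\<^bsub>\<mu> i\<^esub>, x\<^sub>j - x\<^bsub>\<mu> j\<^esub>\<close> violate the weak sequence
  condition unless every other vertex is adjacent to \<open>i\<close> or \<open>\<mu> i\<close>, which forces \<open>G\<close> to be some \<open>K\<^bsub>n,n\<^esub>\<close>.

  For the converse, if one homogeneous system of parameters is regular, then all are: two of them can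
  be connected by exchanging their last members for a common parameter. For \<open>K\<^bsub>n,n\<^esub>\<close> this is applied to
  the polynomial rings on the two parts.
\<close>

section \<open>Ideals, radicals and regular sequences\<close>

text \<open>Buchsbaumness quantifies over all homogeneous systems of parameters: refuting it takes
  one well-chosen system, proving it requires control of all of them. The field is arbitrary,
  possibly finite, so a common parameter cannot be sought as a general linear combination. It comes
  from a dimension count: modulo all members but one of a system of parameters the graded pieces
  have bounded dimension, so enough forms x^i y^(N-i) of one degree satisfy a linear relation modulo
  both ideals at once, and a form coprime to this relation is the parameter. Growth counts also
  settle dimension. A chain of primes or a regular sequence of length m produces on the order of r^m
  independent elements in degrees linear in r, whereas a Stanley-Reisner ring whose faces have at
  most d vertices admits only a constant times r^d. This bounds the Krull dimension, and it shows
  that a homogeneous regular sequence of that length is a system of parameters, which the definition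
  of Cohen-Macaulayness does not ask for.\<close>

abbreviation lookup where "lookup \<equiv> Poly_Mapping.lookup"
abbreviation keys where "keys \<equiv> Poly_Mapping.keys"
abbreviation single where "single \<equiv> Poly_Mapping.single"

lemma ideal_zero: "is_ideal I \<Longrightarrow> 0 \<in> I"
  by (simp add: is_ideal_def)

lemma ideal_add: "is_ideal I \<Longrightarrow> a \<in> I \<Longrightarrow> b \<in> I \<Longrightarrow> a + b \<in> I"
  by (simp add: is_ideal_def)

lemma ideal_mult: "is_ideal I \<Longrightarrow> a \<in> I \<Longrightarrow> r * a \<in> I"
  by (simp add: is_ideal_def)

lemma ideal_mult2: "is_ideal I \<Longrightarrow> a \<in> I \<Longrightarrow> a * r \<in> I"
  using ideal_mult[of I a r] by (simp add: mult.commute)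

lemma ideal_uminus: "is_ideal I \<Longrightarrow> a \<in> I \<Longrightarrow> - a \<in> I"
  using ideal_mult[of I a "-1"] by simp

lemma ideal_diff: "is_ideal I \<Longrightarrow> a \<in> I \<Longrightarrow> b \<in> I \<Longrightarrow> a - b \<in> I"
  using ideal_add[OF _ _ ideal_uminus, of I a b] by simp

lemma ideal_sum: "is_ideal I \<Longrightarrow> (\<And>x. x \<in> X \<Longrightarrow> f x \<in> I) \<Longrightarrow> sum f X \<in> I"
  by (induction X rule: infinite_finite_induct) (auto simp: ideal_zero ideal_add)

lemma ideal_diff_cancel: "is_ideal I \<Longrightarrow> a - b \<in> I \<Longrightarrow> b \<in> I \<Longrightarrow> a \<in> I"
  using ideal_add[of I "a - b" b] by simp

lemma ideal_UNIV_iff: "is_ideal I \<Longrightarrow> I = UNIV \<longleftrightarrow> 1 \<in> I"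
  using ideal_mult[of I 1] by auto

lemma is_ideal_gen: "is_ideal (gen_ideal X)"
  by (auto simp: gen_ideal_def is_ideal_def)

lemma gen_ideal_superset: "X \<subseteq> gen_ideal X"
  by (auto simp: gen_ideal_def)

lemma gen_ideal_least: "is_ideal J \<Longrightarrow> X \<subseteq> J \<Longrightarrow> gen_ideal X \<subseteq> J"
  by (auto simp: gen_ideal_def)

lemma gen_ideal_id: "is_ideal I \<Longrightarrow> gen_ideal I = I"
  using gen_ideal_least[of I I] gen_ideal_superset[of I] by blast

lemma gen_ideal_mono: "X \<subseteq> Y \<Longrightarrow> gen_ideal X \<subseteq> gen_ideal Y"
  by (meson gen_ideal_least gen_ideal_superset is_ideal_gen subset_trans)

lemma gen_ideal_Un_gen: "gen_ideal (gen_ideal X \<union> Y) = gen_ideal (X \<union> Y)"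
proof
  show "gen_ideal (gen_ideal X \<union> Y) \<subseteq> gen_ideal (X \<union> Y)"
    by (rule gen_ideal_least[OF is_ideal_gen])
      (use gen_ideal_mono[of X "X \<union> Y"] gen_ideal_superset[of "X \<union> Y"] in blast)
  show "gen_ideal (X \<union> Y) \<subseteq> gen_ideal (gen_ideal X \<union> Y)"
    by (rule gen_ideal_mono) (use gen_ideal_superset[of X] in blast)
qed

lemma gen_ideal_insert:
  assumes "is_ideal I"
  shows "gen_ideal (insert a I) = {i + r * a | i r. i \<in> I}"
proof
  have "is_ideal {i + r * a | i r. i \<in> I}"
    unfolding is_ideal_def
  proof (intro conjI ballI allI)
    show "0 \<in> {i + r * a |i r. i \<in> I}"
      using ideal_zero[OF assms] by (intro CollectI exI[of _ 0]) simp
  next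
    fix x y assume "x \<in> {i + r * a |i r. i \<in> I}" "y \<in> {i + r * a |i r. i \<in> I}"
    then obtain i r j s where "x = i + r * a" "i \<in> I" "y = j + s * a" "j \<in> I"
      by blast
    then show "x + y \<in> {i + r * a |i r. i \<in> I}"
      using ideal_add[OF assms] by (intro CollectI exI[of _ "i + j"] exI[of _ "r + s"])
        (simp add: algebra_simps)
  next
    fix x s assume "x \<in> {i + r * a |i r. i \<in> I}"
    then obtain i r where "x = i + r * a" "i \<in> I"
      by blast
    then show "s * x \<in> {i + r * a |i r. i \<in> I}"
      using ideal_mult[OF assms] by (intro CollectI exI[of _ "s * i"] exI[of _ "s * r"])
        (simp add: algebra_simps)
  qed
  moreover have "insert a I \<subseteq> {i + r * a | i r. i \<in> I}"
  proof
    fix x assume "x \<in> insert a I"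
    then consider "x = 0 + 1 * a" | "x \<in> I" "x = x + 0 * a" by auto
    then show "x \<in> {i + r * a | i r. i \<in> I}"
      using ideal_zero[OF assms] by cases blast+
  qed
  ultimately show "gen_ideal (insert a I) \<subseteq> {i + r * a | i r. i \<in> I}"
    by (rule gen_ideal_least)
  show "{i + r * a | i r. i \<in> I} \<subseteq> gen_ideal (insert a I)"
    using gen_ideal_superset[of "insert a I"]
    by (auto intro!: ideal_add ideal_mult is_ideal_gen)
qed

lemma gen_ideal_insertE:
  assumes "x \<in> gen_ideal (insert a I)" "is_ideal I"
  obtains i r where "i \<in> I" "x = i + r * a"
  using assms by (auto simp: gen_ideal_insert)

lemma gen_ideal_insert_memI: "a \<in> gen_ideal (insert a I)"
  using gen_ideal_superset by blast

lemma gen_ideal_insert_sub: "I \<subseteq> gen_ideal (insert a I)"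
  using gen_ideal_superset by blast

lemma gen_ideal_insert_gen: "gen_ideal (insert a (gen_ideal X)) = gen_ideal (insert a X)"
  using gen_ideal_Un_gen[of X "{a}"] by simp

lemma radicalI: "f ^ k \<in> J \<Longrightarrow> f \<in> radical J"
  by (auto simp: radical_def)

lemma radical_superset: "J \<subseteq> radical J"
  using radicalI[of _ 1] by auto

lemma radical_mono: "J \<subseteq> L \<Longrightarrow> radical J \<subseteq> radical L"
  by (auto simp: radical_def)

lemma radical_radical: "f \<in> radical (radical J) \<Longrightarrow> f \<in> radical J"
  by (auto simp: radical_def power_mult[symmetric])

lemma ideal_power_add:
  fixes x y :: "'r::comm_ring_1"
  assumes "is_ideal J" "x ^ p \<in> J" "y ^ q \<in> J"
  shows "(x + y) ^ (p + q) \<in> J"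
  unfolding binomial_ring
proof (rule ideal_sum[OF assms(1)])
  fix k
  show "of_nat (p + q choose k) * x ^ k * y ^ (p + q - k) \<in> J"
  proof (cases "p \<le> k")
    case True
    then have "x ^ k = x ^ (k - p) * x ^ p"
      by (simp flip: power_add)
    then have "x ^ k \<in> J"
      using ideal_mult[OF assms(1,2)] by simp
    then show ?thesis
      by (intro ideal_mult2 ideal_mult assms(1))
  next
    case False
    then have "y ^ (p + q - k) = y ^ (p - k) * y ^ q"
      by (simp flip: power_add)
    then have "y ^ (p + q - k) \<in> J"
      using ideal_mult[OF assms(1,3)] by simp
    then show ?thesis
      by (intro ideal_mult assms(1))
  qed
qed

lemma is_ideal_radical:
  assumes "is_ideal J"
  shows "is_ideal (radical J)"
  unfolding is_ideal_def
proof (intro conjI ballI allI)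
  show "0 \<in> radical J"
    using ideal_zero[OF assms] radical_superset by blast
next
  fix a b assume "a \<in> radical J" "b \<in> radical J"
  then show "a + b \<in> radical J"
    using ideal_power_add[OF assms] unfolding radical_def by blast
next
  fix a r assume "a \<in> radical J"
  then show "r * a \<in> radical J"
    using ideal_mult[OF assms] by (auto simp: radical_def power_mult_distrib)
qed

lemma radical_gen_least: "X \<subseteq> radical J \<Longrightarrow> is_ideal J \<Longrightarrow> radical (gen_ideal X) \<subseteq> radical J"
  using radical_mono[OF gen_ideal_least[OF is_ideal_radical, of J X]] radical_radical[of _ J] by auto

text \<open>The zero set of \<open>Q\<close> is the union of those of \<open>Q + (x)\<close> and
  \<open>Q + (y)\<close>. Algebraically, multiplying the two memberships of powers of
  \<open>z\<close> leaves only terms in \<open>Q\<close> and a multiple of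
  \<open>x * y\<close>.\<close>

lemma radical_cases:
  fixes z :: "'r::comm_ring_1"
  assumes Q: "is_ideal Q" and xy: "x * y \<in> Q"
    and zx: "z \<in> radical (gen_ideal (insert x Q))" and zy: "z \<in> radical (gen_ideal (insert y Q))"
  shows "z \<in> radical Q"
proof -
  obtain p q where "z ^ p \<in> gen_ideal (insert x Q)" "z ^ q \<in> gen_ideal (insert y Q)"
    using zx zy by (auto simp: radical_def)
  then obtain i r j s where *: "i \<in> Q" "z ^ p = i + r * x" "j \<in> Q" "z ^ q = j + s * y"
    using gen_ideal_insertE[OF _ Q] by metis
  have "z ^ (p + q) = i * (j + s * y) + (r * x) * j + (r * s) * (x * y)"
    unfolding power_add *(2,4) by (simp add: algebra_simps)
  also have "\<dots> \<in> Q"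
    by (intro ideal_add ideal_mult ideal_mult2 Q * xy)
  finally show ?thesis by (rule radicalI)
qed

text \<open>Regularity on the quotient by \<open>I\<close>, without asking that the quotient be
  nonzero; properness is dealt with once, in \<open>cohen_macaulay_iff\<close>.\<close>

definition nzd :: "'r::comm_ring_1 set \<Rightarrow> 'r \<Rightarrow> bool" where
  "nzd I a \<longleftrightarrow> (\<forall>g. a * g \<in> I \<longrightarrow> g \<in> I)"

text \<open>Each element is absorbed into the ideal, which suits inductions that generalise over
  \<open>I\<close>; \<open>reg_iff_nth\<close> translates to the prefixes
  \<open>pre_ideal\<close>.\<close>

primrec reg :: "'r::comm_ring_1 set \<Rightarrow> 'r list \<Rightarrow> bool" where
  "reg I [] \<longleftrightarrow> True"
| "reg I (a # as) \<longleftrightarrow> nzd I a \<and> reg (gen_ideal (insert a I)) as"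

lemma nzdD: "nzd I a \<Longrightarrow> a * g \<in> I \<Longrightarrow> g \<in> I"
  by (simp add: nzd_def)

lemma nzd_power: "nzd I a \<Longrightarrow> nzd I (a ^ n)"
  unfolding nzd_def by (induction n) (simp, metis mult.assoc power_Suc)

lemma colon_single: "colon J {t} = {g. t * g \<in> J}"
  by (auto simp: colon_def mult.commute)

lemma nzd_iff_colon: "is_ideal J \<Longrightarrow> nzd J t \<longleftrightarrow> colon J {t} = J"
  unfolding colon_single nzd_def using ideal_mult by blast

lemma pre_ideal_0: "is_ideal I \<Longrightarrow> pre_ideal I th 0 = I"
  by (simp add: pre_ideal_def gen_ideal_id)

lemma pre_ideal_Suc: "pre_ideal I (a # as) (Suc i) = pre_ideal (gen_ideal (insert a I)) as i"
  using gen_ideal_Un_gen[of "insert a I" "set (take i as)"] by (simp add: pre_ideal_def)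

lemma is_ideal_pre: "is_ideal (pre_ideal I th i)"
  by (simp add: pre_ideal_def is_ideal_gen)

lemma pre_ideal_superset: "I \<subseteq> pre_ideal I th i"
  using gen_ideal_superset[of "I \<union> set (take i th)"] by (auto simp: pre_ideal_def)

lemma pre_ideal_mem: "j < i \<Longrightarrow> j < length th \<Longrightarrow> th ! j \<in> pre_ideal I th i"
  using gen_ideal_superset[of "I \<union> set (take i th)"]
  by (force simp: pre_ideal_def in_set_conv_nth)

lemma pre_ideal_least:
  "is_ideal J \<Longrightarrow> I \<subseteq> J \<Longrightarrow> (\<And>j. j < i \<Longrightarrow> j < length th \<Longrightarrow> th ! j \<in> J) \<Longrightarrow> pre_ideal I th i \<subseteq> J"
  unfolding pre_ideal_def by (rule gen_ideal_least) (auto simp: in_set_conv_nth)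

lemma reg_iff_nth:
  "is_ideal I \<Longrightarrow> reg I th \<longleftrightarrow> (\<forall>i<length th. nzd (pre_ideal I th i) (th ! i))"
proof (induction th arbitrary: I)
  case (Cons a th)
  show ?case
    by (simp add: Cons.IH[OF is_ideal_gen] All_less_Suc2 pre_ideal_Suc pre_ideal_0[OF Cons.prems])
qed simp

lemma reg_iff_colon:
  "is_ideal I \<Longrightarrow>
    reg I th \<longleftrightarrow> (\<forall>i<length th. colon (pre_ideal I th i) {th ! i} = pre_ideal I th i)"
  by (simp add: reg_iff_nth nzd_iff_colon[OF is_ideal_pre])

lemma reg_append: "is_ideal I \<Longrightarrow> reg I (as @ bs) \<longleftrightarrow> reg I as \<and> reg (gen_ideal (I \<union> set as)) bs"
proof (induction as arbitrary: I)
  case Nil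
  then show ?case by (simp add: gen_ideal_id)
next
  case (Cons a as)
  have "gen_ideal (gen_ideal (insert a I) \<union> set as) = gen_ideal (I \<union> set (a # as))"
    by (simp add: gen_ideal_Un_gen)
  then show ?case by (simp add: Cons.IH[OF is_ideal_gen])
qed

text \<open>A power of \<open>b\<close> is a multiple of \<open>c\<close> modulo \<open>I\<close>, so whatever \<open>c\<close> kills is killed by a power of \<open>b\<close>.\<close>

lemma nzd_exchange:
  assumes I: "is_ideal I" and b: "nzd I b" "b \<in> radical (gen_ideal (insert c I))"
  shows "nzd I c"
  unfolding nzd_def
proof (intro allI impI)
  fix g assume g: "c * g \<in> I"
  obtain k i h where "i \<in> I" "b ^ k = i + h * c"
    using b(2) gen_ideal_insertE[OF _ I] by (auto simp: radical_def) metis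
  then have "b ^ k * g = i * g + h * (c * g)"
    by (simp add: algebra_simps)
  also have "\<dots> \<in> I"
    by (intro ideal_add ideal_mult2 ideal_mult I g \<open>i \<in> I\<close>)
  finally show "g \<in> I"
    using nzdD[OF nzd_power[OF b(1)]] by blast
qed

section \<open>Linear systems\<close>

text \<open>Gaussian elimination: a pivot \<open>x0\<close> for the equation \<open>y\<close> clears
  \<open>y\<close> from the other unknowns, which leaves one unknown and one equation fewer.\<close>

lemma linear_system_nontrivial:
  fixes a :: "'i \<Rightarrow> 'j \<Rightarrow> 'k::field"
  assumes "finite X" "finite Y" "card Y < card X"
  shows "\<exists>c. (\<exists>x\<in>X. c x \<noteq> 0) \<and> (\<forall>y\<in>Y. (\<Sum>x\<in>X. c x * a x y) = 0)"
  using assms(2,1,3)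
proof (induction Y arbitrary: X a rule: finite_induct)
  case empty
  then obtain x where "x \<in> X" by fastforce
  then show ?case by (intro exI[of _ "\<lambda>_. 1"]) auto
next
  case (insert y Y)
  show ?case
  proof (cases "\<forall>x\<in>X. a x y = 0")
    case True
    then show ?thesis
      using insert.IH[of X a] insert.prems insert.hyps by auto
  next
    case False
    then obtain x0 where x0: "x0 \<in> X" "a x0 y \<noteq> 0" by blast
    define a' where "a' x z = a x z - a x y / a x0 y * a x0 z" for x z
    have "card Y < card (X - {x0})"
      using insert.prems insert.hyps x0 by simp
    then obtain c where c: "\<exists>x\<in>X - {x0}. c x \<noteq> 0" "\<forall>z\<in>Y. (\<Sum>x\<in>X - {x0}. c x * a' x z) = 0"
      using insert.IH[of "X - {x0}" a'] insert.prems by auto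
    define s where "s = (\<Sum>x\<in>X - {x0}. c x * a x y)"
    \<comment> \<open>The value at the pivot is forced by equation \<open>y\<close>; the same value
      turns each reduced equation back into the original one.\<close>
    define c' where "c' = c(x0 := - s / a x0 y)"
    have split: "(\<Sum>x\<in>X. c' x * a x z) = - s / a x0 y * a x0 z + (\<Sum>x\<in>X - {x0}. c x * a x z)" for z
      by (subst sum.remove[OF insert.prems(1) x0(1)]) (auto simp: c'_def intro!: sum.cong)
    have "(\<Sum>x\<in>X. c' x * a x y) = 0"
      using x0(2) by (simp add: split flip: s_def)
    moreover have "(\<Sum>x\<in>X. c' x * a x z) = 0" if "z \<in> Y" for z
    proof -
      have "(\<Sum>x\<in>X - {x0}. c x * a' x z) = (\<Sum>x\<in>X - {x0}. c x * a x z) - s / a x0 y * a x0 z"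
        unfolding a'_def s_def
        by (simp add: algebra_simps sum_subtractf sum_distrib_left sum_distrib_right sum_divide_distrib)
      then show ?thesis
        using c(2) that by (simp add: split)
    qed
    moreover have "\<exists>x\<in>X. c' x \<noteq> 0"
      using c(1) by (auto simp: c'_def)
    ultimately show ?thesis by auto
  qed
qed

section \<open>Monomials and gradings\<close>

abbreviation mon :: "'m \<Rightarrow> 'm \<Rightarrow>\<^sub>0 'k::comm_ring_1" where
  "mon m \<equiv> single m 1"

lemma mpoly_expand: "(p :: 'm \<Rightarrow>\<^sub>0 'k::comm_ring_1) = (\<Sum>m\<in>keys p. single m (lookup p m))"
  by (rule poly_mapping_eqI) (simp add: lookup_sum lookup_single when_def in_keys_iff)

lemma mpoly_induct [case_names single add]:
  fixes p :: "'m \<Rightarrow>\<^sub>0 'k::comm_ring_1"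
  assumes "\<And>m c. P (single m c)" "\<And>p q. P p \<Longrightarrow> P q \<Longrightarrow> P (p + q)"
  shows "P p"
proof -
  have "P (\<Sum>m\<in>X. single m (lookup p m))" if "finite X" for X
    using that by (induction X rule: finite_induct) (use assms(1)[of undefined 0] in \<open>auto intro: assms\<close>)
  from this[of "keys p"] show ?thesis
    using mpoly_expand[of p] by simp
qed

lemma lookup_single_times:
  fixes f :: "'m::cancel_comm_monoid_add \<Rightarrow>\<^sub>0 'k::comm_ring_1"
  shows "lookup (single k c * f) (k + m) = c * lookup f m"
proof (induction f rule: mpoly_induct)
  case (single n d)
  have "k + n = k + m \<longleftrightarrow> n = m" by simp
  then show ?case
    unfolding mult_single lookup_single by (simp add: when_def)
qed (simp add: lookup_add algebra_simps)

lemma lookup_single_times_eq_0: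
  fixes f :: "'m::cancel_comm_monoid_add \<Rightarrow>\<^sub>0 'k::comm_ring_1"
  assumes "\<And>m. n \<noteq> k + m"
  shows "lookup (single k c * f) n = 0"
  using assms[THEN not_sym]
  by (induction f rule: mpoly_induct)
    (auto simp: mult_single lookup_single when_def lookup_add algebra_simps)

lemma mon_times: "mon m * mon n = mon (m + n)"
  by (simp add: mult_single)

lemma single_eq_const_mon: "single m c = single 0 c * mon m"
  by (simp add: mult_single)

lemma mon_sum: "finite X \<Longrightarrow> mon (sum f X) = (\<Prod>x\<in>X. mon (f x))"
  by (induction X rule: finite_induct) (auto simp flip: mon_times)

lemma sum_single_times: "(\<Sum>x\<in>X. single m (c x)) = single m (sum c X)"
  by (induction X rule: infinite_finite_induct) (auto simp: single_add)

lemma single_const_mult: "single 0 c * single 0 d = single 0 (c * d)"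
  by (simp add: mult_single)

subsection \<open>Restriction to a set of monomials\<close>

text \<open>One truncation operator serves both for homogeneous components (\<open>hcomp\<close>)
  and for the projection onto the polynomial ring of a face.\<close>

definition restr :: "('m \<Rightarrow> bool) \<Rightarrow> ('m \<Rightarrow>\<^sub>0 'k::comm_ring_1) \<Rightarrow> 'm \<Rightarrow>\<^sub>0 'k" where
  "restr P f = Poly_Mapping.mapp (\<lambda>m c. c when P m) f"

lemma lookup_restr: "lookup (restr P f) m = (if P m then lookup f m else 0)"
  by (simp add: restr_def lookup_mapp when_def in_keys_iff)

lemma keys_restr: "keys (restr P f) = {m \<in> keys f. P m}"
  by (auto simp: in_keys_iff lookup_restr split: if_splits)

lemma restr_add: "restr P (f + g) = restr P f + restr P g"
  by (rule poly_mapping_eqI) (simp add: lookup_restr lookup_add)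

subsection \<open>Degrees\<close>

lemma mono_deg_UNIV: "mono_deg (m :: 'a::finite \<Rightarrow>\<^sub>0 nat) = (\<Sum>v\<in>UNIV. lookup m v)"
  unfolding mono_deg_def by (rule sum.mono_neutral_left) (auto simp: in_keys_iff)

lemma mono_deg_add: "mono_deg (m + n :: 'a::finite \<Rightarrow>\<^sub>0 nat) = mono_deg m + mono_deg n"
  by (simp add: mono_deg_UNIV lookup_add sum.distrib)

lemma mono_deg_0 [simp]: "mono_deg 0 = 0"
  by (simp add: mono_deg_def)

lemma mono_deg_single [simp]: "mono_deg (single v n) = n"
  by (cases "n = 0") (auto simp: mono_deg_def)

lemma mono_deg_eq_0_iff: "mono_deg (m :: 'a::finite \<Rightarrow>\<^sub>0 nat) = 0 \<longleftrightarrow> m = 0"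
  by (simp add: mono_deg_UNIV poly_mapping_eq_iff fun_eq_iff)

lemma exps_add_eq_0_iff: "m + n = 0 \<longleftrightarrow> m = 0 \<and> n = (0 :: 'a::finite \<Rightarrow>\<^sub>0 nat)"
  by (metis add_is_0 mono_deg_add mono_deg_eq_0_iff add_0)

lemma keys_exps_add: "keys (m + n :: 'a \<Rightarrow>\<^sub>0 nat) = keys m \<union> keys n"
  by (auto simp: in_keys_iff lookup_add)

lemma exps_addE:
  assumes "\<And>v. lookup m v \<le> lookup n v"
  obtains k :: "'a \<Rightarrow>\<^sub>0 nat" where "n = m + k"
proof
  show "n = m + (n - m)"
    using assms by (intro poly_mapping_eqI) (simp add: lookup_add lookup_minus)
qed

lemma finite_exps_deg_le: "finite {m :: 'a::finite \<Rightarrow>\<^sub>0 nat. mono_deg m \<le> n}"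
proof (rule finite_subset)
  show "{m :: 'a \<Rightarrow>\<^sub>0 nat. mono_deg m \<le> n} \<subseteq> Abs_poly_mapping ` (UNIV \<rightarrow>\<^sub>E {..n})"
  proof
    fix m :: "'a \<Rightarrow>\<^sub>0 nat" assume "m \<in> {m. mono_deg m \<le> n}"
    then have "lookup m v \<le> n" for v
      using member_le_sum[of v UNIV "lookup m"] by (simp add: mono_deg_UNIV)
    then have "lookup m \<in> UNIV \<rightarrow>\<^sub>E {..n}"
      by auto
    moreover have "Abs_poly_mapping (lookup m) = m"
      by (simp add: poly_mapping.lookup_inverse)
    ultimately show "m \<in> Abs_poly_mapping ` (UNIV \<rightarrow>\<^sub>E {..n})"
      by (metis imageI)
  qed
  show "finite (Abs_poly_mapping ` ((UNIV :: 'a set) \<rightarrow>\<^sub>E {..n}))"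
    by (intro finite_imageI finite_PiE) auto
qed

definition homog :: "nat \<Rightarrow> ('a, 'k::comm_ring_1) mpoly \<Rightarrow> bool" where
  "homog n p \<longleftrightarrow> (\<forall>m\<in>keys p. mono_deg m = n)"

lemma homog_pos_iff: "homog_pos p \<longleftrightarrow> (\<exists>n>0. homog n p)"
  by (simp add: homog_pos_def homog_def)

lemma homog_mult:
  "homog m p \<Longrightarrow> homog n q \<Longrightarrow> homog (m + n) (p * q :: ('a::finite, 'k::comm_ring_1) mpoly)"
  using keys_mult[of p q] by (force simp: homog_def mono_deg_add)

lemma homog_1: "homog 0 (1 :: ('a, 'k::comm_ring_1) mpoly)"
  by (simp add: homog_def)

lemma homog_power: "homog m p \<Longrightarrow> homog (n * m) (p ^ n :: ('a::finite, 'k::comm_ring_1) mpoly)"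
  by (induction n) (auto simp: homog_1 homog_mult)

lemma homog_add: "homog n p \<Longrightarrow> homog n q \<Longrightarrow> homog n (p + q)"
  using keys_add[of p q] by (auto simp: homog_def)

lemma homog_diff: "homog n p \<Longrightarrow> homog n q \<Longrightarrow> homog n (p - q)"
  using keys_diff[of p q] by (auto simp: homog_def)

lemma homog_0: "homog n 0"
  by (simp add: homog_def)

lemma homog_sum: "(\<And>x. x \<in> X \<Longrightarrow> homog n (f x)) \<Longrightarrow> homog n (sum f X)"
  by (induction X rule: infinite_finite_induct) (auto simp: homog_0 homog_add)

lemma homog_mon: "homog (mono_deg m) (single m c)"
  by (simp add: homog_def)

lemma homog_const_times: "homog n p \<Longrightarrow> homog n (single 0 c * p :: ('a::finite, 'k::comm_ring_1) mpoly)"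
  using homog_mult[OF homog_mon[of 0 c], of n p] by simp

lemma homog_var: "homog 1 (var v)"
  using homog_mon[of "single v 1" 1] by (simp add: var_def)

definition hcomp :: "nat \<Rightarrow> ('a, 'k::comm_ring_1) mpoly \<Rightarrow> ('a, 'k) mpoly" where
  "hcomp n = restr (\<lambda>m. mono_deg m = n)"

lemma lookup_hcomp: "lookup (hcomp n f) m = (if mono_deg m = n then lookup f m else 0)"
  by (simp add: hcomp_def lookup_restr)

lemma hcomp_add: "hcomp n (f + g) = hcomp n f + hcomp n g"
  by (simp add: hcomp_def restr_add)

lemma homog_hcomp: "homog n (hcomp n f)"
  by (auto simp: homog_def hcomp_def keys_restr)

lemma hcomp_homog: "homog m f \<Longrightarrow> hcomp n f = (if n = m then f else 0)"
  by (rule poly_mapping_eqI) (auto simp: lookup_hcomp homog_def in_keys_iff)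

lemma hcomp_mult_homog:
  fixes a :: "('a::finite, 'k::comm_ring_1) mpoly"
  assumes "homog e a"
  shows "hcomp n (a * r) = (if e \<le> n then a * hcomp (n - e) r else 0)"
proof (induction r rule: mpoly_induct)
  case (single m c)
  show ?case
    using homog_mon[of m c] homog_mult[OF assms homog_mon[of m c]]
    by (auto simp: hcomp_homog)
next
  case (add p q)
  then show ?case by (auto simp: algebra_simps hcomp_add)
qed

lemma sum_hcomp: "(\<Sum>n\<in>mono_deg ` keys f. hcomp n f) = f"
  by (rule poly_mapping_eqI)
    (auto simp: lookup_sum lookup_hcomp in_keys_iff intro!: image_eqI)

definition hom_ideal :: "('a, 'k::comm_ring_1) mpoly set \<Rightarrow> bool" where
  "hom_ideal I \<longleftrightarrow> is_ideal I \<and> (\<forall>f\<in>I. \<forall>n. hcomp n f \<in> I)"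

lemma hom_ideal_ideal: "hom_ideal I \<Longrightarrow> is_ideal I"
  by (simp add: hom_ideal_def)

lemma hom_ideal_hcomp: "hom_ideal I \<Longrightarrow> f \<in> I \<Longrightarrow> hcomp n f \<in> I"
  by (simp add: hom_ideal_def)

lemma hom_ideal_insert:
  fixes I :: "('a::finite, 'k::comm_ring_1) mpoly set"
  assumes "hom_ideal I" "homog e a"
  shows "hom_ideal (gen_ideal (insert a I))"
  unfolding hom_ideal_def
proof (intro conjI is_ideal_gen ballI allI)
  fix f n assume "f \<in> gen_ideal (insert a I)"
  then obtain i r where i: "i \<in> I" "f = i + a * r"
    using gen_ideal_insertE[OF _ hom_ideal_ideal[OF assms(1)], of f a] by (metis mult.commute)
  then have "hcomp n f = hcomp n i + hcomp n (a * r)"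
    by (simp add: hcomp_add)
  also have "\<dots> \<in> gen_ideal (insert a I)"
  proof (intro ideal_add is_ideal_gen)
    show "hcomp n i \<in> gen_ideal (insert a I)"
      using hom_ideal_hcomp[OF assms(1) i(1)] gen_ideal_insert_sub by blast
    show "hcomp n (a * r) \<in> gen_ideal (insert a I)"
      using gen_ideal_insert_memI[of a I]
      by (auto simp: hcomp_mult_homog[OF assms(2)] intro!: ideal_mult2 ideal_zero is_ideal_gen)
  qed
  finally show "hcomp n f \<in> gen_ideal (insert a I)" .
qed

lemma hom_ideal_Un:
  fixes I :: "('a::finite, 'k::comm_ring_1) mpoly set"
  shows "hom_ideal I \<Longrightarrow> \<forall>t\<in>set th. homog_pos t \<Longrightarrow> hom_ideal (gen_ideal (I \<union> set th))"
proof (induction th arbitrary: I)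
  case Nil
  then show ?case by (simp add: gen_ideal_id hom_ideal_ideal)
next
  case (Cons a th)
  then have "hom_ideal (gen_ideal (insert a I))"
    by (auto simp: homog_pos_iff intro: hom_ideal_insert)
  then show ?case
    using Cons.IH[of "gen_ideal (insert a I)"] Cons.prems gen_ideal_Un_gen[of "insert a I" "set th"]
    by simp
qed

section \<open>Monomial ideals\<close>

text \<open>For arbitrary \<open>M\<close> this is only the linear span of the monomials in
  \<open>M\<close>; it becomes an ideal when \<open>M\<close> is an \<open>upset\<close>. The
  general form is used with \<open>M = keys f\<close> in \<open>homog_spans\<close>.\<close>

definition mon_ideal :: "'m set \<Rightarrow> ('m \<Rightarrow>\<^sub>0 'k::comm_ring_1) set" where
  "mon_ideal M = {f. keys f \<subseteq> M}"

definition upset :: "'m::comm_monoid_add set \<Rightarrow> bool" where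
  "upset M \<longleftrightarrow> (\<forall>m\<in>M. \<forall>n. m + n \<in> M)"

lemma upsetD: "upset M \<Longrightarrow> m \<in> M \<Longrightarrow> m + n \<in> M"
  by (simp add: upset_def)

lemma upsetD2: "upset M \<Longrightarrow> m \<in> M \<Longrightarrow> n + m \<in> M"
  by (simp add: upset_def add.commute)

lemma is_ideal_mon_ideal:
  assumes "upset M"
  shows "is_ideal (mon_ideal M :: ('m::comm_monoid_add \<Rightarrow>\<^sub>0 'k::comm_ring_1) set)"
  unfolding is_ideal_def mon_ideal_def mem_Collect_eq
proof (intro conjI ballI allI)
  fix a b :: "'m \<Rightarrow>\<^sub>0 'k" assume "a \<in> {f. keys f \<subseteq> M}" "b \<in> {f. keys f \<subseteq> M}"
  then show "keys (a + b) \<subseteq> M"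
    using keys_add[of a b] by auto
next
  fix a r :: "'m \<Rightarrow>\<^sub>0 'k" assume "a \<in> {f. keys f \<subseteq> M}"
  then show "keys (r * a) \<subseteq> M"
    using keys_mult[of r a] upsetD2[OF assms] by blast
qed simp

lemma mon_mem_mon_ideal: "mon m \<in> (mon_ideal M :: ('m \<Rightarrow>\<^sub>0 'k::comm_ring_1) set) \<longleftrightarrow> m \<in> M"
  by (simp add: mon_ideal_def)

lemma hom_ideal_mon_ideal: "upset M \<Longrightarrow> hom_ideal (mon_ideal M)"
  unfolding hom_ideal_def
  by (intro conjI is_ideal_mon_ideal) (auto simp: mon_ideal_def hcomp_def keys_restr)

lemma mon_ideal_subset_ideal:
  assumes "is_ideal J" "\<And>m. m \<in> M \<Longrightarrow> mon m \<in> J"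
  shows "mon_ideal M \<subseteq> (J :: ('m::comm_monoid_add \<Rightarrow>\<^sub>0 'k::comm_ring_1) set)"
proof
  fix f :: "'m \<Rightarrow>\<^sub>0 'k" assume f: "f \<in> mon_ideal M"
  have "(\<Sum>m\<in>keys f. single m (lookup f m)) \<in> J"
  proof (rule ideal_sum[OF assms(1)])
    fix m assume "m \<in> keys f"
    then have "mon m \<in> J"
      using f assms(2) by (auto simp: mon_ideal_def)
    then show "single m (lookup f m) \<in> J"
      by (subst single_eq_const_mon) (rule ideal_mult[OF assms(1)])
  qed
  then show "f \<in> J"
    using mpoly_expand[of f] by simp
qed

lemma gen_ideal_mons:
  "gen_ideal (mon ` G) =
    (mon_ideal {m. \<exists>g\<in>G. \<exists>k. m = g + k} :: ('m::comm_monoid_add \<Rightarrow>\<^sub>0 'k::comm_ring_1) set)"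
  (is "?L = mon_ideal ?M")
proof
  have "upset ?M"
    unfolding upset_def by (auto intro: add.assoc)
  then have "is_ideal (mon_ideal ?M :: ('m \<Rightarrow>\<^sub>0 'k) set)"
    by (rule is_ideal_mon_ideal)
  moreover have "mon ` G \<subseteq> (mon_ideal ?M :: ('m \<Rightarrow>\<^sub>0 'k) set)"
    by (auto simp: mon_mem_mon_ideal) (metis add.right_neutral)
  ultimately show "?L \<subseteq> mon_ideal ?M"
    by (rule gen_ideal_least)
  show "mon_ideal ?M \<subseteq> ?L"
  proof (rule mon_ideal_subset_ideal[OF is_ideal_gen])
    fix m assume "m \<in> ?M"
    then obtain g k where g: "g \<in> G" "m = g + k" by blast
    then have "(mon g :: 'm \<Rightarrow>\<^sub>0 'k) \<in> ?L"
      using gen_ideal_superset[of "mon ` G"] by auto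
    then have "(mon g * mon k :: 'm \<Rightarrow>\<^sub>0 'k) \<in> ?L"
      by (rule ideal_mult2[OF is_ideal_gen])
    then show "(mon m :: 'm \<Rightarrow>\<^sub>0 'k) \<in> ?L"
      by (simp add: g mon_times)
  qed
qed

abbreviation expv :: "'a \<Rightarrow> 'a \<Rightarrow>\<^sub>0 nat" where
  "expv v \<equiv> single v 1"

lemma expv_dvd:
  assumes "v \<in> keys u"
  obtains k where "u = expv v + k"
proof (rule exps_addE[of "expv v" u])
  show "lookup (expv v) w \<le> lookup u w" for w
    using assms by (auto simp: lookup_single when_def in_keys_iff Suc_le_eq)
qed

lemma nzd_var:
  assumes "\<And>u. expv v + u \<in> M \<Longrightarrow> u \<in> M"
  shows "nzd (mon_ideal M) (var v :: ('a, 'k::comm_ring_1) mpoly)"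
  unfolding nzd_def
proof (intro allI impI)
  fix f :: "('a, 'k) mpoly" assume f: "var v * f \<in> mon_ideal M"
  have "u \<in> M" if "u \<in> keys f" for u
  proof -
    have "expv v + u \<in> keys (var v * f)"
      using that by (simp add: in_keys_iff lookup_single_times var_def)
    then show ?thesis
      using f assms by (auto simp: mon_ideal_def)
  qed
  then show "f \<in> mon_ideal M"
    by (auto simp: mon_ideal_def)
qed

text \<open>The hypothesis \<open>x\<^sub>v x\<^sub>w \<in> M\<close> makes the coefficient of \<open>x\<^sub>v u\<close> in \<open>(x\<^sub>v - x\<^sub>w) f\<close> equal to that of
  \<open>u\<close> in \<open>f\<close> whenever \<open>x\<^sub>v u \<notin> M\<close>, so no cancellation can occur.\<close>

lemma nzd_var_diff:
  assumes M: "upset M" "expv v + expv w \<in> M" and "v \<noteq> w"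
    and vw: "\<And>u. expv v + u \<in> M \<Longrightarrow> expv w + u \<in> M \<Longrightarrow> u \<in> M"
  shows "nzd (mon_ideal M) (var v - var w :: ('a, 'k::comm_ring_1) mpoly)"
  unfolding nzd_def
proof (intro allI impI)
  fix f :: "('a, 'k) mpoly" assume f: "(var v - var w) * f \<in> mon_ideal M"
  have step: "expv v + u \<in> M"
    if f: "(var v - var w) * f \<in> mon_ideal M" and M2: "expv v + expv w \<in> M" and "v \<noteq> w"
      and u: "u \<in> keys f" for u v w and f :: "('a, 'k) mpoly"
  proof (rule ccontr)
    assume notM: "expv v + u \<notin> M"
    have "expv v + u \<noteq> expv w + m" for m
    proof
      assume "expv v + u = expv w + m"
      then have "lookup (expv v + u) w = lookup (expv w + m) w"
        by simp
      then have "w \<in> keys u"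
        using \<open>v \<noteq> w\<close> by (simp add: lookup_add lookup_single in_keys_iff)
      then obtain k where "u = expv w + k"
        by (rule expv_dvd)
      then have "expv v + u = (expv v + expv w) + k"
        by (simp add: add.assoc)
      then show False
        using notM upsetD[OF M(1) M2, of k] by simp
    qed
    then have "lookup ((var v - var w) * f) (expv v + u) = lookup f u"
      by (simp add: left_diff_distrib lookup_minus var_def lookup_single_times
          lookup_single_times_eq_0)
    then have "expv v + u \<in> keys ((var v - var w) * f)"
      using u by (simp add: in_keys_iff)
    then show False
      using f notM by (auto simp: mon_ideal_def)
  qed
  have "- ((var v - var w) * f) \<in> mon_ideal M"
    using ideal_uminus[OF is_ideal_mon_ideal[OF M(1)] f] .
  then have f': "(var w - var v) * f \<in> mon_ideal M"
    by (simp add: algebra_simps)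
  have "u \<in> M" if "u \<in> keys f" for u
    using step[OF f M(2) \<open>v \<noteq> w\<close> that] step[OF f' _ _ that] M(2) \<open>v \<noteq> w\<close> vw
    by (simp add: add.commute)
  then show "f \<in> mon_ideal M"
    by (auto simp: mon_ideal_def)
qed

section \<open>Renaming of monomials\<close>

text \<open>The linear extension of a map of monomials, multiplicative when \<open>\<rho>\<close> is
  additive. It serves both to change the index type of the variables and to identify variables with
  one another.\<close>

definition push :: "('m \<Rightarrow> 'n) \<Rightarrow> ('m \<Rightarrow>\<^sub>0 'k::comm_ring_1) \<Rightarrow> 'n \<Rightarrow>\<^sub>0 'k" where
  "push \<rho> f = (\<Sum>m\<in>keys f. single (\<rho> m) (lookup f m))"

lemma push_superset: "finite X \<Longrightarrow> keys f \<subseteq> X \<Longrightarrow> push \<rho> f = (\<Sum>m\<in>X. single (\<rho> m) (lookup f m))"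
  unfolding push_def by (rule sum.mono_neutral_left) (auto simp: in_keys_iff)

lemma push_single [simp]: "push \<rho> (single m c) = single (\<rho> m) c"
  by (simp add: push_def)

lemma push_add: "push \<rho> (f + g) = push \<rho> f + push \<rho> g"
proof -
  have "keys (f + g) \<subseteq> keys f \<union> keys g"
    by (rule keys_add)
  then show ?thesis
    by (simp add: push_superset[of "keys f \<union> keys g"] lookup_add single_add sum.distrib)
qed

lemma push_0 [simp]: "push \<rho> 0 = 0"
  by (simp add: push_def)

lemma push_diff: "push \<rho> (f - g) = push \<rho> f - push \<rho> g"
  using push_add[of \<rho> "f - g" g] by (simp add: algebra_simps)

lemma push_mult:
  fixes \<rho> :: "'m::comm_monoid_add \<Rightarrow> 'n::comm_monoid_add"
  assumes "\<And>m n. \<rho> (m + n) = \<rho> m + \<rho> n"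
  shows "push \<rho> (f * g :: 'm \<Rightarrow>\<^sub>0 'k::comm_ring_1) = push \<rho> f * push \<rho> g"
proof (induction f rule: mpoly_induct)
  case (single m c)
  show ?case
    by (induction g rule: mpoly_induct)
      (auto simp: mult_single assms push_add algebra_simps)
qed (simp add: algebra_simps push_add)

lemma push_eq_0:
  assumes "inj \<rho>" "push \<rho> f = 0"
  shows "f = 0"
proof (rule poly_mapping_eqI)
  fix m
  have "lookup (push \<rho> f) (\<rho> m) = (\<Sum>n\<in>keys f. if n = m then lookup f n else 0)"
    unfolding push_def lookup_sum
    by (intro sum.cong) (auto simp: lookup_single when_def injD[OF assms(1)])
  also have "\<dots> = lookup f m"
    by (simp add: in_keys_iff)
  finally show "lookup f m = lookup 0 m"
    using assms(2) by simp
qed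

definition rename :: "('a::finite \<Rightarrow> 'b) \<Rightarrow> ('a \<Rightarrow>\<^sub>0 nat) \<Rightarrow> 'b \<Rightarrow>\<^sub>0 nat" where
  "rename r m = (\<Sum>v\<in>UNIV. single (r v) (lookup m v))"

lemma rename_add: "rename r (m + n) = rename r m + rename r n"
  by (simp add: rename_def lookup_add single_add sum.distrib)

lemma rename_expv: "rename r (expv v) = expv (r v)"
proof -
  have "rename r (expv v) = (\<Sum>w\<in>UNIV. if w = v then expv (r v) else 0)"
    unfolding rename_def by (intro sum.cong) (auto simp: lookup_single when_def)
  then show ?thesis by simp
qed

lemma inj_rename:
  assumes "inj r"
  shows "inj (rename r)"
proof (rule injI, rule poly_mapping_eqI)
  fix m n v assume "rename r m = rename r n"
  then have "lookup (rename r m) (r v) = lookup (rename r n) (r v)"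
    by simp
  moreover have "lookup (rename r m) (r v) = lookup m v" for m
  proof -
    have "lookup (rename r m) (r v) = (\<Sum>w\<in>UNIV. if w = v then lookup m w else 0)"
      unfolding rename_def lookup_sum
      by (intro sum.cong) (auto simp: lookup_single when_def injD[OF assms])
    then show ?thesis by simp
  qed
  ultimately show "lookup m v = lookup n v" by simp
qed

text \<open>Exponent vectors indexed by \<open>nat\<close> are linearly ordered, so the polynomials
  over them have no zero divisors; an injection of the finite index type into \<open>nat\<close>
  carries this over.\<close>

lemma mpoly_no_zero_divisors:
  fixes f g :: "('a::finite, 'k::idom) mpoly"
  assumes "f * g = 0"
  shows "f = 0 \<or> g = 0"
proof -
  obtain e :: "'a \<Rightarrow> nat" where "inj e"
    using finite_imp_inj_to_nat_seg[of "UNIV :: 'a set"] by auto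
  then have e: "inj (rename e)"
    by (rule inj_rename)
  have "push (rename e) f * push (rename e) g = 0"
    using assms push_mult[of "rename e" f g, OF rename_add] by simp
  then show ?thesis
    using push_eq_0[OF e] by (metis mult_eq_0_iff)
qed

section \<open>Stanley-Reisner ideals and the maximal homogeneous ideal\<close>

definition down_closed :: "'a set set \<Rightarrow> bool" where
  "down_closed D \<longleftrightarrow> (\<forall>F\<in>D. \<forall>G\<subseteq>F. G \<in> D)"

lemma down_closedD: "down_closed D \<Longrightarrow> F \<in> D \<Longrightarrow> G \<subseteq> F \<Longrightarrow> G \<in> D"
  by (auto simp: down_closed_def)

definition sqfree :: "'a::finite set \<Rightarrow> 'a \<Rightarrow>\<^sub>0 nat" where
  "sqfree F = (\<Sum>v\<in>F. expv v)"

lemma lookup_sqfree: "lookup (sqfree F) v = (if v \<in> F then 1 else 0)"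
  by (simp add: sqfree_def lookup_sum lookup_single when_def)

lemma keys_sqfree [simp]: "keys (sqfree F) = F"
  by (auto simp: in_keys_iff lookup_sqfree split: if_splits)

lemma mono_deg_sqfree [simp]: "mono_deg (sqfree F) = card F"
  by (simp add: mono_deg_def lookup_sqfree)

lemma prod_var: "(\<Prod>v\<in>F. var v) = (mon (sqfree F) :: ('a::finite, 'k::comm_ring_1) mpoly)"
  by (simp add: sqfree_def mon_sum var_def)

lemma var_power: "var v ^ n = (mon (single v n) :: ('a, 'k::comm_ring_1) mpoly)"
proof (induction n)
  case (Suc n)
  then show ?case
    by (simp add: var_def mon_times flip: single_add)
qed simp

lemma sqfree_dvd_iff: "(\<exists>k. m = sqfree F + k) \<longleftrightarrow> F \<subseteq> keys m"
proof
  assume "\<exists>k. m = sqfree F + k"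
  then obtain k where "m = sqfree F + k" ..
  then show "F \<subseteq> keys m" by (simp add: keys_exps_add)
next
  assume "F \<subseteq> keys m"
  then have "lookup (sqfree F) v \<le> lookup m v" for v
    by (auto simp: lookup_sqfree in_keys_iff Suc_le_eq)
  then show "\<exists>k. m = sqfree F + k"
    by (metis exps_addE)
qed

lemma SR_ideal_eq:
  assumes "down_closed D"
  shows "SR_ideal TYPE('k::comm_ring_1) D = mon_ideal {m. keys m \<notin> D}"
proof -
  have "{(\<Prod>v\<in>F. var v) | F. F \<notin> D} = (mon ` sqfree ` (- D) :: ('a, 'k) mpoly set)"
    by (auto simp: prod_var)
  moreover have "{m. \<exists>g\<in>sqfree ` (- D). \<exists>k. m = g + k} = {m. keys m \<notin> D}"
  proof -
    have "(\<exists>F\<in>- D. F \<subseteq> keys m) \<longleftrightarrow> keys m \<notin> D" for m :: "'a \<Rightarrow>\<^sub>0 nat"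
      using assms by (auto dest: down_closedD)
    then show ?thesis by (simp add: sqfree_dvd_iff)
  qed
  ultimately show ?thesis
    by (simp add: SR_ideal_def gen_ideal_mons)
qed

lemma upset_nonfaces:
  assumes "down_closed D"
  shows "upset {m :: 'a \<Rightarrow>\<^sub>0 nat. keys m \<notin> D}"
  unfolding upset_def by (auto simp: keys_exps_add dest: down_closedD[OF assms, OF _ Un_upper1])

lemma is_ideal_SR: "is_ideal (SR_ideal K D)"
  by (simp add: SR_ideal_def is_ideal_gen)

lemma hom_ideal_SR: "down_closed D \<Longrightarrow> hom_ideal (SR_ideal TYPE('k::comm_ring_1) D)"
  by (simp add: SR_ideal_eq hom_ideal_mon_ideal upset_nonfaces)

lemma mon_in_SR:
  "down_closed D \<Longrightarrow> (mon m :: ('a::finite, 'k::comm_ring_1) mpoly) \<in> SR_ideal TYPE('k) D \<longleftrightarrow> keys m \<notin> D"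
  by (simp add: SR_ideal_eq mon_mem_mon_ideal)

lemma max_homog_eq: "max_homog TYPE('k::comm_ring_1) = (mon_ideal {m. m \<noteq> 0} :: ('a::finite, 'k) mpoly set)"
proof -
  have "range var = (mon ` range expv :: ('a, 'k) mpoly set)"
    by (auto simp: var_def)
  moreover have "{m. \<exists>g\<in>range expv. \<exists>k. m = g + k} = {m :: 'a \<Rightarrow>\<^sub>0 nat. m \<noteq> 0}"
  proof (intro set_eqI iffI)
    fix m :: "'a \<Rightarrow>\<^sub>0 nat" assume "m \<in> {m. m \<noteq> 0}"
    then obtain v where "v \<in> keys m"
      using keys_eq_empty by blast
    then show "m \<in> {m. \<exists>g\<in>range expv. \<exists>k. m = g + k}"
      using expv_dvd by (metis (mono_tags, lifting) mem_Collect_eq rangeI)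
  next
    fix m :: "'a \<Rightarrow>\<^sub>0 nat" assume "m \<in> {m. \<exists>g\<in>range expv. \<exists>k. m = g + k}"
    then obtain v k where "m = expv v + k" by blast
    then have "v \<in> keys m" by (simp add: keys_exps_add)
    then show "m \<in> {m. m \<noteq> 0}" by auto
  qed
  ultimately show ?thesis
    by (simp add: max_homog_def gen_ideal_mons)
qed

lemma is_ideal_max_homog: "is_ideal (max_homog K)"
  by (simp add: max_homog_def is_ideal_gen)

lemma var_in_max_homog: "var v \<in> max_homog K"
  using gen_ideal_superset[of "range var"] by (auto simp: max_homog_def)

lemma max_homog_iff: "f \<in> max_homog TYPE('k::comm_ring_1) \<longleftrightarrow> lookup (f :: ('a::finite, 'k) mpoly) 0 = 0"
  by (auto simp: max_homog_eq mon_ideal_def in_keys_iff)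

lemma homog_in_max_homog:
  "homog n (f :: ('a::finite, 'k::comm_ring_1) mpoly) \<Longrightarrow> n > 0 \<Longrightarrow> f \<in> max_homog TYPE('k)"
  by (auto simp: max_homog_eq mon_ideal_def homog_def)

lemma homog_pos_in_max_homog:
  "homog_pos (f :: ('a::finite, 'k::comm_ring_1) mpoly) \<Longrightarrow> f \<in> max_homog TYPE('k)"
  by (auto simp: homog_pos_iff homog_in_max_homog)

lemma lookup_mult_0: "lookup (f * g :: ('a::finite, 'k::comm_ring_1) mpoly) 0 = lookup f 0 * lookup g 0"
proof (induction f rule: mpoly_induct)
  case (single m c)
  show ?case
    by (induction g rule: mpoly_induct)
      (auto simp: mult_single lookup_single when_def exps_add_eq_0_iff lookup_add algebra_simps)
qed (simp add: algebra_simps lookup_add)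

lemma radical_max_homog:
  "radical (max_homog TYPE('k::idom)) \<subseteq> (max_homog TYPE('k) :: ('a::finite, 'k) mpoly set)"
proof
  fix f :: "('a, 'k) mpoly" assume "f \<in> radical (max_homog TYPE('k))"
  then obtain k where "lookup (f ^ k) 0 = 0"
    by (auto simp: radical_def max_homog_iff)
  moreover have "lookup (f ^ k) 0 = lookup f 0 ^ k"
    by (induction k) (auto simp: lookup_mult_0)
  ultimately show "f \<in> max_homog TYPE('k)"
    by (simp add: max_homog_iff)
qed

text \<open>The radical condition of \<open>hsop\<close> reduced to one inclusion and to variables;
  the reverse inclusion is automatic for homogeneous elements of positive degree, see
  \<open>hsop_iff\<close>.\<close>

definition par :: "('a, 'k::comm_ring_1) mpoly set \<Rightarrow> ('a, 'k) mpoly list \<Rightarrow> bool" where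
  "par I th \<longleftrightarrow> range var \<subseteq> radical (gen_ideal (I \<union> set th))"

lemma max_homog_subset_radical:
  "is_ideal J \<Longrightarrow> max_homog K \<subseteq> radical J \<longleftrightarrow> range var \<subseteq> radical J"
  unfolding max_homog_def
  using gen_ideal_least[OF is_ideal_radical, of J "range var"]
    subset_trans[OF gen_ideal_superset[of "range var"], of "radical J"] by argo

lemma hsop_iff:
  fixes I :: "('a::finite, 'k::idom) mpoly set"
  assumes "I \<subseteq> max_homog TYPE('k)"
  shows "hsop TYPE('k) I th \<longleftrightarrow>
    length th = krull_dim_quot I \<and> (\<forall>t\<in>set th. homog_pos t) \<and> par I th"
proof -
  have "radical (gen_ideal (I \<union> set th)) = max_homog TYPE('k) \<longleftrightarrow> par I th"
    if "\<forall>t\<in>set th. homog_pos t"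
  proof -
    have "gen_ideal (I \<union> set th) \<subseteq> max_homog TYPE('k)"
      using assms that homog_pos_in_max_homog by (intro gen_ideal_least is_ideal_max_homog) auto
    then have "radical (gen_ideal (I \<union> set th)) \<subseteq> max_homog TYPE('k)"
      using radical_max_homog radical_mono by blast
    then show ?thesis
      using max_homog_subset_radical[OF is_ideal_gen, of "TYPE('k)" "I \<union> set th"]
      by (auto simp: par_def)
  qed
  then show ?thesis
    by (auto simp: hsop_def pre_ideal_def)
qed

lemma SR_subset_max_homog:
  "{} \<in> D \<Longrightarrow> down_closed D \<Longrightarrow> SR_ideal TYPE('k::comm_ring_1) D \<subseteq> max_homog TYPE('k)"
  by (auto simp: SR_ideal_eq max_homog_eq mon_ideal_def)

section \<open>Permuting and exchanging homogeneous regular sequences\<close>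

text \<open>Since \<open>I\<close> and \<open>b\<close> are graded, \<open>b * g\<close> lies in
  \<open>I\<close> only if \<open>b\<close> times each component of \<open>g\<close> does. This
  makes induction on the degree available in \<open>nzd_swap\<close>.\<close>

lemma nzd_homogI:
  fixes I :: "('a::finite, 'k::comm_ring_1) mpoly set"
  assumes I: "hom_ideal I" and b: "homog d b" and *: "\<And>n g. homog n g \<Longrightarrow> b * g \<in> I \<Longrightarrow> g \<in> I"
  shows "nzd I b"
  unfolding nzd_def
proof (intro allI impI)
  fix g assume g: "b * g \<in> I"
  have "hcomp n g \<in> I" for n
  proof (rule *[OF homog_hcomp])
    have "hcomp (d + n) (b * g) \<in> I"
      by (rule hom_ideal_hcomp[OF I g])
    then show "b * hcomp n g \<in> I"
      by (simp add: hcomp_mult_homog[OF b])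
  qed
  then have "(\<Sum>n\<in>mono_deg ` keys g. hcomp n g) \<in> I"
    by (intro ideal_sum hom_ideal_ideal[OF I])
  then show "g \<in> I" by (simp add: sum_hcomp)
qed

text \<open>A graded Nakayama argument: an element killed by \<open>b\<close> lies in
  \<open>I + (a)\<close>, and after removing a part in \<open>I\<close> it is \<open>a * r'\<close>.
  Cancelling \<open>a\<close> shows that \<open>r'\<close> is killed by \<open>b\<close> too, in a
  degree lower by \<open>e > 0\<close>.\<close>

lemma nzd_swap:
  fixes I :: "('a::finite, 'k::comm_ring_1) mpoly set"
  assumes I: "hom_ideal I" and a: "homog e a" "e > 0" and b: "homog d b"
    and nzd: "nzd I a" "nzd (gen_ideal (insert a I)) b"
  shows "nzd I b" "nzd (gen_ideal (insert b I)) a"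
proof -
  note id = hom_ideal_ideal[OF I]
  have homI: "g \<in> I" if "homog n g" "b * g \<in> I" for n g
    using that
  proof (induction n arbitrary: g rule: less_induct)
    case (less n)
    have "b * g \<in> gen_ideal (insert a I)"
      using less.prems gen_ideal_insert_sub by blast
    then have "g \<in> gen_ideal (insert a I)"
      by (rule nzdD[OF nzd(2)])
    then obtain i r where i: "i \<in> I" "g = i + a * r"
      using id by (metis gen_ideal_insertE mult.commute)
    have g: "g = hcomp n i + hcomp n (a * r)"
      using hcomp_homog[OF less.prems(1), of n] i by (simp add: hcomp_add)
    have i': "hcomp n i \<in> I"
      by (rule hom_ideal_hcomp[OF I i(1)])
    show ?case
    proof (cases "e \<le> n")
      case False
      then show ?thesis
        using g i' by (simp add: hcomp_mult_homog[OF a(1)])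
    next
      case True
      define r' where "r' = hcomp (n - e) r"
      have g': "g = hcomp n i + a * r'"
        using g True by (simp add: hcomp_mult_homog[OF a(1)] r'_def)
      have "a * (b * r') = b * g - b * hcomp n i"
        by (simp add: g' algebra_simps)
      also have "\<dots> \<in> I"
        by (intro ideal_diff ideal_mult id less.prems i')
      finally have "b * r' \<in> I"
        by (rule nzdD[OF nzd(1)])
      then have "r' \<in> I"
        using less.IH[of "n - e" r'] True a(2) by (simp add: r'_def homog_hcomp)
      then show ?thesis
        by (simp add: g' ideal_add ideal_mult id i')
    qed
  qed
  then show "nzd I b"
    by (rule nzd_homogI[OF I b])
  show "nzd (gen_ideal (insert b I)) a"
    unfolding nzd_def
  proof (intro allI impI)
    fix g assume "a * g \<in> gen_ideal (insert b I)"
    then obtain i h where i: "i \<in> I" "a * g = i + h * b"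
      using id by (metis gen_ideal_insertE)
    \<comment> \<open>Read modulo \<open>a\<close>, the relation puts \<open>h\<close> into
      \<open>I + (a)\<close>. Substituting this back leaves a multiple of \<open>a\<close> inside
      \<open>I\<close>, from which \<open>a\<close> cancels.\<close>
    then have "b * h = - i + g * a"
      by (simp add: algebra_simps)
    also have "\<dots> \<in> gen_ideal (insert a I)"
      using ideal_uminus[OF id i(1)] unfolding gen_ideal_insert[OF id] by blast
    finally have "h \<in> gen_ideal (insert a I)"
      by (rule nzdD[OF nzd(2)])
    then obtain j s where j: "j \<in> I" "h = j + s * a"
      using id by (metis gen_ideal_insertE)
    have "a * (g - s * b) = i + j * b"
      using i(2) j(2) by (simp add: algebra_simps)
    also have "\<dots> \<in> I"
      by (intro ideal_add ideal_mult2 id i j)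
    finally have "g - s * b \<in> I"
      by (rule nzdD[OF nzd(1)])
    moreover have "g = (g - s * b) + s * b" by simp
    ultimately show "g \<in> gen_ideal (insert b I)"
      unfolding gen_ideal_insert[OF id] by blast
  qed
qed

text \<open>By \<open>nzd_swap\<close> neighbouring homogeneous elements of a regular sequence
  commute, so the last one can travel to the front.\<close>

lemma reg_rotate:
  fixes I :: "('a::finite, 'k::comm_ring_1) mpoly set"
  assumes "hom_ideal I" "\<forall>t\<in>set as. homog_pos t" "homog_pos c"
  shows "reg I (as @ [c]) \<longleftrightarrow> reg I (c # as)"
  using assms
proof (induction as arbitrary: I)
  case (Cons a as)
  obtain d e where c: "homog d c" "d > 0" and a: "homog e a" "e > 0"
    using Cons.prems by (auto simp: homog_pos_iff)
  have "hom_ideal (gen_ideal (insert a I))"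
    using hom_ideal_insert[OF Cons.prems(1) a(1)] .
  then have "reg I ((a # as) @ [c]) \<longleftrightarrow>
      nzd I a \<and> nzd (gen_ideal (insert a I)) c \<and> reg (gen_ideal (insert c (insert a I))) as"
    using Cons by (simp add: gen_ideal_insert_gen)
  also have "\<dots> \<longleftrightarrow>
      nzd I c \<and> nzd (gen_ideal (insert c I)) a \<and> reg (gen_ideal (insert a (insert c I))) as"
    using nzd_swap[OF Cons.prems(1) a c(1)] nzd_swap[OF Cons.prems(1) c a(1)]
    unfolding insert_commute[of c a I] by blast
  finally show ?case
    by (simp add: gen_ideal_insert_gen)
qed simp

section \<open>A common parameter\<close>

definition spans :: "('a, 'k::comm_ring_1) mpoly set \<Rightarrow> 'y set \<Rightarrow> ('y \<Rightarrow> ('a, 'k) mpoly) \<Rightarrow> ('a, 'k) mpoly \<Rightarrow> bool" where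
  "spans I Y g f \<longleftrightarrow> (\<exists>c. f - (\<Sum>y\<in>Y. single 0 (c y) * g y) \<in> I)"

lemma sum_in_ideal_if_spans:
  fixes I :: "('a, 'k::comm_ring_1) mpoly set"
  assumes I: "is_ideal I"
    and c: "\<And>x. x \<in> X \<Longrightarrow> f x - (\<Sum>y\<in>Y. single 0 (c x y) * g y) \<in> I"
    and \<gamma>: "\<And>y. y \<in> Y \<Longrightarrow> (\<Sum>x\<in>X. \<gamma> x * c x y) = 0"
  shows "(\<Sum>x\<in>X. single 0 (\<gamma> x) * f x) \<in> I"
proof -
  have "(\<Sum>x\<in>X. single 0 (\<gamma> x) * (\<Sum>y\<in>Y. single 0 (c x y) * g y)) =
      (\<Sum>y\<in>Y. \<Sum>x\<in>X. single 0 (\<gamma> x * c x y) * g y)"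
    unfolding sum_distrib_left
    by (subst sum.swap) (simp flip: mult.assoc add: single_const_mult)
  also have "\<dots> = (\<Sum>y\<in>Y. single 0 (\<Sum>x\<in>X. \<gamma> x * c x y) * g y)"
    by (simp flip: sum_distrib_right add: sum_single_times)
  also have "\<dots> = 0"
    by (simp add: \<gamma>)
  finally have "(\<Sum>x\<in>X. single 0 (\<gamma> x) * f x) =
      (\<Sum>x\<in>X. single 0 (\<gamma> x) * (f x - (\<Sum>y\<in>Y. single 0 (c x y) * g y)))"
    by (simp add: right_diff_distrib sum_subtractf)
  also have "\<dots> \<in> I"
    by (intro ideal_sum I ideal_mult c)
  finally show ?thesis .
qed

text \<open>Vanishing modulo \<open>I\<close> costs at most \<open>card Y\<close> linear conditions
  on the coefficients and vanishing modulo \<open>J\<close> at most \<open>card Z\<close>; the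
  disjoint sum of the index sets merges them into one system.\<close>

lemma linear_dependence_mod:
  fixes I J :: "('a, 'k::field) mpoly set" and f :: "'x \<Rightarrow> ('a, 'k) mpoly"
  assumes "is_ideal I" "is_ideal J" "finite X" "finite Y" "finite Z" "card Y + card Z < card X"
    and "\<And>x. x \<in> X \<Longrightarrow> spans I Y g (f x)" "\<And>x. x \<in> X \<Longrightarrow> spans J Z h (f x)"
  shows "\<exists>\<gamma>. (\<exists>x\<in>X. \<gamma> x \<noteq> 0) \<and> (\<Sum>x\<in>X. single 0 (\<gamma> x) * f x) \<in> I \<inter> J"
proof -
  obtain c where c: "\<And>x. x \<in> X \<Longrightarrow> f x - (\<Sum>y\<in>Y. single 0 (c x y) * g y) \<in> I"
    using assms(7) unfolding spans_def by metis
  obtain d where d: "\<And>x. x \<in> X \<Longrightarrow> f x - (\<Sum>y\<in>Z. single 0 (d x y) * h y) \<in> J"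
    using assms(8) unfolding spans_def by metis
  have "card (Y <+> Z) < card X"
    using assms by (simp add: card_Plus)
  then obtain \<gamma> where \<gamma>: "\<exists>x\<in>X. \<gamma> x \<noteq> 0"
      "\<forall>y\<in>Y <+> Z. (\<Sum>x\<in>X. \<gamma> x * case_sum (c x) (d x) y) = 0"
    using linear_system_nontrivial[of X "Y <+> Z" "\<lambda>x. case_sum (c x) (d x)"] assms by auto
  have "(\<Sum>x\<in>X. \<gamma> x * c x y) = 0" if "y \<in> Y" for y
    using \<gamma>(2)[rule_format, OF InlI[OF that]] by simp
  moreover have "(\<Sum>x\<in>X. \<gamma> x * d x y) = 0" if "y \<in> Z" for y
    using \<gamma>(2)[rule_format, OF InrI[OF that]] by simp
  ultimately have "(\<Sum>x\<in>X. single 0 (\<gamma> x) * f x) \<in> I" "(\<Sum>x\<in>X. single 0 (\<gamma> x) * f x) \<in> J"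
    by (auto intro!: sum_in_ideal_if_spans[OF assms(1) c] sum_in_ideal_if_spans[OF assms(2) d])
  then show ?thesis
    using \<gamma>(1) by blast
qed

text \<open>Pigeonhole: if some power \<open>k v\<close> of every variable lies in \<open>J\<close>,
  a monomial of degree above the sum of all \<open>k v\<close> contains one of these powers.\<close>

lemma high_degree_mem:
  fixes J :: "('a::finite, 'k::comm_ring_1) mpoly set"
  assumes "is_ideal J" "range var \<subseteq> radical J"
  obtains M where "\<And>m. M \<le> mono_deg m \<Longrightarrow> mon m \<in> J"
proof -
  have "\<exists>k. var v ^ k \<in> J" for v
    using assms(2) by (auto simp: radical_def)
  then obtain k where k: "\<And>v. var v ^ k v \<in> J"
    by metis
  show ?thesis
  proof
    fix m :: "'a \<Rightarrow>\<^sub>0 nat" assume m: "Suc (sum k UNIV) \<le> mono_deg m"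
    have "\<exists>v. k v \<le> lookup m v"
    proof (rule ccontr)
      assume "\<not> ?thesis"
      then have "mono_deg m \<le> sum k UNIV"
        unfolding mono_deg_UNIV by (intro sum_mono) (meson le_cases)
      then show False using m by simp
    qed
    then obtain v where "k v \<le> lookup m v" ..
    then have "lookup (single v (k v)) w \<le> lookup m w" for w
      by (auto simp: lookup_single when_def)
    then obtain n where "m = single v (k v) + n"
      by (rule exps_addE)
    then have "mon m = var v ^ k v * (mon n :: ('a, 'k) mpoly)"
      by (simp add: var_power mon_times)
    then show "(mon m :: ('a, 'k) mpoly) \<in> J"
      using ideal_mult2[OF assms(1) k[of v], of "mon n"] by simp
  qed
qed

text \<open>Modulo \<open>I\<close> everything is generated over the powers of \<open>b\<close> by
  the monomials of degree below \<open>M\<close>. In a fixed degree each such monomial needs just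
  one power of \<open>b\<close>, so the number of spanning elements does not grow with
  \<open>n\<close>.\<close>

lemma homog_spans:
  fixes I :: "('a::finite, 'k::comm_ring_1) mpoly set"
  assumes I: "hom_ideal I" and b: "homog e b" "e > 0"
    and M: "\<And>m. M \<le> mono_deg m \<Longrightarrow> mon m \<in> gen_ideal (insert b I)"
    and f: "homog n f"
  shows "\<exists>c. (\<forall>u. c u \<noteq> 0 \<longrightarrow> mono_deg u \<le> n) \<and>
    f - (\<Sum>u | mono_deg u < M. single 0 (c u) * (b ^ ((n - mono_deg u) div e) * mon u)) \<in> I"
  using f
proof (induction n arbitrary: f rule: less_induct)
  case (less n)
  note id = hom_ideal_ideal[OF I]
  have fin: "finite {u :: 'a \<Rightarrow>\<^sub>0 nat. mono_deg u < M}"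
    by (rule finite_subset[OF _ finite_exps_deg_le[of M]]) auto
  show ?case
  proof (cases "n < M")
    case True
    have "(\<Sum>u | mono_deg u < M. single 0 (lookup f u) * (b ^ ((n - mono_deg u) div e) * mon u))
        = (\<Sum>u\<in>keys f. single 0 (lookup f u) * (b ^ ((n - mono_deg u) div e) * mon u))"
      using less.prems True fin by (intro sum.mono_neutral_right) (auto simp: homog_def in_keys_iff)
    also have "\<dots> = (\<Sum>u\<in>keys f. single u (lookup f u))"
      using less.prems by (intro sum.cong) (auto simp: homog_def mult_single)
    also have "\<dots> = f"
      by (rule mpoly_expand[symmetric])
    finally show ?thesis
      using less.prems ideal_zero[OF id]
      by (intro exI[of _ "lookup f"]) (auto simp: homog_def in_keys_iff)
  next
    case False
    have "mon_ideal (keys f) \<subseteq> gen_ideal (insert b I)"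
      using less.prems False by (intro mon_ideal_subset_ideal is_ideal_gen M) (auto simp: homog_def)
    then have "f \<in> gen_ideal (insert b I)"
      by (auto simp: mon_ideal_def)
    then obtain i r where i: "i \<in> I" "f = i + b * r"
      using id by (metis gen_ideal_insertE mult.commute)
    have f: "f = hcomp n i + hcomp n (b * r)"
      using hcomp_homog[OF less.prems(1), of n] i by (simp add: hcomp_add)
    have i': "hcomp n i \<in> I"
      by (rule hom_ideal_hcomp[OF I i(1)])
    show ?thesis
    proof (cases "e \<le> n")
      case False
      then have "f \<in> I"
        using f i' by (simp add: hcomp_mult_homog[OF b(1)])
      then show ?thesis by (intro exI[of _ "\<lambda>_. 0"]) auto
    next
      case True
      define g where "g = hcomp (n - e) r"
      have fg: "f = hcomp n i + b * g"
        using f True by (simp add: hcomp_mult_homog[OF b(1)] g_def)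
      obtain c where c: "\<forall>u. c u \<noteq> 0 \<longrightarrow> mono_deg u \<le> n - e"
        "g - (\<Sum>u | mono_deg u < M. single 0 (c u) * (b ^ ((n - e - mono_deg u) div e) * mon u)) \<in> I"
        using less.IH[of "n - e" g] b(2) True by (auto simp: g_def homog_hcomp)
      have "single 0 (c u) * (b ^ ((n - mono_deg u) div e) * mon u) =
          b * (single 0 (c u) * (b ^ ((n - e - mono_deg u) div e) * mon u))" for u
      proof (cases "c u = 0")
        case False
        \<comment> \<open>The bound \<open>mono_deg u \<le> n - e\<close> for nonzero
          \<open>c u\<close> rules out truncation in the subtraction, so adding \<open>e\<close>
          raises the quotient by exactly one.\<close>
        then have eq: "n - mono_deg u = (n - e - mono_deg u) + e"
          using c(1)[rule_format, of u] True by simp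
        have "(n - mono_deg u) div e = Suc ((n - e - mono_deg u) div e)"
          using b(2) by (subst eq, subst div_add_self2) auto
        then show ?thesis by (simp add: mult_ac)
      qed simp
      then have "f - (\<Sum>u | mono_deg u < M. single 0 (c u) * (b ^ ((n - mono_deg u) div e) * mon u))
          = hcomp n i + b * (g - (\<Sum>u | mono_deg u < M.
              single 0 (c u) * (b ^ ((n - e - mono_deg u) div e) * mon u)))"
        by (simp add: fg right_diff_distrib sum_distrib_left)
      also have "\<dots> \<in> I"
        by (intro ideal_add ideal_mult id i' c(2))
      finally show ?thesis
        using c(1) by (intro exI[of _ c]) auto
    qed
  qed
qed

text \<open>Let \<open>F = \<Sum>\<^sub>i \<gamma>\<^sub>i x\<^sup>i y\<^bsup>N-i\<^esup>\<close> be a nonzero form vanishing in \<open>S / L\<close> and write \<open>F = y\<^bsup>N-n\<^esup> H\<close> with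
  \<open>x\<^sup>n\<close> occurring in \<open>H\<close>. Then \<open>x H + y\<^bsup>n+1\<^esup>\<close> is coprime to \<open>F\<close>, so it generates together with \<open>F\<close>
  an ideal whose radical contains \<open>x\<close> and \<open>y\<close>.\<close>

lemma coprime_form:
  fixes x y :: "('a::finite, 'k::field) mpoly"
  assumes \<gamma>: "\<exists>i\<in>{..N}. \<gamma> i \<noteq> 0"
  obtains n H where "H = (\<Sum>i\<le>n. single 0 (\<gamma> i) * (x ^ i * y ^ (n - i)))"
    "\<And>L. is_ideal L \<Longrightarrow> (\<Sum>i\<le>N. single 0 (\<gamma> i) * (x ^ i * y ^ (N - i))) \<in> L \<Longrightarrow>
      {x, y} \<subseteq> radical (gen_ideal (insert (x * H + y ^ Suc n) L))"
proof -
  define n where "n = Max {i \<in> {..N}. \<gamma> i \<noteq> 0}"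
  have "n \<in> {i \<in> {..N}. \<gamma> i \<noteq> 0}"
    unfolding n_def using \<gamma> by (intro Max_in) auto
  then have n: "n \<le> N" "\<gamma> n \<noteq> 0" by auto
  have n_max: "\<gamma> i = 0" if "n < i" "i \<le> N" for i
  proof (rule ccontr)
    assume "\<gamma> i \<noteq> 0"
    then have "i \<le> n"
      unfolding n_def using that by (intro Max_ge) auto
    then show False using that by simp
  qed
  define H where "H = (\<Sum>i\<le>n. single 0 (\<gamma> i) * (x ^ i * y ^ (n - i)))"
  \<comment> \<open>\<open>R\<close> collects the lower terms of \<open>H\<close>, all divisible by
    \<open>y\<close>: modulo \<open>y\<close> the form \<open>H\<close> is a nonzero multiple of
    \<open>x ^ n\<close>.\<close>
  define R where "R = (\<Sum>i<n. single 0 (\<gamma> i) * (x ^ i * y ^ (n - i - 1)))"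
  have H: "H = single 0 (\<gamma> n) * x ^ n + y * R"
  proof -
    have "H = (\<Sum>i<n. single 0 (\<gamma> i) * (x ^ i * y ^ (n - i))) + single 0 (\<gamma> n) * x ^ n"
      unfolding H_def by (simp flip: lessThan_Suc_atMost)
    also have "(\<Sum>i<n. single 0 (\<gamma> i) * (x ^ i * y ^ (n - i))) = y * R"
      unfolding R_def sum_distrib_left
    proof (rule sum.cong)
      fix i assume "i \<in> {..<n}"
      then have "n - i = Suc (n - i - 1)" by simp
      then have "y ^ (n - i) = y * y ^ (n - i - 1)"
        by (metis power_Suc)
      then show "single 0 (\<gamma> i) * (x ^ i * y ^ (n - i)) = y * (single 0 (\<gamma> i) * (x ^ i * y ^ (n - i - 1)))"
        by (simp add: mult_ac)
    qed simp
    finally show ?thesis by simp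
  qed
  have F: "(\<Sum>i\<le>N. single 0 (\<gamma> i) * (x ^ i * y ^ (N - i))) = y ^ (N - n) * H"
  proof -
    have "(\<Sum>i\<le>N. single 0 (\<gamma> i) * (x ^ i * y ^ (N - i))) =
        (\<Sum>i\<le>n. single 0 (\<gamma> i) * (x ^ i * y ^ (N - i)))"
      using n(1) n_max by (intro sum.mono_neutral_right) auto
    also have "\<dots> = (\<Sum>i\<le>n. y ^ (N - n) * (single 0 (\<gamma> i) * (x ^ i * y ^ (n - i))))"
    proof (rule sum.cong)
      fix i assume "i \<in> {..n}"
      then have "N - i = (N - n) + (n - i)" using n(1) by simp
      then show "single 0 (\<gamma> i) * (x ^ i * y ^ (N - i)) =
          y ^ (N - n) * (single 0 (\<gamma> i) * (x ^ i * y ^ (n - i)))"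
        by (simp add: power_add mult_ac)
    qed simp
    finally show ?thesis by (simp add: H_def sum_distrib_left)
  qed
  \<comment> \<open>Once \<open>y\<close> is nilpotent, membership of \<open>x ^ k * H\<close>
    amounts to membership of \<open>x ^ (k + n)\<close>, because the leading coefficient is
    invertible.\<close>
  have x_mem: "x \<in> radical Q"
    if Q: "is_ideal Q" and y: "y \<in> radical Q" and xH: "x ^ k * H \<in> radical Q" for Q k
  proof -
    have "x ^ k * H - (x ^ k * R) * y \<in> radical Q"
      using is_ideal_radical[OF Q] by (intro ideal_diff xH ideal_mult[OF _ y])
    then have "single 0 (inverse (\<gamma> n)) * (x ^ k * H - (x ^ k * R) * y) \<in> radical Q"
      by (rule ideal_mult[OF is_ideal_radical[OF Q]])
    also have "single 0 (inverse (\<gamma> n)) * (x ^ k * H - (x ^ k * R) * y) =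
        (single 0 (inverse (\<gamma> n)) * single 0 (\<gamma> n)) * x ^ (k + n)"
      unfolding H by (simp add: algebra_simps power_add)
    also have "\<dots> = x ^ (k + n)"
      using n(2) by (simp add: single_const_mult)
    finally show ?thesis
      by (rule radical_radical[OF radicalI])
  qed
  show ?thesis
  proof (rule that[OF H_def])
    fix L assume L: "is_ideal L" and "(\<Sum>i\<le>N. single 0 (\<gamma> i) * (x ^ i * y ^ (N - i))) \<in> L"
    then have FL: "y ^ (N - n) * H \<in> L" by (simp add: F)
    define c where "c = x * H + y ^ Suc n"
    define Q where "Q = gen_ideal (insert c L)"
    have Q: "is_ideal Q" "y ^ (N - n) * H \<in> Q" "c \<in> Q"
      using FL gen_ideal_insert_sub gen_ideal_insert_memI by (auto simp: Q_def is_ideal_gen)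
    \<comment> \<open>The product of \<open>y ^ (N - n)\<close> and \<open>H\<close> lies in
      \<open>Q\<close>, so \<open>radical_cases\<close> allows adjoining either factor
      separately.\<close>
    have 1: "{x, y} \<subseteq> radical (gen_ideal (insert (y ^ (N - n)) Q))" (is "_ \<subseteq> radical ?Q1")
    proof -
      have y: "y \<in> radical ?Q1"
        by (rule radicalI[OF gen_ideal_insert_memI])
      have "c \<in> radical ?Q1"
        using Q(3) gen_ideal_insert_sub radical_superset by blast
      then have "c - y ^ n * y \<in> radical ?Q1"
        using y by (intro ideal_diff ideal_mult is_ideal_radical is_ideal_gen)
      then have "x ^ 1 * H \<in> radical ?Q1"
        by (simp add: c_def algebra_simps)
      then show ?thesis
        using x_mem[OF is_ideal_gen y] y by blast
    qed
    have 2: "{x, y} \<subseteq> radical (gen_ideal (insert H Q))" (is "_ \<subseteq> radical ?Q2")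
    proof -
      have H: "H \<in> ?Q2"
        by (rule gen_ideal_insert_memI)
      have "c - x * H \<in> ?Q2"
        using H Q(3) gen_ideal_insert_sub by (intro ideal_diff ideal_mult is_ideal_gen) auto
      then have y: "y \<in> radical ?Q2"
        by (intro radicalI[of _ "Suc n"]) (simp add: c_def)
      have "x ^ 0 * H \<in> radical ?Q2"
        using H radical_superset by auto
      then show ?thesis
        using x_mem[OF is_ideal_gen y] y by blast
    qed
    show "{x, y} \<subseteq> radical (gen_ideal (insert (x * H + y ^ Suc n) L))"
      using 1 2 radical_cases[OF Q(1,2)] unfolding Q_def c_def by blast
  qed
qed

lemma radical_insert_trans:
  assumes "is_ideal I" "X \<subseteq> radical (gen_ideal (insert b I))" "b \<in> radical (gen_ideal (insert c I))"
  shows "X \<subseteq> radical (gen_ideal (insert c I))"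
proof -
  have "insert b I \<subseteq> radical (gen_ideal (insert c I))"
    using assms(3) gen_ideal_insert_sub radical_superset by blast
  then show ?thesis
    using radical_gen_least[OF _ is_ideal_gen] assms(2) by blast
qed

text \<open>The form from \<open>coprime_form\<close> has both \<open>x\<close> and \<open>y\<close>
  in the radical it generates with either ideal. Of these, \<open>x\<close> is a parameter modulo
  \<open>I\<close> and \<open>y\<close> modulo \<open>J\<close>, so the same form is a parameter for
  both.\<close>

lemma common_parameter:
  fixes I J :: "('a::finite, 'k::field) mpoly set"
  assumes I: "hom_ideal I" and J: "hom_ideal J" and "homog_pos a" "homog_pos b"
    and "range var \<subseteq> radical (gen_ideal (insert a I))" "range var \<subseteq> radical (gen_ideal (insert b J))"
  obtains c where "homog_pos c" "range var \<subseteq> radical (gen_ideal (insert c I))"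
    "range var \<subseteq> radical (gen_ideal (insert c J))"
proof -
  note idI = hom_ideal_ideal[OF I] and idJ = hom_ideal_ideal[OF J]
  obtain m n where a: "homog m a" "m > 0" and b: "homog n b" "n > 0"
    using assms(3,4) by (auto simp: homog_pos_iff)
  \<comment> \<open>Passing to powers gives both parameters the same degree, which makes all
    products \<open>x ^ i * y ^ (N - i)\<close> forms of one degree.\<close>
  define e x y where "e = n * m" and "x = a ^ n" and "y = b ^ m"
  have e: "e > 0" and x: "homog e x" and y: "homog e y"
    using a b homog_power[OF a(1), of n] homog_power[OF b(1), of m]
    by (auto simp: e_def x_def y_def mult.commute)
  have xI: "range var \<subseteq> radical (gen_ideal (insert x I))"
    using radical_insert_trans[OF idI assms(5)] radicalI[OF gen_ideal_insert_memI]
    by (metis x_def)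
  have yJ: "range var \<subseteq> radical (gen_ideal (insert y J))"
    using radical_insert_trans[OF idJ assms(6)] radicalI[OF gen_ideal_insert_memI]
    by (metis y_def)
  obtain M where M: "\<And>m. M \<le> mono_deg m \<Longrightarrow> mon m \<in> gen_ideal (insert x I)"
    using high_degree_mem[OF is_ideal_gen xI] by blast
  obtain M' where M': "\<And>m. M' \<le> mono_deg m \<Longrightarrow> mon m \<in> gen_ideal (insert y J)"
    using high_degree_mem[OF is_ideal_gen yJ] by blast
  define U where "U k = {u :: 'a \<Rightarrow>\<^sub>0 nat. mono_deg u < k}" for k
  have fin: "finite (U k)" for k
    unfolding U_def by (rule finite_subset[OF _ finite_exps_deg_le[of k]]) auto
  \<comment> \<open>Chosen so that the \<open>N + 1\<close> forms outnumber the spanning families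
    modulo \<open>I\<close> and modulo \<open>J\<close> together.\<close>
  define N where "N = card (U M) + card (U M')"
  have hom: "homog (N * e) (x ^ i * y ^ (N - i))" if "i \<in> {..N}" for i
  proof -
    have "i * e + (N - i) * e = N * e"
      using that by (simp flip: add_mult_distrib)
    then show ?thesis
      using homog_mult[OF homog_power[OF x, of i] homog_power[OF y, of "N - i"]] by simp
  qed
  have spI: "spans I (U M) (\<lambda>u. x ^ ((N * e - mono_deg u) div e) * mon u) (x ^ i * y ^ (N - i))"
    if "i \<in> {..N}" for i
    using homog_spans[OF I x e M hom[OF that]] by (auto simp: spans_def U_def)
  have spJ: "spans J (U M') (\<lambda>u. y ^ ((N * e - mono_deg u) div e) * mon u) (x ^ i * y ^ (N - i))"
    if "i \<in> {..N}" for i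
    using homog_spans[OF J y e M' hom[OF that]] by (auto simp: spans_def U_def)
  have "card (U M) + card (U M') < card {..N}"
    by (simp add: N_def)
  from linear_dependence_mod[where f = "\<lambda>i. x ^ i * y ^ (N - i)", OF idI idJ finite_atMost fin fin this spI spJ]
  obtain \<gamma> where \<gamma>: "\<exists>i\<in>{..N}. \<gamma> i \<noteq> 0"
      "(\<Sum>i\<le>N. single 0 (\<gamma> i) * (x ^ i * y ^ (N - i))) \<in> I \<inter> J"
    by blast
  obtain k H where H: "H = (\<Sum>i\<le>k. single 0 (\<gamma> i) * (x ^ i * y ^ (k - i)))"
    "\<And>L. is_ideal L \<Longrightarrow> (\<Sum>i\<le>N. single 0 (\<gamma> i) * (x ^ i * y ^ (N - i))) \<in> L \<Longrightarrow>
      {x, y} \<subseteq> radical (gen_ideal (insert (x * H + y ^ Suc k) L))"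
    by (rule coprime_form[OF \<gamma>(1), of x y]) blast
  show ?thesis
  proof (rule that[of "x * H + y ^ Suc k"])
    have "homog (k * e) H"
      unfolding H(1)
    proof (intro homog_sum homog_const_times)
      fix i assume "i \<in> {..k}"
      then have "i * e + (k - i) * e = k * e"
        by (simp flip: add_mult_distrib)
      then show "homog (k * e) (x ^ i * y ^ (k - i))"
        using homog_mult[OF homog_power[OF x, of i] homog_power[OF y, of "k - i"]] by simp
    qed
    then have "homog (Suc k * e) (x * H + y ^ Suc k)"
      using homog_mult[OF x, of "k * e" H] homog_power[OF y, of "Suc k"] by (intro homog_add) auto
    then show "homog_pos (x * H + y ^ Suc k)"
      using e by (auto simp: homog_pos_iff intro!: exI[of _ "Suc k * e"])
    show "range var \<subseteq> radical (gen_ideal (insert (x * H + y ^ Suc k) I))"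
      using radical_insert_trans[OF idI xI] H(2)[OF idI] \<gamma>(2) by blast
    show "range var \<subseteq> radical (gen_ideal (insert (x * H + y ^ Suc k) J))"
      using radical_insert_trans[OF idJ yJ] H(2)[OF idJ] \<gamma>(2) by blast
  qed
qed

text \<open>Induction on the length: replace the last members of both sequences by a common parameter \<open>c\<close>
  and move \<open>c\<close> to the front.\<close>

theorem reg_if_par:
  fixes I :: "('a::finite, 'k::field) mpoly set"
  assumes "hom_ideal I" "length \<phi> = length \<theta>" "\<forall>t\<in>set \<phi>. homog_pos t" "\<forall>t\<in>set \<theta>. homog_pos t"
    "par I \<phi>" "par I \<theta>" "reg I \<phi>"
  shows "reg I \<theta>"
  using assms
proof (induction "length \<phi>" arbitrary: I \<phi> \<theta>)
  case (Suc d)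
  note I = Suc.prems(1) and idI = hom_ideal_ideal[OF Suc.prems(1)]
  obtain \<phi>' a where \<phi>: "\<phi> = \<phi>' @ [a]"
    using Suc.hyps(2) by (metis length_0_conv nat.distinct(1) rev_exhaust)
  obtain \<theta>' b where \<theta>: "\<theta> = \<theta>' @ [b]"
    using Suc.hyps(2) Suc.prems(2) by (metis length_0_conv nat.distinct(1) rev_exhaust)
  have ins: "gen_ideal (I \<union> set (as @ [c])) = gen_ideal (insert c (gen_ideal (I \<union> set as)))" for as c
    by (simp add: gen_ideal_insert_gen)
  have pos: "homog_pos a" "homog_pos b" "\<forall>t\<in>set \<phi>'. homog_pos t" "\<forall>t\<in>set \<theta>'. homog_pos t"
    using Suc.prems \<phi> \<theta> by auto
  define I' J' where "I' = gen_ideal (I \<union> set \<phi>')" and "J' = gen_ideal (I \<union> set \<theta>')"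
  have hom: "hom_ideal I'" "hom_ideal J'"
    using hom_ideal_Un[OF I] pos by (auto simp: I'_def J'_def)
  have par: "range var \<subseteq> radical (gen_ideal (insert a I'))" "range var \<subseteq> radical (gen_ideal (insert b J'))"
    using Suc.prems(5,6) unfolding par_def \<phi> \<theta> ins I'_def J'_def .
  obtain c where c: "homog_pos c" "range var \<subseteq> radical (gen_ideal (insert c I'))"
      "range var \<subseteq> radical (gen_ideal (insert c J'))"
    using common_parameter[OF hom pos(1,2) par] .
  \<comment> \<open>A positive-degree form is nilpotent modulo any parameter of these quotients;
    this is what \<open>nzd_exchange\<close> needs to trade \<open>a\<close> for \<open>c\<close>
    and later \<open>c\<close> for \<open>b\<close>.\<close>
  have mem: "t \<in> radical (gen_ideal (insert s L))"
    if "range var \<subseteq> radical (gen_ideal (insert s L))" "homog_pos t" for t s and L :: "('a, 'k) mpoly set"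
    using that homog_pos_in_max_homog[of t] max_homog_subset_radical[OF is_ideal_gen, of "TYPE('k)"]
    by blast
  have "reg I \<phi>'" "nzd I' a"
    using Suc.prems(7) unfolding \<phi> reg_append[OF idI] I'_def by auto
  then have "reg I (\<phi>' @ [c])"
    using nzd_exchange[OF hom_ideal_ideal[OF hom(1)] _ mem[OF c(2) pos(1)]]
    by (simp add: reg_append[OF idI] flip: I'_def)
  then have c': "nzd I c" "reg (gen_ideal (insert c I)) \<phi>'"
    using reg_rotate[OF I pos(3) c(1)] by auto
  obtain e where "homog e c" using c(1) by (auto simp: homog_pos_iff)
  then have hom_c: "hom_ideal (gen_ideal (insert c I))"
    by (rule hom_ideal_insert[OF I])
  have par_c: "par (gen_ideal (insert c I)) as"
    if "range var \<subseteq> radical (gen_ideal (insert c (gen_ideal (I \<union> set as))))" for as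
    using that by (simp add: par_def gen_ideal_Un_gen gen_ideal_insert_gen)
  \<comment> \<open>The induction hypothesis is applied modulo \<open>c\<close>, where the two
    shortened sequences are again parameters of equal length.\<close>
  have "reg (gen_ideal (insert c I)) \<theta>'"
    using Suc.hyps Suc.prems(2) \<phi> \<theta> c
    by (intro Suc.hyps(1)[OF _ hom_c _ pos(3,4) par_c par_c c'(2)]) (auto simp: I'_def J'_def)
  then have "reg I (\<theta>' @ [c])"
    using c'(1) reg_rotate[OF I pos(4) c(1)] by simp
  then have "reg I \<theta>'" "nzd J' c"
    unfolding reg_append[OF idI] J'_def by auto
  then show ?case
    using nzd_exchange[OF hom_ideal_ideal[OF hom(2)] _ mem[OF par(2) c(1)]]
    by (simp add: \<theta> reg_append[OF idI] flip: J'_def)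
qed simp

section \<open>Growth and Krull dimension\<close>

definition indep :: "('a, 'k::comm_ring_1) mpoly set \<Rightarrow> 'x set \<Rightarrow> ('x \<Rightarrow> ('a, 'k) mpoly) \<Rightarrow> bool" where
  "indep J X f \<longleftrightarrow> (\<forall>c. (\<Sum>x\<in>X. single 0 (c x) * f x) \<in> J \<longrightarrow> (\<forall>x\<in>X. c x = 0))"

definition deg_le :: "nat \<Rightarrow> ('a, 'k::comm_ring_1) mpoly \<Rightarrow> bool" where
  "deg_le n f \<longleftrightarrow> (\<forall>m\<in>keys f. mono_deg m \<le> n)"

lemma deg_le_mult:
  "deg_le m p \<Longrightarrow> deg_le n q \<Longrightarrow> deg_le (m + n) (p * q :: ('a::finite, 'k::comm_ring_1) mpoly)"
  using keys_mult[of p q] by (force simp: deg_le_def mono_deg_add intro: add_mono)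

lemma deg_le_mono: "deg_le m p \<Longrightarrow> m \<le> n \<Longrightarrow> deg_le n p"
  by (auto simp: deg_le_def)

lemma deg_le_1: "deg_le 0 1"
  by (simp add: deg_le_def)

lemma deg_le_power: "deg_le m p \<Longrightarrow> deg_le (n * m) (p ^ n :: ('a::finite, 'k::comm_ring_1) mpoly)"
  by (induction n) (auto simp: deg_le_1 deg_le_mult)

lemma homog_deg_le: "homog n p \<Longrightarrow> deg_le n p"
  by (auto simp: homog_def deg_le_def)

text \<open>Modulo \<open>Q\<close> only the term with \<open>k = 0\<close> survives, so its
  coefficients vanish; then one factor \<open>t\<close> cancels modulo \<open>J\<close> and the
  argument repeats.\<close>

lemma indep_powers:
  fixes g :: "'x \<Rightarrow> ('a, 'k::comm_ring_1) mpoly"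
  assumes J: "is_ideal J" and Q: "is_ideal Q" "J \<subseteq> Q" and t: "t \<in> Q" "nzd J t" and g: "indep Q X g"
    and sum: "(\<Sum>k\<le>r. t ^ k * (\<Sum>x\<in>X. single 0 (c k x) * g x)) \<in> J"
  shows "\<forall>k\<le>r. \<forall>x\<in>X. c k x = 0"
  using sum
proof (induction r arbitrary: c)
  case 0
  then show ?case
    using g Q(2) by (auto simp: indep_def)
next
  case (Suc r)
  define G where "G k = (\<Sum>x\<in>X. single 0 (c k x) * g x)" for k
  have eq: "(\<Sum>k\<le>Suc r. t ^ k * G k) = G 0 + t * (\<Sum>k\<le>r. t ^ k * G (Suc k))"
    by (subst sum.atMost_Suc_shift) (simp add: sum_distrib_left mult.assoc)
  have "G 0 + t * (\<Sum>k\<le>r. t ^ k * G (Suc k)) \<in> Q"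
    using subsetD[OF Q(2) Suc.prems] unfolding eq[symmetric] by (simp add: G_def)
  then have "G 0 + t * (\<Sum>k\<le>r. t ^ k * G (Suc k)) - t * (\<Sum>k\<le>r. t ^ k * G (Suc k)) \<in> Q"
    by (intro ideal_diff ideal_mult2 Q t)
  then have c0: "\<forall>x\<in>X. c 0 x = 0"
    using g by (auto simp: indep_def G_def)
  then have "t * (\<Sum>k\<le>r. t ^ k * G (Suc k)) \<in> J"
    using Suc.prems unfolding G_def[symmetric] eq by (simp add: G_def)
  then have "(\<Sum>k\<le>r. t ^ k * G (Suc k)) \<in> J"
    by (rule nzdD[OF t(2)])
  then have "\<forall>k\<le>r. \<forall>x\<in>X. c (Suc k) x = 0"
    unfolding G_def by (rule Suc.IH)
  then show ?case
    using c0 by (metis Suc_le_mono not0_implies_Suc)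
qed

text \<open>A lower bound for the Hilbert function of the quotient, stated without dimensions.
  Indices are lists so that pairing with a new exponent is consing and the index type stays the same
  throughout a chain.\<close>

definition has_indep :: "('a, 'k::comm_ring_1) mpoly set \<Rightarrow> nat \<Rightarrow> nat \<Rightarrow> bool" where
  "has_indep J N n \<longleftrightarrow> (\<exists>(X :: nat list set) g. finite X \<and> card X = N \<and> indep J X g \<and>
     (\<forall>x\<in>X. deg_le n (g x)))"

lemma has_indep_grow:
  fixes J :: "('a::finite, 'k::comm_ring_1) mpoly set"
  assumes J: "is_ideal J" and Q: "is_ideal Q" "J \<subseteq> Q" and t: "t \<in> Q" "nzd J t" "deg_le e t"
    and "has_indep Q N n"
  shows "has_indep J ((r + 1) * N) (n + r * e)"
proof -
  obtain X g where X: "finite (X :: nat list set)" "card X = N" "indep Q X g" "\<forall>x\<in>X. deg_le n (g x)"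
    using assms(7) by (auto simp: has_indep_def)
  define Y where "Y = (\<lambda>(k, x). k # x) ` ({..r} \<times> X)"
  define h where "h y = t ^ hd y * g (tl y)" for y
  have inj: "inj_on (\<lambda>(k, x). k # x) ({..r} \<times> X)"
    by (auto simp: inj_on_def)
  have "finite Y" "card Y = (r + 1) * N"
    using X by (auto simp: Y_def card_image[OF inj])
  moreover have "indep J Y h"
    unfolding indep_def
  proof (intro allI impI)
    fix c assume "(\<Sum>y\<in>Y. single 0 (c y) * h y) \<in> J"
    also have "(\<Sum>y\<in>Y. single 0 (c y) * h y) =
        (\<Sum>k\<le>r. t ^ k * (\<Sum>x\<in>X. single 0 (c (k # x)) * g x))"
      unfolding Y_def sum.reindex[OF inj]
      by (simp add: case_prod_unfold h_def sum_distrib_left mult_ac sum.cartesian_product)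
    finally have "\<forall>k\<le>r. \<forall>x\<in>X. c (k # x) = 0"
      by (rule indep_powers[OF J Q t(1,2) X(3), where c = "\<lambda>k x. c (k # x)"])
    then show "\<forall>y\<in>Y. c y = 0"
      by (auto simp: Y_def)
  qed
  moreover have "deg_le (n + r * e) (h y)" if y: "y \<in> Y" for y
  proof -
    obtain k x where "y = k # x" "k \<le> r" "x \<in> X"
      using y by (auto simp: Y_def)
    then have "deg_le (k * e + n) (h y)"
      using X(4) deg_le_power[OF t(3), of k] by (auto simp: h_def intro: deg_le_mult)
    moreover have "k * e + n \<le> n + r * e"
      using \<open>k \<le> r\<close> by simp
    ultimately show ?thesis by (rule deg_le_mono)
  qed
  ultimately show ?thesis
    by (auto simp: has_indep_def)
qed

text \<open>Each step multiplies the size by \<open>r + 1\<close> and adds only \<open>r * e\<close>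
  to the degree: growth of order \<open>m\<close> as \<open>r\<close> varies.\<close>

lemma has_indep_chain:
  fixes P :: "nat \<Rightarrow> ('a::finite, 'k::comm_ring_1) mpoly set"
  assumes "\<And>i. i \<le> m \<Longrightarrow> is_ideal (P i)"
    and "\<And>i. i < m \<Longrightarrow> P i \<subseteq> P (Suc i) \<and> t i \<in> P (Suc i) \<and> nzd (P i) (t i) \<and> deg_le e (t i)"
    and "has_indep (P m) N n"
  shows "has_indep (P 0) ((r + 1) ^ m * N) (n + m * r * e)"
  using assms
proof (induction m arbitrary: N n)
  case (Suc m)
  have "has_indep (P m) ((r + 1) * N) (n + r * e)"
    using Suc.prems by (intro has_indep_grow[of _ "P (Suc m)" "t m"]) auto
  then have "has_indep (P 0) ((r + 1) ^ m * ((r + 1) * N)) ((n + r * e) + m * r * e)"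
    using Suc.prems by (intro Suc.IH) auto
  then show ?case by (simp add: algebra_simps)
qed simp

text \<open>Monomials supported on faces span the quotient. On a given face with at most
  \<open>d\<close> vertices every exponent is at most \<open>n\<close>, which leaves at most
  \<open>(n + 1) ^ d\<close> choices.\<close>

lemma has_indep_le:
  fixes D :: "'a::finite set set"
  assumes D: "down_closed D" and d: "\<And>F. F \<in> D \<Longrightarrow> card F \<le> d"
    and ind: "has_indep (SR_ideal TYPE('k::field) D) N n"
  shows "N \<le> card D * (n + 1) ^ d"
proof -
  define Y where "Y = {m :: 'a \<Rightarrow>\<^sub>0 nat. keys m \<in> D \<and> mono_deg m \<le> n}"
  have "finite Y"
    unfolding Y_def by (rule finite_subset[OF _ finite_exps_deg_le[of n]]) auto
  define I where "I = SR_ideal TYPE('k) D"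
  obtain X g where X: "finite (X :: nat list set)" "card X = N" "indep I X g"
      "\<forall>x\<in>X. deg_le n (g x)"
    using ind by (auto simp: has_indep_def I_def)
  have sp: "spans I Y mon (g x)" if "x \<in> X" for x
  proof -
    have "lookup (g x) m = 0" if "mono_deg m > n" for m
      using X(4) \<open>x \<in> X\<close> that unfolding deg_le_def by (metis in_keys_iff not_le)
    then have "lookup (g x - (\<Sum>m\<in>Y. single m (lookup (g x) m))) m = (if keys m \<in> D then 0 else lookup (g x) m)" for m
      using \<open>finite Y\<close> by (auto simp: lookup_minus lookup_sum lookup_single when_def Y_def)
    then have "g x - (\<Sum>m\<in>Y. single m (lookup (g x) m)) \<in> I"
      unfolding I_def SR_ideal_eq[OF D] mon_ideal_def
      by (auto simp: in_keys_iff split: if_splits)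
    then show ?thesis
      by (auto simp: spans_def mult_single intro!: exI[of _ "lookup (g x)"])
  qed
  have "\<not> card Y < card X"
  proof
    assume "card Y < card X"
    \<comment> \<open>Taking \<open>UNIV\<close> with an empty spanning family as second ideal makes
      half of \<open>linear_dependence_mod\<close> vacuous.\<close>
    have "is_ideal I" "is_ideal (UNIV :: ('a, 'k) mpoly set)"
      by (simp_all add: I_def is_ideal_SR) (simp add: is_ideal_def)
    moreover have "spans UNIV {} (\<lambda>_ :: unit. 0) (g x)" for x
      by (simp add: spans_def)
    ultimately obtain \<gamma> where "\<exists>x\<in>X. \<gamma> x \<noteq> 0" "(\<Sum>x\<in>X. single 0 (\<gamma> x) * g x) \<in> I"
      using linear_dependence_mod[of I UNIV X Y "{} :: unit set" mon g "\<lambda>_. 0"] sp X(1)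
        \<open>finite Y\<close> \<open>card Y < card X\<close> by auto
    then show False
      using X(3) by (auto simp: indep_def)
  qed
  moreover have "card Y \<le> card D * (n + 1) ^ d"
  proof -
    define Z where "Z F = {m \<in> Y. keys m = F}" for F
    have "card (Z F) \<le> (n + 1) ^ d" if "F \<in> D" for F
    proof -
      have "card (Z F) \<le> card (F \<rightarrow>\<^sub>E {..n})"
      proof (rule card_inj_on_le)
        show "inj_on (\<lambda>m. restrict (lookup m) F) (Z F)"
        proof (rule inj_onI)
          fix m m' assume m: "m \<in> Z F" "m' \<in> Z F"
            and eq: "restrict (lookup m) F = restrict (lookup m') F"
          have "lookup m v = lookup m' v" for v
          proof (cases "v \<in> F")
            case True
            then show ?thesis using fun_cong[OF eq, of v] by simp
          next
            case False
            then have "v \<notin> keys m" "v \<notin> keys m'" using m by (auto simp: Z_def)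
            then show ?thesis by (simp add: in_keys_iff)
          qed
          then show "m = m'" by (rule poly_mapping_eqI)
        qed
        show "(\<lambda>m. restrict (lookup m) F) ` Z F \<subseteq> F \<rightarrow>\<^sub>E {..n}"
        proof (intro image_subsetI restrict_PiE_iff[THEN iffD2] ballI)
          fix m v assume "m \<in> Z F"
          then show "lookup m v \<in> {..n}"
            using member_le_sum[of v UNIV "lookup m"] by (simp add: mono_deg_UNIV Z_def Y_def)
        qed
      qed (auto intro: finite_PiE)
      also have "\<dots> = (n + 1) ^ card F"
        by (simp add: card_PiE)
      also have "\<dots> \<le> (n + 1) ^ d"
        using d[OF that] by (intro power_increasing) auto
      finally show ?thesis .
    qed
    then have "(\<Sum>F\<in>D. card (Z F)) \<le> (\<Sum>F\<in>D. (n + 1) ^ d)"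
      by (rule sum_mono)
    moreover have "Y = (\<Union>F\<in>D. Z F)"
      by (auto simp: Z_def Y_def)
    then have "card Y \<le> (\<Sum>F\<in>D. card (Z F))"
      using card_UN_le[of D Z] by simp
    ultimately show ?thesis by simp
  qed
  ultimately show ?thesis using X(2) by simp
qed

lemma max_face_exists:
  fixes D :: "'a::finite set set"
  assumes "D \<noteq> {}"
  obtains F where "F \<in> D" "\<And>G. G \<in> D \<Longrightarrow> card G \<le> card F"
proof -
  have "Max (card ` D) \<in> card ` D"
    using assms by (intro Max_in) auto
  then obtain F where "F \<in> D" "card F = Max (card ` D)"
    by auto
  then show ?thesis
    using that by simp
qed

text \<open>The quotient is the polynomial ring on \<open>F\<close>, a domain. The product of the
  two projections \<open>\<pi> f\<close> and \<open>\<pi> g\<close> lies both in that ring and in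
  the ideal, hence is zero.\<close>

lemma prime_ideal_face:
  "prime_ideal (mon_ideal {m. \<not> keys m \<subseteq> F} :: ('a::finite, 'k::idom) mpoly set)"
  (is "prime_ideal ?P")
proof -
  have up: "upset {m :: 'a \<Rightarrow>\<^sub>0 nat. \<not> keys m \<subseteq> F}"
    by (auto simp: upset_def keys_exps_add)
  have id: "is_ideal ?P"
    by (rule is_ideal_mon_ideal[OF up])
  have "1 \<notin> ?P"
    using mon_mem_mon_ideal[of 0 "{m :: 'a \<Rightarrow>\<^sub>0 nat. \<not> keys m \<subseteq> F}", where ?'k = 'k] by simp
  moreover have "f \<in> ?P \<or> g \<in> ?P" if fg: "f * g \<in> ?P" for f g
  proof -
    define \<pi> :: "('a, 'k) mpoly \<Rightarrow> ('a, 'k) mpoly" where "\<pi> = restr (\<lambda>m. keys m \<subseteq> F)"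
    have \<pi>: "h - \<pi> h \<in> ?P" for h :: "('a, 'k) mpoly"
      by (auto simp: mon_ideal_def \<pi>_def in_keys_iff lookup_minus lookup_restr)
    have "f * g - f * (g - \<pi> g) - (f - \<pi> f) * \<pi> g \<in> ?P"
      by (intro ideal_diff id fg ideal_mult ideal_mult2 \<pi>)
    then have "\<pi> f * \<pi> g \<in> ?P"
      by (simp add: algebra_simps)
    moreover have "keys (\<pi> f * \<pi> g) \<subseteq> {m. keys m \<subseteq> F}"
      using keys_mult[of "\<pi> f" "\<pi> g"] by (force simp: \<pi>_def keys_restr keys_exps_add)
    ultimately have "keys (\<pi> f * \<pi> g) \<subseteq> {}"
      unfolding mon_ideal_def by blast
    then have "\<pi> f = 0 \<or> \<pi> g = 0"
      by (intro mpoly_no_zero_divisors) simp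
    then show ?thesis
      using \<pi>[of f] \<pi>[of g] by auto
  qed
  ultimately show ?thesis
    using id by (auto simp: prime_ideal_def)
qed

text \<open>An element of \<open>P (Suc i)\<close> outside the prime \<open>P i\<close> is regular
  modulo \<open>P i\<close>, so the chain forces growth of order \<open>m\<close> modulo
  \<open>P 0\<close>, hence modulo the smaller Stanley-Reisner ideal, where growth has order at most
  \<open>d\<close>. The elements need not be homogeneous, so only degree bounds enter.\<close>

lemma prime_chain_le:
  fixes D :: "'a::finite set set" and P :: "nat \<Rightarrow> ('a, 'k::field) mpoly set"
  assumes D: "down_closed D" and d: "\<And>F. F \<in> D \<Longrightarrow> card F \<le> d"
    and P: "\<forall>i\<le>m. prime_ideal (P i) \<and> SR_ideal TYPE('k) D \<subseteq> P i" "\<forall>i<m. P i \<subset> P (Suc i)"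
  shows "m \<le> d"
proof (rule ccontr)
  assume "\<not> m \<le> d"
  have id: "is_ideal (P i)" if "i \<le> m" for i
    using P(1) that by (simp add: prime_ideal_def)
  have "\<exists>t. t \<in> P (Suc i) \<and> nzd (P i) t" if "i < m" for i
  proof -
    obtain t where "t \<in> P (Suc i)" "t \<notin> P i"
      using P(2) \<open>i < m\<close> by blast
    moreover have "nzd (P i) t"
      using P(1)[rule_format, of i] \<open>i < m\<close> \<open>t \<notin> P i\<close> by (auto simp: nzd_def prime_ideal_def)
    ultimately show ?thesis by blast
  qed
  then obtain t where t: "\<And>i. i < m \<Longrightarrow> t i \<in> P (Suc i) \<and> nzd (P i) (t i)"
    by metis
  define e where "e = Max (insert 0 (mono_deg ` (\<Union>i<m. keys (t i))))"
  have e: "deg_le e (t i)" if "i < m" for i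
    unfolding deg_le_def e_def using that by (auto intro!: Max_ge)
  have "has_indep (P m) 1 0"
  proof -
    have "1 \<notin> P m"
      using P(1) ideal_UNIV_iff[OF id[of m]] by (auto simp: prime_ideal_def)
    have "c = 0" if "single 0 c \<in> P m" for c :: 'k
    proof (rule ccontr)
      assume "c \<noteq> 0"
      then have "single 0 (inverse c) * single 0 c = (1 :: ('a, 'k) mpoly)"
        by (simp add: single_const_mult)
      then show False
        using ideal_mult[OF id[of m] that, of "single 0 (inverse c)"] \<open>1 \<notin> P m\<close> by simp
    qed
    then have "indep (P m) {[]} (\<lambda>_. 1)"
      by (auto simp: indep_def)
    then show ?thesis
      unfolding has_indep_def by (intro exI[of _ "{[]}"] exI[of _ "\<lambda>_. 1"]) (auto simp: deg_le_1)
  qed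
  then have big: "has_indep (P 0) ((r + 1) ^ m * 1) (0 + m * r * e)" for r
    using t P(2) id e by (intro has_indep_chain[where t = t]) auto
  define C where "C = card D * (m * e + 1) ^ d"
  have le: "(r + 1) ^ m \<le> C * (r + 1) ^ d" for r
  proof -
    have "has_indep (SR_ideal TYPE('k) D) ((r + 1) ^ m) (m * r * e)"
      using big[of r] P(1) by (force simp: has_indep_def indep_def)
    then have "(r + 1) ^ m \<le> card D * (m * r * e + 1) ^ d"
      by (rule has_indep_le[OF D, rotated]) (rule d)
    also have "\<dots> \<le> card D * ((m * e + 1) * (r + 1)) ^ d"
      by (intro mult_left_mono power_mono) (auto simp: algebra_simps)
    also have "\<dots> = C * (r + 1) ^ d"
      unfolding C_def power_mult_distrib by (simp only: mult_ac)
    finally show ?thesis .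
  qed
  \<comment> \<open>The estimate \<open>le\<close> is contradictory already at
    \<open>r = C\<close>.\<close>
  have "(C + 1) ^ Suc d \<le> (C + 1) ^ m"
    using \<open>\<not> m \<le> d\<close> by (intro power_increasing) auto
  also have "\<dots> \<le> C * (C + 1) ^ d"
    by (rule le)
  finally show False by simp
qed

text \<open>Removing the vertices of a largest face one at a time gives a chain of face primes of
  the right length. The bound from \<open>prime_chain_le\<close> also ensures that the
  \<open>Sup\<close> of naturals is a maximum.\<close>

theorem krull_dim_SR:
  fixes D :: "'a::finite set set"
  assumes D: "down_closed D" and F: "F \<in> D" "\<And>G. G \<in> D \<Longrightarrow> card G \<le> card F"
  shows "krull_dim_quot (SR_ideal TYPE('k::field) D) = card F"
  unfolding krull_dim_quot_def
proof (rule cSup_eq_maximum)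
  obtain vs where vs: "set vs = F" "distinct vs" "length vs = card F"
    by (metis finite_distinct_list distinct_card finite_code)
  define P :: "nat \<Rightarrow> ('a, 'k) mpoly set" where
    "P i = mon_ideal {m. \<not> keys m \<subseteq> set (drop i vs)}" for i
  have "SR_ideal TYPE('k) D \<subseteq> P i" for i
  proof -
    have "set (drop i vs) \<in> D"
      using F(1) vs(1) set_drop_subset[of i vs] by (auto intro: down_closedD[OF D])
    then have "keys m \<notin> D \<Longrightarrow> \<not> keys m \<subseteq> set (drop i vs)" for m :: "'a \<Rightarrow>\<^sub>0 nat"
      using down_closedD[OF D] by blast
    then show ?thesis
      by (auto simp: SR_ideal_eq[OF D] P_def mon_ideal_def)
  qed
  moreover have "P i \<subset> P (Suc i)" if "i < card F" for i
  proof
    have drop: "drop i vs = vs ! i # drop (Suc i) vs"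
      using that vs(3) by (simp add: Cons_nth_drop_Suc)
    then have notin: "vs ! i \<notin> set (drop (Suc i) vs)"
      using vs(2) distinct_drop[of vs i] by simp
    show "P i \<subseteq> P (Suc i)"
      unfolding P_def mon_ideal_def drop by auto
    have "mon (expv (vs ! i)) \<in> P (Suc i)" "mon (expv (vs ! i)) \<notin> P i"
      using notin drop by (auto simp: P_def mon_mem_mon_ideal)
    then show "P i \<noteq> P (Suc i)" by auto
  qed
  moreover have "prime_ideal (P i)" for i
    unfolding P_def by (rule prime_ideal_face)
  ultimately show "card F \<in> {n. \<exists>P :: nat \<Rightarrow> ('a, 'k) mpoly set.
      (\<forall>i\<le>n. prime_ideal (P i) \<and> SR_ideal TYPE('k) D \<subseteq> P i) \<and> (\<forall>i<n. P i \<subset> P (Suc i))}"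
    by blast
next
  fix n assume "n \<in> {n. \<exists>P :: nat \<Rightarrow> ('a, 'k) mpoly set.
      (\<forall>i\<le>n. prime_ideal (P i) \<and> SR_ideal TYPE('k) D \<subseteq> P i) \<and> (\<forall>i<n. P i \<subset> P (Suc i))}"
  then show "n \<le> card F"
    using prime_chain_le[OF D F(2)] by blast
qed

text \<open>If a variable were not nilpotent modulo the sequence, its powers would be independent
  families of any size, and regularity would multiply these beyond the growth of the Stanley-Reisner
  ring.\<close>

theorem par_if_reg:
  fixes D :: "'a::finite set set"
  assumes D: "down_closed D" and d: "\<And>F. F \<in> D \<Longrightarrow> card F \<le> length th"
    and th: "\<forall>t\<in>set th. homog_pos t" and reg: "reg (SR_ideal TYPE('k::field) D) th"
  shows "par (SR_ideal TYPE('k) D) th"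
proof -
  define I where "I = SR_ideal TYPE('k) D"
  have I: "is_ideal I" "hom_ideal I"
    by (simp_all add: I_def is_ideal_SR hom_ideal_SR D)
  define d where "d = length th"
  define J where "J = pre_ideal I th d"
  have J: "J = gen_ideal (I \<union> set th)" "is_ideal J" "hom_ideal J"
    using hom_ideal_Un[OF I(2) th] by (auto simp: J_def d_def pre_ideal_def is_ideal_gen)
  have "\<exists>n. homog n (th ! i)" if "i < d" for i
    using th nth_mem[of i th] that by (auto simp: d_def homog_pos_iff)
  then obtain n where n: "\<And>i. i < d \<Longrightarrow> homog (n i) (th ! i)"
    by metis
  define e where "e = Max (insert 0 (n ` {..<d}))"
  have e: "deg_le e (th ! i)" if "i < d" for i
    using n[OF that] that by (intro deg_le_mono[OF homog_deg_le]) (auto simp: e_def)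
  \<comment> \<open>The factor \<open>(n + 1) ^ d\<close> gained along the regular sequence cancels
    against the one in \<open>has_indep_le\<close>, so this bound does not depend on
    \<open>n\<close>.\<close>
  define C where "C = card D * (1 + d * e) ^ d"
  have C: "N \<le> C" if "has_indep J N n" for N n
  proof -
    have "has_indep (pre_ideal I th 0) ((n + 1) ^ d * N) (n + d * n * e)"
    proof (rule has_indep_chain[where t = "\<lambda>i. th ! i"])
      fix i assume "i < d"
      then have i: "i < length th" by (simp add: d_def)
      have "pre_ideal I th i \<subseteq> pre_ideal I th (Suc i)"
        unfolding pre_ideal_def using i by (intro gen_ideal_mono) (auto simp: take_Suc_conv_app_nth)
      moreover have "nzd (pre_ideal I th i) (th ! i)"
        using reg i reg_iff_nth[OF I(1)] by (simp add: I_def)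
      ultimately show "pre_ideal I th i \<subseteq> pre_ideal I th (Suc i) \<and> th ! i \<in> pre_ideal I th (Suc i) \<and>
          nzd (pre_ideal I th i) (th ! i) \<and> deg_le e (th ! i)"
        using pre_ideal_mem[of i "Suc i" th I] i e[OF \<open>i < d\<close>] by auto
    qed (use that in \<open>auto simp: is_ideal_pre J_def\<close>)
    then have "(n + 1) ^ d * N \<le> card D * (n + d * n * e + 1) ^ d"
      unfolding pre_ideal_0[OF I(1)] unfolding I_def
      by (rule has_indep_le[OF D, of d, rotated]) (simp add: d_def assms(2))
    also have "\<dots> \<le> card D * ((1 + d * e) * (n + 1)) ^ d"
      by (intro mult_left_mono power_mono) (auto simp: algebra_simps)
    also have "\<dots> = (n + 1) ^ d * C"
      unfolding C_def power_mult_distrib by (simp only: mult_ac)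
    finally show "N \<le> C" by simp
  qed
  have "var v \<in> radical J" for v
  proof (rule ccontr)
    assume v: "var v \<notin> radical J"
    define g :: "nat list \<Rightarrow> ('a, 'k) mpoly" where "g = (\<lambda>x. var v ^ hd x)"
    \<comment> \<open>These index \<open>C + 1\<close> powers, one more than allowed. They have
      distinct degrees, so the homogeneity of \<open>J\<close> separates the terms of any
      relation.\<close>
    define X where "X = (\<lambda>i. [i]) ` {..C}"
    have hom: "homog i (var v ^ i :: ('a, 'k) mpoly)" for i
      using homog_power[OF homog_var[of v], of i] by simp
    have "indep J X g"
      unfolding indep_def
    proof (intro allI impI ballI)
      fix c x assume sum: "(\<Sum>x\<in>X. single 0 (c x) * g x) \<in> J" and "x \<in> X"
      then obtain i where i: "x = [i]" "i \<le> C" by (auto simp: X_def)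
      have "(\<Sum>x\<in>X. single 0 (c x) * g x) = (\<Sum>j\<le>C. single 0 (c [j]) * var v ^ j)"
        unfolding X_def by (subst sum.reindex) (auto simp: inj_on_def g_def)
      then have "hcomp i (\<Sum>j\<le>C. single 0 (c [j]) * var v ^ j) \<in> J"
        using hom_ideal_hcomp[OF J(3) sum] by simp
      also have "hcomp i (\<Sum>j\<le>C. single 0 (c [j]) * var v ^ j) =
          (\<Sum>j\<le>C. hcomp i (single 0 (c [j]) * var v ^ j))"
        by (induction C) (auto simp: hcomp_add)
      also have "\<dots> = (\<Sum>j\<le>C. if i = j then single 0 (c [j]) * var v ^ j else 0)"
        by (intro sum.cong refl hcomp_homog homog_const_times hom)
      also have "\<dots> = single 0 (c [i]) * var v ^ i"
        using i(2) by simp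
      finally have "single 0 (inverse (c [i])) * (single 0 (c [i]) * var v ^ i) \<in> J"
        by (rule ideal_mult[OF J(2)])
      then have "c x \<noteq> 0 \<Longrightarrow> var v ^ i \<in> J"
        by (simp add: i(1) single_const_mult flip: mult.assoc)
      then show "c x = 0"
        using v radicalI by blast
    qed
    then have "has_indep J (card X) C"
      using deg_le_mono[OF homog_deg_le[OF hom]] unfolding has_indep_def
      by (intro exI[of _ X] exI[of _ g]) (auto simp: X_def g_def)
    then have "card X \<le> C" by (rule C)
    then show False
      by (simp add: X_def card_image inj_on_def)
  qed
  then show ?thesis
    by (auto simp: par_def I_def[symmetric] J(1)[symmetric])
qed

section \<open>Cohen-Macaulay and Buchsbaum complexes\<close>

text \<open>Properness of the final ideal is automatic: everything involved lies in the maximal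
  homogeneous ideal, which does not contain 1.\<close>

lemma cohen_macaulay_iff:
  fixes D :: "'a::finite set set"
  assumes D: "down_closed D" "{} \<in> D"
  shows "cohen_macaulay_cx TYPE('k::field) D \<longleftrightarrow>
    (\<exists>th. length th = krull_dim_quot (SR_ideal TYPE('k) D) \<and> (\<forall>t\<in>set th. homog_pos t) \<and>
      reg (SR_ideal TYPE('k) D) th)"
proof -
  have "pre_ideal (SR_ideal TYPE('k) D) th (length th) \<noteq> UNIV"
    if "\<forall>t\<in>set th. homog_pos t" for th
  proof
    assume U: "pre_ideal (SR_ideal TYPE('k) D) th (length th) = UNIV"
    have "pre_ideal (SR_ideal TYPE('k) D) th (length th) \<subseteq> max_homog TYPE('k)"
      using that by (intro pre_ideal_least is_ideal_max_homog SR_subset_max_homog D)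
        (auto intro: homog_pos_in_max_homog)
    then have "(1 :: ('a, 'k) mpoly) \<in> max_homog TYPE('k)"
      unfolding U by auto
    then show False by (simp add: max_homog_iff)
  qed
  then show ?thesis
    unfolding cohen_macaulay_cx_def cohen_macaulay_quot_def regular_seq_def
      reg_iff_colon[OF is_ideal_SR] by blast
qed

text \<open>Each parameter lies in the maximal ideal, so one inclusion of the two colon ideals
  always holds; for the other, annihilation by the maximal ideal can be tested on variables.\<close>

lemma weak_seq_iff:
  assumes "\<forall>t\<in>set th. t \<in> max_homog TYPE('k)"
  shows "weak_seq TYPE('k::comm_ring_1) I th \<longleftrightarrow>
    (\<forall>i<length th. \<forall>g. th ! i * g \<in> pre_ideal I th i \<longrightarrow>
      (\<forall>v :: 'a::finite. var v * g \<in> pre_ideal I th i))"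
proof -
  have "colon J (max_homog TYPE('k)) = {g. \<forall>v. var v * g \<in> J}"
    if J: "is_ideal J" for J :: "('a, 'k) mpoly set"
  proof (intro set_eqI iffI)
    fix g assume "g \<in> colon J (max_homog TYPE('k))"
    then show "g \<in> {g. \<forall>v. var v * g \<in> J}"
      using var_in_max_homog[of _ "TYPE('k)"] unfolding colon_def mem_Collect_eq
      by (metis mult.commute)
  next
    fix g assume g: "g \<in> {g. \<forall>v. var v * g \<in> J}"
    have "is_ideal {h. g * h \<in> J}"
      using J by (auto simp: is_ideal_def distrib_left mult.left_commute)
    then have "max_homog TYPE('k) \<subseteq> {h. g * h \<in> J}"
      unfolding max_homog_def using g by (intro gen_ideal_least) (auto simp: mult.commute)
    then show "g \<in> colon J (max_homog TYPE('k))"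
      by (auto simp: colon_def)
  qed
  note colon_eq = this
  have colon_sub: "colon J (max_homog TYPE('k)) \<subseteq> colon J {t}"
    if "t \<in> set th" for t and J :: "('a, 'k) mpoly set"
    using assms that by (auto simp: colon_def)
  have "colon (pre_ideal I th i) {th ! i} = colon (pre_ideal I th i) (max_homog TYPE('k)) \<longleftrightarrow>
      colon (pre_ideal I th i) {th ! i} \<subseteq> {g. \<forall>v. var v * g \<in> pre_ideal I th i}"
    if "i < length th" for i
    using colon_sub[OF nth_mem[OF that], of "pre_ideal I th i"]
    unfolding colon_eq[OF is_ideal_pre, of I th i] by (rule antisym_conv[symmetric])
  then have "weak_seq TYPE('k) I th \<longleftrightarrow>
      (\<forall>i<length th. colon (pre_ideal I th i) {th ! i} \<subseteq> {g. \<forall>v. var v * g \<in> pre_ideal I th i})"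
    unfolding weak_seq_def by blast
  then show ?thesis
    unfolding colon_single by blast
qed

theorem buchsbaum_if_cohen_macaulay:
  fixes D :: "'a::finite set set"
  assumes D: "down_closed D" "{} \<in> D" and "cohen_macaulay_cx TYPE('k::field) D"
  shows "buchsbaum_cx TYPE('k) D"
proof -
  define I where "I = SR_ideal TYPE('k) D"
  obtain F where F: "F \<in> D" "\<And>G. G \<in> D \<Longrightarrow> card G \<le> card F"
    using max_face_exists[of D] D(2) by blast
  have dim: "krull_dim_quot I = card F"
    unfolding I_def by (rule krull_dim_SR[OF D(1) F])
  obtain \<phi> where \<phi>: "length \<phi> = card F" "\<forall>t\<in>set \<phi>. homog_pos t" "reg I \<phi>"
    using assms(3) dim unfolding cohen_macaulay_iff[OF D] I_def by auto
  \<comment> \<open>\<open>reg_if_par\<close> compares systems of parameters, so the regular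
    sequence must first be recognised as one.\<close>
  have "par I \<phi>"
    using par_if_reg[OF D(1) _ \<phi>(2)] F(2) \<phi>(1,3) unfolding I_def by simp
  have "weak_seq TYPE('k) I th" if "hsop TYPE('k) I th" for th
  proof -
    have th: "length th = card F" "\<forall>t\<in>set th. homog_pos t" "par I th"
      using that dim hsop_iff[OF SR_subset_max_homog[OF D(2,1)], of th] by (auto simp: I_def)
    have "hom_ideal I"
      unfolding I_def by (rule hom_ideal_SR[OF D(1)])
    then have "reg I th"
      by (rule reg_if_par[OF _ _ \<phi>(2) th(2) \<open>par I \<phi>\<close> th(3) \<phi>(3)]) (simp add: \<phi>(1) th(1))
    then have "nzd (pre_ideal I th i) (th ! i)" if "i < length th" for i
      using that by (simp add: reg_iff_nth is_ideal_SR I_def)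
    then show ?thesis
      using th(2) by (subst weak_seq_iff)
        (auto intro: homog_pos_in_max_homog intro!: ideal_mult is_ideal_pre simp: nzd_def)
  qed
  then show ?thesis
    by (simp add: buchsbaum_cx_def buchsbaum_quot_def I_def)
qed

section \<open>Buchsbaum complexes are pure\<close>

text \<open>Modulo the Stanley-Reisner ideal this is the elementary symmetric polynomial of degree
  \<open>j\<close>, since the missing squarefree monomials belong to nonfaces.\<close>

definition face_sum :: "'a::finite set set \<Rightarrow> nat \<Rightarrow> ('a, 'k::comm_ring_1) mpoly" where
  "face_sum D j = (\<Sum>\<sigma> | \<sigma> \<in> D \<and> card \<sigma> = j. mon (sqfree \<sigma>))"

lemma homog_face_sum: "homog j (face_sum D j)"
  unfolding face_sum_def
proof (rule homog_sum)
  fix \<sigma> :: "'a set" assume "\<sigma> \<in> {\<sigma> \<in> D. card \<sigma> = j}"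
  then show "homog j (mon (sqfree \<sigma>))"
    using homog_mon[of "sqfree \<sigma>"] by simp
qed

lemma sqfree_add: "sqfree F + sqfree G = sqfree (F \<union> G) + sqfree (F \<inter> G)"
  by (rule poly_mapping_eqI) (auto simp: lookup_add lookup_sqfree)

text \<open>Descending induction on the size of \<open>F\<close>: the product of its monomial with
  the face sum of the same size is the square of the monomial plus terms divisible by monomials of
  the strictly larger sets \<open>F \<union> \<sigma>\<close>.\<close>

lemma face_monomials_nilpotent:
  fixes D :: "'a::finite set set" and J :: "('a, 'k::comm_ring_1) mpoly set"
  assumes D: "down_closed D" and d: "\<And>F. F \<in> D \<Longrightarrow> card F \<le> d"
    and J: "is_ideal J" "SR_ideal TYPE('k) D \<subseteq> J" "\<And>j. 1 \<le> j \<Longrightarrow> j \<le> d \<Longrightarrow> face_sum D j \<in> J"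
  shows "F \<noteq> {} \<Longrightarrow> mon (sqfree F) \<in> radical J"
proof (induction "card (UNIV :: 'a set) - card F" arbitrary: F rule: less_induct)
  case less
  note rad = is_ideal_radical[OF J(1)]
  show ?case
  proof (cases "F \<in> D")
    case False
    then show ?thesis
      using J(2) radical_superset[of J] mon_in_SR[OF D, of "sqfree F", where 'k = 'k] by auto
  next
    case True
    define j where "j = card F"
    have j: "1 \<le> j" "j \<le> d"
      using less.prems d[OF True] by (auto simp: j_def Suc_le_eq card_gt_0_iff)
    define R where "R = (\<Sum>\<sigma> | \<sigma> \<in> D \<and> card \<sigma> = j \<and> \<sigma> \<noteq> F. mon (sqfree F + sqfree \<sigma>) :: ('a, 'k) mpoly)"
    have "mon (sqfree F) * face_sum D j = (\<Sum>\<sigma> | \<sigma> \<in> D \<and> card \<sigma> = j. mon (sqfree F + sqfree \<sigma>) :: ('a, 'k) mpoly)"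
      by (simp add: face_sum_def sum_distrib_left mon_times)
    also have "{\<sigma>. \<sigma> \<in> D \<and> card \<sigma> = j} = insert F {\<sigma>. \<sigma> \<in> D \<and> card \<sigma> = j \<and> \<sigma> \<noteq> F}"
      using True by (auto simp: j_def)
    also have "(\<Sum>\<sigma>\<in>\<dots>. mon (sqfree F + sqfree \<sigma>)) = mon (sqfree F) ^ 2 + R"
      unfolding R_def by (subst sum.insert) (auto simp: power2_eq_square mon_times)
    finally have eq: "mon (sqfree F) ^ 2 = mon (sqfree F) * face_sum D j - R"
      by simp
    have "R \<in> radical J"
      unfolding R_def
    proof (rule ideal_sum[OF rad])
      fix \<sigma> assume "\<sigma> \<in> {\<sigma>. \<sigma> \<in> D \<and> card \<sigma> = j \<and> \<sigma> \<noteq> F}"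
      then have "\<not> \<sigma> \<subseteq> F"
        using card_subset_eq[of F \<sigma>] by (auto simp: j_def)
      then have "card F < card (F \<union> \<sigma>)"
        by (intro psubset_card_mono) auto
      moreover have "card (F \<union> \<sigma>) \<le> card (UNIV :: 'a set)"
        by (intro card_mono) auto
      ultimately have "mon (sqfree (F \<union> \<sigma>)) \<in> radical J"
        using less.prems by (intro less.hyps) auto
      then have "mon (sqfree (F \<union> \<sigma>)) * mon (sqfree (F \<inter> \<sigma>)) \<in> radical J"
        by (rule ideal_mult2[OF rad])
      then show "mon (sqfree F + sqfree \<sigma>) \<in> radical J"
        by (simp add: mon_times sqfree_add[of F \<sigma>])
    qed
    moreover have "mon (sqfree F) * face_sum D j \<in> radical J"
      using J(3)[OF j] radical_superset by (intro ideal_mult[OF rad]) blast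
    ultimately have "mon (sqfree F) ^ 2 \<in> radical J"
      unfolding eq by (intro ideal_diff[OF rad])
    then show ?thesis
      by (rule radical_radical[OF radicalI])
  qed
qed

lemma homog_pos_var: "homog_pos (var v)"
  unfolding homog_pos_iff by (intro exI[of _ 1] conjI homog_var) simp

lemma var_eq_sqfree: "var v = (mon (sqfree {v}) :: ('a::finite, 'k::comm_ring_1) mpoly)"
  by (simp add: var_def sqfree_def)

text \<open>If \<open>F\<close> is a facet of non-maximal size, then the top face sum kills the monomial of \<open>F\<close>,
  while the maximal ideal does not.\<close>

theorem facet_card_if_buchsbaum:
  fixes D :: "'a::finite set set"
  assumes D: "down_closed D" "{} \<in> D" and B: "buchsbaum_cx TYPE('k::field) D"
    and G: "G \<in> D" "\<And>H. H \<in> D \<Longrightarrow> card H \<le> card G"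
    and F: "F \<in> D" "F \<noteq> {}" "\<And>H. H \<in> D \<Longrightarrow> F \<subseteq> H \<Longrightarrow> H = F"
  shows "card F = card G"
proof (rule ccontr)
  assume "card F \<noteq> card G"
  then have less: "card F < card G"
    using G(2)[OF F(1)] by simp
  define d I where "d = card G" and "I = SR_ideal TYPE('k) D"
  have I: "is_ideal I" by (simp add: I_def is_ideal_SR)
  have dim: "krull_dim_quot I = d"
    unfolding I_def d_def by (rule krull_dim_SR[OF D(1) G])
  \<comment> \<open>The top face sum comes first so that the weak sequence condition at index 0
    speaks about \<open>I\<close> itself.\<close>
  define th :: "('a, 'k) mpoly list" where "th = map (face_sum D) (d # [1..<d])"
  have "insert d {1..<d} = {1..d}"
    using less by (auto simp: d_def)
  then have th: "length th = d" "set th = face_sum D ` {1..d}" "th ! 0 = face_sum D d"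
    using less by (auto simp: th_def d_def simp flip: image_insert)
  have "homog_pos (face_sum D j :: ('a, 'k) mpoly)" if "j > 0" for j
    unfolding homog_pos_iff using that homog_face_sum by blast
  then have pos: "\<forall>t\<in>set th. homog_pos t"
    by (auto simp: th(2))
  have "par I th"
  proof -
    define J where "J = gen_ideal (I \<union> set th)"
    have "SR_ideal TYPE('k) D \<subseteq> J" "\<And>j. 1 \<le> j \<Longrightarrow> j \<le> d \<Longrightarrow> face_sum D j \<in> J"
      using gen_ideal_superset[of "I \<union> set th"] by (auto simp: J_def I_def th(2))
    then have "mon (sqfree F) \<in> radical J" if "F \<noteq> {}" for F
      using face_monomials_nilpotent[OF D(1), of d J F] G(2) that
      by (auto simp: J_def is_ideal_gen d_def)
    then show ?thesis
      by (auto simp: par_def var_eq_sqfree J_def)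
  qed
  then have "hsop TYPE('k) I th"
    using hsop_iff[OF SR_subset_max_homog[OF D(2,1)], of th] pos dim th(1) by (simp add: I_def)
  then have "weak_seq TYPE('k) I th"
    using B by (auto simp: buchsbaum_cx_def buchsbaum_quot_def I_def)
  then have weak: "\<forall>v. var v * g \<in> I" if "face_sum D d * g \<in> I" for g
    using that less th weak_seq_iff[of th I] pos homog_pos_in_max_homog pre_ideal_0[OF I]
    by (metis d_def gr_implies_not0 not_gr_zero)
  have "face_sum D d * mon (sqfree F) \<in> I"
    unfolding face_sum_def sum_distrib_right mon_times
  proof (rule ideal_sum[OF I])
    fix \<sigma> assume \<sigma>: "\<sigma> \<in> {\<sigma>. \<sigma> \<in> D \<and> card \<sigma> = d}"
    have "\<sigma> \<union> F \<notin> D"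
    proof
      assume "\<sigma> \<union> F \<in> D"
      then have "\<sigma> \<union> F = F" by (rule F(3)) simp
      then have "card \<sigma> \<le> card F" by (intro card_mono) auto
      then show False using \<sigma> less by (simp add: d_def)
    qed
    then show "(mon (sqfree \<sigma> + sqfree F) :: ('a, 'k) mpoly) \<in> I"
      by (simp add: I_def mon_in_SR[OF D(1)] keys_exps_add)
  qed
  then have *: "var v * mon (sqfree F) \<in> I" for v
    using weak by blast
  \<comment> \<open>Multiplying by a variable of \<open>F\<close> leaves the support equal to the
    face \<open>F\<close>, so the product is not in \<open>I\<close>.\<close>
  obtain v where "v \<in> F" using F(2) by blast
  then have "keys (expv v + sqfree F) = F"
    by (auto simp: keys_exps_add)
  then have "(mon (expv v + sqfree F) :: ('a, 'k) mpoly) \<notin> I"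
    using F(1) by (simp add: I_def mon_in_SR[OF D(1)])
  then show False
    using *[of v] by (simp add: var_def mon_times)
qed

section \<open>Complete bipartite graphs\<close>

lemma Ind_down_closed: "down_closed (Ind E)"
  by (auto simp: down_closed_def Ind_def)

lemma empty_in_Ind: "{} \<in> Ind E"
  by (simp add: Ind_def)

lemma gen_ideal_mon_Un_vars:
  fixes M :: "('a::finite \<Rightarrow>\<^sub>0 nat) set"
  assumes M: "upset M"
  shows "gen_ideal (mon_ideal M \<union> var ` V) =
    (mon_ideal (M \<union> {m. keys m \<inter> V \<noteq> {}}) :: ('a, 'k::comm_ring_1) mpoly set)" (is "?L = ?R")
proof
  have "upset (M \<union> {m. keys m \<inter> V \<noteq> {}})"
    using M by (auto simp: upset_def keys_exps_add)
  then show "?L \<subseteq> ?R"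
    by (intro gen_ideal_least is_ideal_mon_ideal) (auto simp: mon_ideal_def var_def)
  show "?R \<subseteq> ?L"
  proof (rule mon_ideal_subset_ideal[OF is_ideal_gen])
    fix m assume "m \<in> M \<union> {m. keys m \<inter> V \<noteq> {}}"
    then consider "m \<in> M" | v where "v \<in> V" "v \<in> keys m" by auto
    then show "(mon m :: ('a, 'k) mpoly) \<in> ?L"
    proof cases
      case 1
      then show ?thesis
        using gen_ideal_superset[of "mon_ideal M \<union> var ` V"] by (auto simp: mon_mem_mon_ideal)
    next
      case 2
      obtain k where k: "m = expv v + k"
        using expv_dvd[OF 2(2)] .
      have "(var v :: ('a, 'k) mpoly) \<in> ?L"
        using gen_ideal_superset[of "mon_ideal M \<union> var ` V"] 2(1) by auto
      then have "var v * mon k \<in> ?L"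
        by (rule ideal_mult2[OF is_ideal_gen])
      then show ?thesis
        by (simp add: k var_def mon_times)
    qed
  qed
qed

lemma upset_not_subset: "upset {m :: 'a \<Rightarrow>\<^sub>0 nat. \<not> keys m \<subseteq> X}"
  by (auto simp: upset_def keys_exps_add)

text \<open>The quotient is the polynomial ring on \<open>X\<close>, where the variables form a
  regular system of parameters; \<open>reg_if_par\<close> transfers regularity to
  \<open>th\<close>.\<close>

lemma reg_face_ideal:
  fixes X :: "'a::finite set"
  assumes "\<forall>t\<in>set th. homog_pos t" "length th = card X"
    and "par (mon_ideal {m. \<not> keys m \<subseteq> X}) th"
  shows "reg (mon_ideal {m. \<not> keys m \<subseteq> X}) (th :: ('a, 'k::field) mpoly list)"
proof -
  define P :: "('a, 'k) mpoly set" where "P = mon_ideal {m. \<not> keys m \<subseteq> X}"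
  have P: "hom_ideal P" "is_ideal P"
    using hom_ideal_mon_ideal[OF upset_not_subset[of X]] hom_ideal_ideal by (auto simp: P_def)
  obtain xs where xs: "set xs = X" "distinct xs" "length xs = card X"
    by (metis finite_distinct_list distinct_card finite_code)
  define \<phi> :: "('a, 'k) mpoly list" where "\<phi> = map var xs"
  have "nzd (pre_ideal P \<phi> i) (\<phi> ! i)" if i: "i < length \<phi>" for i
  proof -
    have "pre_ideal P \<phi> i =
        mon_ideal ({m. \<not> keys m \<subseteq> X} \<union> {m. keys m \<inter> set (take i xs) \<noteq> {}})"
      using gen_ideal_mon_Un_vars[OF upset_not_subset, of X "set (take i xs)"]
      by (simp add: pre_ideal_def \<phi>_def P_def take_map)
    moreover have "xs ! i \<in> X" "xs ! i \<notin> set (take i xs)"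
      using i xs by (auto simp: \<phi>_def distinct_conv_nth in_set_conv_nth)
    then have "nzd (mon_ideal ({m. \<not> keys m \<subseteq> X} \<union> {m. keys m \<inter> set (take i xs) \<noteq> {}}))
        (var (xs ! i) :: ('a, 'k) mpoly)"
      by (intro nzd_var) (auto simp: keys_exps_add)
    ultimately show ?thesis
      using i by (simp add: \<phi>_def)
  qed
  then have "reg P \<phi>"
    by (simp add: reg_iff_nth[OF P(2)])
  moreover have "par P \<phi>"
  proof -
    have "var v \<in> P \<union> set \<phi>" for v
      by (cases "v \<in> X") (auto simp: P_def \<phi>_def xs(1) var_def mon_mem_mon_ideal)
    then show ?thesis
      using gen_ideal_superset[of "P \<union> set \<phi>"] radical_superset
      unfolding par_def by blast
  qed
  moreover have "\<forall>t\<in>set \<phi>. homog_pos t"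
    by (auto simp: \<phi>_def homog_pos_var)
  moreover have "length \<phi> = length th"
    using assms(2) xs(3) by (simp add: \<phi>_def)
  ultimately have "reg P th"
    using reg_if_par[OF P(1), of \<phi> th] assms by (simp add: P_def)
  then show ?thesis
    by (simp add: P_def)
qed

text \<open>Modulo the prime of either part \<open>X\<close> every system of parameters is regular, and multiplication by
  a variable of \<open>X\<close> maps this prime into the Stanley-Reisner ideal.\<close>

theorem buchsbaum_complete_bipartite:
  fixes E :: "'a::finite \<Rightarrow> 'a \<Rightarrow> bool"
  assumes "is_complete_bipartite_nn E n"
  shows "buchsbaum_cx TYPE('k::field) (Ind E)"
proof -
  obtain A where A: "card A = n" "card (- A) = n" "\<And>u v. E u v \<longleftrightarrow> (u \<in> A \<longleftrightarrow> v \<notin> A)"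
    using assms by (auto simp: is_complete_bipartite_nn_def)
  have Ind: "S \<in> Ind E \<longleftrightarrow> S \<subseteq> A \<or> S \<subseteq> - A" for S
    by (auto simp: Ind_def A(3))
  define I where "I = SR_ideal TYPE('k) (Ind E)"
  have I: "I = mon_ideal {m. keys m \<notin> Ind E}"
    unfolding I_def by (rule SR_ideal_eq[OF Ind_down_closed])
  have "card G \<le> card A" if "G \<in> Ind E" for G
    using that A(1,2) card_mono[of A G] card_mono[of "- A" G] by (auto simp: Ind)
  then have dim: "krull_dim_quot I = n"
    using krull_dim_SR[OF Ind_down_closed, of A E, where 'k = 'k] Ind[of A] A(1) by (simp add: I_def)
  have "weak_seq TYPE('k) I th" if "hsop TYPE('k) I th" for th
  proof -
    have th: "length th = n" "\<forall>t\<in>set th. homog_pos t" "par I th"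
      using that dim hsop_iff[OF SR_subset_max_homog[OF empty_in_Ind Ind_down_closed], of E th]
      by (auto simp: I_def)
    have side: "var v * g \<in> pre_ideal I th i"
      if i: "i < length th" and g: "th ! i * g \<in> pre_ideal I th i" and v: "v \<in> X"
        and X: "card X = n" "X = A \<or> X = - A" for i g v X
    proof -
      define P :: "('a, 'k) mpoly set" where "P = mon_ideal {m. \<not> keys m \<subseteq> X}"
      have P: "is_ideal P"
        unfolding P_def by (rule is_ideal_mon_ideal[OF upset_not_subset])
      have IP: "I \<subseteq> P"
        unfolding I P_def mon_ideal_def using X(2) Ind by blast
      have pre: "pre_ideal I th i \<subseteq> pre_ideal P th i"
        unfolding pre_ideal_def using IP by (intro gen_ideal_mono) auto
      have "par P th"
        using th(3) IP radical_mono[OF gen_ideal_mono[of "I \<union> set th" "P \<union> set th"]]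
        unfolding par_def by blast
      then have "reg P th"
        unfolding P_def using th X(1) by (intro reg_face_ideal) auto
      then have "nzd (pre_ideal P th i) (th ! i)"
        using i by (simp add: reg_iff_nth[OF P])
      then have gP: "g \<in> pre_ideal P th i"
        using g pre by (blast intro: nzdD)
      \<comment> \<open>It suffices to check generators: this conductor ideal contains
        \<open>P\<close>, because a nonsubset of \<open>X\<close> together with a vertex of
        \<open>X\<close> is never a face, and it contains the earlier parameters.\<close>
      have "is_ideal {f. var v * f \<in> pre_ideal I th i}"
        using is_ideal_pre[of I th i] by (auto simp: is_ideal_def distrib_left mult.left_commute)
      then have "pre_ideal P th i \<subseteq> {f. var v * f \<in> pre_ideal I th i}"
      proof (rule pre_ideal_least)
        show "P \<subseteq> {f. var v * f \<in> pre_ideal I th i}"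
          unfolding P_def
        proof (rule mon_ideal_subset_ideal[OF \<open>is_ideal {f. _ f}\<close>])
          fix m :: "'a \<Rightarrow>\<^sub>0 nat" assume "m \<in> {m. \<not> keys m \<subseteq> X}"
          then have "keys (expv v + m) \<notin> Ind E"
            using v X(2) by (auto simp: Ind keys_exps_add)
          then have "var v * mon m \<in> I"
            by (simp add: I var_def mon_times mon_mem_mon_ideal)
          then show "mon m \<in> {f. var v * f \<in> pre_ideal I th i}"
            using pre_ideal_superset by auto
        qed
        show "th ! j \<in> {f. var v * f \<in> pre_ideal I th i}" if "j < i" "j < length th" for j
          using pre_ideal_mem[OF that] by (simp add: ideal_mult is_ideal_pre)
      qed
      then show ?thesis
        using gP by blast
    qed
    then have "var v * g \<in> pre_ideal I th i"
      if "i < length th" "th ! i * g \<in> pre_ideal I th i" for i g v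
      using that A(1,2) by (cases "v \<in> A") blast+
    then show ?thesis
      using th(2) by (subst weak_seq_iff) (auto intro: homog_pos_in_max_homog)
  qed
  then show ?thesis
    by (simp add: buchsbaum_cx_def buchsbaum_quot_def I_def)
qed

section \<open>Perfect matchings\<close>

text \<open>If a nonempty proper subset is tight, it is matched into its neighbours and the rest
  outside them; the condition survives by subtracting the tight equality. Otherwise every such
  subset has a neighbour to spare, so any edge may be fixed and removed.\<close>

lemma hall:
  fixes N :: "'a \<Rightarrow> 'b set"
  assumes "finite A" "\<And>x. x \<in> A \<Longrightarrow> finite (N x)"
    and "\<And>X. X \<subseteq> A \<Longrightarrow> card X \<le> card (\<Union> (N ` X))"
  shows "\<exists>f. inj_on f A \<and> (\<forall>x\<in>A. f x \<in> N x)"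
  using assms
proof (induction "card A" arbitrary: A N rule: less_induct)
  case less
  have fin: "finite (\<Union> (N ` X))" if "X \<subseteq> A" for X
    using less.prems(1,2) that by (meson finite_UN finite_subset subsetD)
  show ?case
  proof (cases "A = {}")
    case False
    show ?thesis
    proof (cases "\<exists>X. X \<subset> A \<and> X \<noteq> {} \<and> card X = card (\<Union> (N ` X))")
      case True
      then obtain X where X: "X \<subset> A" "X \<noteq> {}" "card X = card (\<Union> (N ` X))" by blast
      have finX: "finite X" using X(1) less.prems(1) by (auto intro: finite_subset)
      have "\<exists>f. inj_on f X \<and> (\<forall>x\<in>X. f x \<in> N x)"
        using X(1) less.prems finX by (intro less.hyps psubset_card_mono) auto
      then obtain f where f: "inj_on f X" "\<And>x. x \<in> X \<Longrightarrow> f x \<in> N x" by blast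
      define N' where "N' x = N x - \<Union> (N ` X)" for x
      have "\<exists>g. inj_on g (A - X) \<and> (\<forall>x\<in>A - X. g x \<in> N' x)"
      proof (rule less.hyps)
        show "card (A - X) < card A"
          using X less.prems(1) by (intro psubset_card_mono) auto
        fix Y assume Y: "Y \<subseteq> A - X"
        then have finY: "finite Y" using less.prems(1) by (auto intro: finite_subset)
        have "card X + card Y = card (X \<union> Y)"
          using Y finX finY by (intro card_Un_disjoint[symmetric]) auto
        also have "\<dots> \<le> card (\<Union> (N ` (X \<union> Y)))"
          using X(1) Y by (intro less.prems(3)) auto
        also have "\<Union> (N ` (X \<union> Y)) = \<Union> (N ` X) \<union> \<Union> (N' ` Y)"
          by (auto simp: N'_def)
        also have "card \<dots> \<le> card (\<Union> (N ` X)) + card (\<Union> (N' ` Y))"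
          by (rule card_Un_le)
        finally show "card Y \<le> card (\<Union> (N' ` Y))"
          using X(3) by simp
      qed (use less.prems in \<open>auto simp: N'_def\<close>)
      then obtain g where g: "inj_on g (A - X)" "\<And>x. x \<in> A - X \<Longrightarrow> g x \<in> N' x" by blast
      define h where "h x = (if x \<in> X then f x else g x)" for x
      have "inj_on h A"
      proof (rule inj_onI)
        fix x y assume *: "x \<in> A" "y \<in> A" "h x = h y"
        have ne: "f u \<noteq> g w" if "u \<in> X" "w \<in> A - X" for u w
          using f(2)[OF that(1)] g(2)[OF that(2)] that(1) by (auto simp: N'_def)
        show "x = y"
          using * ne[of x y] ne[of y x] inj_onD[OF f(1), of x y] inj_onD[OF g(1), of x y]
          by (auto simp: h_def split: if_splits)
      qed
      then show ?thesis
        using f(2) g(2) by (intro exI[of _ h]) (auto simp: h_def N'_def)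
    next
      case noX: False
      obtain a where a: "a \<in> A" using False by blast
      then have "card {a} \<le> card (\<Union> (N ` {a}))"
        by (intro less.prems(3)) auto
      then obtain b where b: "b \<in> N a"
        by fastforce
      define N' where "N' x = N x - {b}" for x
      have "\<exists>g. inj_on g (A - {a}) \<and> (\<forall>x\<in>A - {a}. g x \<in> N' x)"
      proof (rule less.hyps)
        show "card (A - {a}) < card A"
          using a less.prems(1) by (intro psubset_card_mono) auto
        fix Y assume Y: "Y \<subseteq> A - {a}"
        show "card Y \<le> card (\<Union> (N' ` Y))"
        proof (cases "Y = {}")
          case False
          then have "card Y < card (\<Union> (N ` Y))"
            using noX Y a less.prems(3)[of Y] by (metis Diff_empty Diff_insert_absorb insert_Diff le_neq_implies_less psubsetI subset_Diff_insert subset_iff)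
          moreover have "\<Union> (N' ` Y) = \<Union> (N ` Y) - {b}"
            by (auto simp: N'_def)
          moreover have "card (\<Union> (N ` Y)) - 1 \<le> card (\<Union> (N ` Y) - {b})"
            by (simp add: card_Diff_singleton_if)
          ultimately show ?thesis
            by simp
        qed simp
      qed (use less.prems in \<open>auto simp: N'_def\<close>)
      then obtain g where g: "inj_on g (A - {a})" "\<And>x. x \<in> A - {a} \<Longrightarrow> g x \<in> N' x" by blast
      have "inj_on (g(a := b)) A"
      proof (rule inj_onI)
        fix x y assume "x \<in> A" "y \<in> A" "(g(a := b)) x = (g(a := b)) y"
        then show "x = y"
          using g(2)[of x] g(2)[of y] inj_onD[OF g(1), of x y]
          by (auto simp: N'_def split: if_splits)
      qed
      then show ?thesis
        using g(2) b by (intro exI[of _ "g(a := b)"]) (auto simp: N'_def)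
    qed
  qed simp
qed

text \<open>A bipartite graph on \<open>A \<union> \<mu> A\<close> with isolated vertices \<open>Z\<close>, for which \<open>i \<le> j \<longleftrightarrow> E i (\<mu> j)\<close> is a
  preorder on \<open>A\<close>.\<close>

locale matched_graph =
  fixes E :: "'a::finite \<Rightarrow> 'a \<Rightarrow> bool" and A Z :: "'a set" and \<mu> :: "'a \<Rightarrow> 'a"
  assumes sym: "E u v \<Longrightarrow> E v u"
    and edge: "E u v \<Longrightarrow> u \<in> A \<and> v \<in> \<mu> ` A \<or> v \<in> A \<and> u \<in> \<mu> ` A"
    and inj: "inj_on \<mu> A"
    and disj: "A \<inter> \<mu> ` A = {}" "Z \<inter> A = {}" "Z \<inter> \<mu> ` A = {}"
    and UNIV: "A \<union> \<mu> ` A \<union> Z = UNIV"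
    and refl: "i \<in> A \<Longrightarrow> E i (\<mu> i)"
    and trans: "i \<in> A \<Longrightarrow> j \<in> A \<Longrightarrow> k \<in> A \<Longrightarrow> E i (\<mu> j) \<Longrightarrow> E j (\<mu> k) \<Longrightarrow> E i (\<mu> k)"

lemma matched_graph_if_pure:
  fixes E :: "'a::finite \<Rightarrow> 'a \<Rightarrow> bool"
  assumes E: "simple_graph E" "bipartite E"
    and pure: "\<And>S. S \<in> Ind E \<Longrightarrow> \<exists>M\<in>Ind E. S \<subseteq> M \<and> card M = d" "\<And>S. S \<in> Ind E \<Longrightarrow> card S \<le> d"
  obtains A Z \<mu> where "matched_graph E A Z \<mu>"
proof -
  have sym: "E u v \<Longrightarrow> E v u" for u v
    using E(1) by (auto simp: simple_graph_def)
  have irr: "\<not> E u u" for u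
    using E(1) by (simp add: simple_graph_def)
  obtain A0 where A0: "\<And>u v. E u v \<Longrightarrow> u \<in> A0 \<longleftrightarrow> v \<notin> A0"
    using E(2) by (auto simp: bipartite_def)
  define Z where "Z = {v. \<forall>u. \<not> E v u}"
  define A B where "A = A0 - Z" and "B = - A0 - Z"
  have Z: "\<not> E z u" "\<not> E u z" if "z \<in> Z" for z u
    using that sym by (auto simp: Z_def)
  have part: "A \<inter> B = {}" "Z \<inter> A = {}" "Z \<inter> B = {}" "A \<union> B \<union> Z = UNIV"
    by (auto simp: A_def B_def)
  have edge: "u \<in> A \<and> v \<in> B \<or> v \<in> A \<and> u \<in> B" if "E u v" for u v
    using that A0[OF that] Z by (auto simp: A_def B_def)
  \<comment> \<open>Each side together with \<open>Z\<close> is a facet, since any further vertex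
    has a neighbour on that side; purity then fixes its size, and the two sides are equally
    large.\<close>
  have card_side: "card X + card Z = d" if X: "X = A \<or> X = B" for X
  proof -
    have "X \<union> Z \<in> Ind E"
      using X edge part Z by (fastforce simp: Ind_def)
    then obtain M where M: "M \<in> Ind E" "X \<union> Z \<subseteq> M" "card M = d"
      using pure(1) by blast
    have "M \<subseteq> X \<union> Z"
    proof
      fix v assume v: "v \<in> M"
      show "v \<in> X \<union> Z"
      proof (rule ccontr)
        assume "v \<notin> X \<union> Z"
        then obtain u where u: "E v u" by (auto simp: Z_def)
        then have "u \<in> X"
          using edge[OF u] X part \<open>v \<notin> X \<union> Z\<close> by blast
        then show False
          using M(1,2) v u by (auto simp: Ind_def)
      qed
    qed
    then have "M = X \<union> Z" using M(2) by blast
    moreover have "card (X \<union> Z) = card X + card Z"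
      using X part by (intro card_Un_disjoint) auto
    ultimately show ?thesis using M(3) by simp
  qed
  have "\<exists>\<mu>. inj_on \<mu> A \<and> (\<forall>x\<in>A. \<mu> x \<in> {v. E x v})"
  proof (rule hall)
    fix X assume X: "X \<subseteq> A"
    define NX where "NX = \<Union> ((\<lambda>x. {v. E x v}) ` X)"
    have NX: "NX \<subseteq> B"
      using X edge part by (auto simp: NX_def)
    \<comment> \<open>Independence of this set is Hall's condition in disguise: its size is at most
      \<open>d = card B + card Z\<close>.\<close>
    have "X \<union> (B - NX) \<union> Z \<in> Ind E"
      unfolding Ind_def
    proof (intro CollectI ballI notI)
      fix u v assume uv: "u \<in> X \<union> (B - NX) \<union> Z" "v \<in> X \<union> (B - NX) \<union> Z" "E u v"
      have "w \<in> NX" if "E x w" "x \<in> X" for x w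
        using that by (auto simp: NX_def)
      then show False
        using uv edge[OF uv(3)] sym[OF uv(3)] Z[of u v] Z[of v u] X part by blast
    qed
    then have "card (X \<union> (B - NX) \<union> Z) \<le> d"
      by (rule pure(2))
    also have "card (X \<union> (B - NX) \<union> Z) = card X + card (B - NX) + card Z"
      using X part by (subst card_Un_disjoint, simp, simp, blast, subst card_Un_disjoint) auto
    also have "card (B - NX) = card B - card NX"
      using NX by (intro card_Diff_subset) auto
    finally show "card X \<le> card NX"
      using card_side[of B] card_mono[OF _ NX] by simp
  qed auto
  then obtain \<mu> where \<mu>: "inj_on \<mu> A" "\<And>x. x \<in> A \<Longrightarrow> E x (\<mu> x)" by blast
  have "\<mu> ` A \<subseteq> B"
    using \<mu>(2) edge part by blast
  moreover have "card (\<mu> ` A) = card B"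
    using card_image[OF \<mu>(1)] card_side[of A] card_side[of B] by simp
  ultimately have img: "\<mu> ` A = B"
    by (intro card_subset_eq) auto
  \<comment> \<open>A nonadjacent pair \<open>i\<close>, \<open>\<mu> k\<close> extends to an
    independent set \<open>M\<close> of size \<open>d\<close>, which must meet every matched edge.
    But \<open>i\<close> excludes \<open>\<mu> j\<close> and \<open>\<mu> k\<close> excludes
    \<open>j\<close>, so the edge of \<open>j\<close> is missed.\<close>
  have trans: "E i (\<mu> k)" if ijk: "i \<in> A" "j \<in> A" "k \<in> A" "E i (\<mu> j)" "E j (\<mu> k)" for i j k
  proof (rule ccontr)
    assume "\<not> E i (\<mu> k)"
    then have "{i, \<mu> k} \<in> Ind E"
      using irr sym by (auto simp: Ind_def)
    then obtain M where M: "M \<in> Ind E" "i \<in> M" "\<mu> k \<in> M" "card M = d"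
      using pure(1)[of "{i, \<mu> k}"] by auto
    have notE: "\<not> E u v" if "u \<in> M" "v \<in> M" for u v
      using that M(1) by (auto simp: Ind_def)
    define U where "U = {a \<in> A. \<mu> a \<in> M}"
    have "M \<inter> B = \<mu> ` U"
      using img by (auto simp: U_def)
    then have "card (M \<inter> B) = card U"
      using card_image[OF inj_on_subset[OF \<mu>(1), of U]] by (auto simp: U_def)
    moreover have "card (M \<inter> A) + card U = card (M \<inter> A \<union> U)"
      using \<mu>(2) notE by (intro card_Un_disjoint[symmetric]) (auto simp: U_def)
    moreover have "j \<notin> M \<inter> A \<union> U"
      using ijk M notE by (auto simp: U_def)
    then have "M \<inter> A \<union> U \<subset> A"
      using ijk(2) by (auto simp: U_def)
    then have "card (M \<inter> A \<union> U) < card A"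
      by (intro psubset_card_mono) auto
    moreover have "card (M \<inter> Z) \<le> card Z"
      by (intro card_mono) auto
    moreover have "card M \<le> card (M \<inter> A) + card (M \<inter> B) + card (M \<inter> Z)"
    proof -
      have "M = (M \<inter> A \<union> M \<inter> B) \<union> M \<inter> Z" using part by blast
      then show ?thesis
        using card_Un_le[of "M \<inter> A \<union> M \<inter> B" "M \<inter> Z"] card_Un_le[of "M \<inter> A" "M \<inter> B"] by simp
    qed
    ultimately show False
      using card_side[of A] M(4) by simp
  qed
  show ?thesis
  proof (rule that)
    show "matched_graph E A Z \<mu>"
    proof
      show "E v u" if "E u v" for u v
        using that by (rule sym)
      show "u \<in> A \<and> v \<in> \<mu> ` A \<or> v \<in> A \<and> u \<in> \<mu> ` A" if "E u v" for u v
        using edge[OF that] by (simp add: img)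
      show "A \<inter> \<mu> ` A = {}" "Z \<inter> A = {}" "Z \<inter> \<mu> ` A = {}" "A \<union> \<mu> ` A \<union> Z = UNIV"
        using part by (simp_all add: img)
    qed (fact \<mu> trans)+
  qed
qed

section \<open>Congruences modulo an ideal and cancellation of variables\<close>

lemma ideal_cong_mult:
  "is_ideal J \<Longrightarrow> a - b \<in> J \<Longrightarrow> c - d \<in> J \<Longrightarrow> a * c - b * d \<in> J"
  using ideal_add[OF _ ideal_mult2[of J "a - b" c] ideal_mult[of J "c - d" b]]
  by (simp add: algebra_simps)

lemma ideal_cong_power: "is_ideal J \<Longrightarrow> a - b \<in> J \<Longrightarrow> a ^ n - b ^ n \<in> J"
  by (induction n) (auto intro: ideal_cong_mult ideal_zero)

lemma ideal_cong_prod: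
  "is_ideal J \<Longrightarrow> (\<And>x. x \<in> X \<Longrightarrow> f x - g x \<in> J) \<Longrightarrow> prod f X - prod g X \<in> J"
  by (induction X rule: infinite_finite_induct) (auto intro: ideal_cong_mult ideal_zero)

text \<open>Congruences multiply, so replacing every variable by a congruent one changes each
  monomial only within \<open>J\<close>.\<close>

lemma push_rename_cong:
  fixes J :: "('a::finite, 'k::comm_ring_1) mpoly set"
  assumes J: "is_ideal J" and r: "\<And>v. var v - var (r v) \<in> J"
  shows "f - push (rename r) f \<in> J"
proof (induction f rule: mpoly_induct)
  case (single m c)
  have m: "m = (\<Sum>v\<in>UNIV. single v (lookup m v))"
    by (rule poly_mapping_eqI) (simp add: lookup_sum lookup_single when_def)
  have "(mon m :: ('a, 'k) mpoly) = (\<Prod>v\<in>UNIV. var v ^ lookup m v)"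
    by (subst m) (simp add: mon_sum var_power)
  moreover have "(mon (rename r m) :: ('a, 'k) mpoly) = (\<Prod>v\<in>UNIV. var (r v) ^ lookup m v)"
    by (simp add: rename_def mon_sum var_power)
  ultimately have "mon m - mon (rename r m) \<in> J"
    by (simp add: ideal_cong_prod ideal_cong_power J r)
  then have "single 0 c * (mon m - mon (rename r m)) \<in> J"
    by (rule ideal_mult[OF J])
  then show ?case
    by (simp add: right_diff_distrib flip: single_eq_const_mon)
next
  case (add p q)
  have eq: "p + q - push (rename r) (p + q) = (p - push (rename r) p) + (q - push (rename r) q)"
    by (simp add: push_add)
  show ?case
    unfolding eq by (rule ideal_add[OF J add])
qed

lemma expv_cancel:
  assumes "expv i + u = expv a + expv c + k" "i \<noteq> a" "i \<noteq> c"
  obtains k' where "u = expv a + expv c + k'"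
proof -
  have "i \<in> keys (expv a + expv c + k)"
    unfolding assms(1)[symmetric] by (simp add: keys_exps_add)
  then have "i \<in> keys k"
    using assms(2,3) by (simp add: keys_exps_add)
  then obtain k' where "k = expv i + k'"
    by (rule expv_dvd)
  then have "expv i + u = expv i + (expv a + expv c + k')"
    using assms(1) by (simp add: add_ac)
  then show ?thesis
    using that by (metis add_left_imp_eq)
qed

lemma expv_add_dvd:
  assumes "a \<in> keys u" "c \<in> keys u" "a \<noteq> c"
  obtains k where "u = expv a + expv c + k"
proof -
  obtain w where w: "u = expv a + w"
    using expv_dvd[OF assms(1)] .
  then have "c \<in> keys w"
    using assms(2,3) by (simp add: keys_exps_add)
  then obtain k where "w = expv c + k"
    by (rule expv_dvd)
  then show ?thesis
    using that w by (simp add: add.assoc)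
qed

section \<open>Algebra of the independence complex of a matched graph\<close>

context matched_graph
begin

lemma notin_image: "i \<in> A \<Longrightarrow> i \<notin> \<mu> ` A"
  using disj by blast

lemma partner_notin: "i \<in> A \<Longrightarrow> \<mu> i \<notin> A"
  using disj by blast

lemma irrefl: "\<not> E u u"
  using edge[of u u] disj by blast

lemma isolated: "z \<in> Z \<Longrightarrow> \<not> E z u \<and> \<not> E u z"
  using edge[of z u] edge[of u z] disj by blast

lemma card_Ind_le:
  assumes "S \<in> Ind E"
  shows "card S \<le> card A + card Z"
proof -
  have notE: "\<not> E u v" if "u \<in> S" "v \<in> S" for u v
    using assms that by (auto simp: Ind_def)
  define U where "U = {a \<in> A. \<mu> a \<in> S}"
  have "S \<inter> \<mu> ` A = \<mu> ` U"
    by (auto simp: U_def)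
  then have "card (S \<inter> \<mu> ` A) \<le> card U"
    by (simp add: card_image_le)
  moreover have "card (S \<inter> A) + card U = card (S \<inter> A \<union> U)"
    using refl notE by (intro card_Un_disjoint[symmetric]) (auto simp: U_def)
  moreover have "card (S \<inter> A \<union> U) \<le> card A" "card (S \<inter> Z) \<le> card Z"
    by (auto intro!: card_mono simp: U_def)
  moreover have "S = (S \<inter> A \<union> S \<inter> \<mu> ` A) \<union> S \<inter> Z"
    using UNIV by blast
  then have "card S \<le> card (S \<inter> A) + card (S \<inter> \<mu> ` A) + card (S \<inter> Z)"
    using card_Un_le[of "S \<inter> A \<union> S \<inter> \<mu> ` A" "S \<inter> Z"] card_Un_le[of "S \<inter> A" "S \<inter> \<mu> ` A"]
    by simp
  ultimately show ?thesis by simp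
qed

lemma krull_dim: "krull_dim_quot (SR_ideal TYPE('k::field) (Ind E)) = card A + card Z"
proof -
  have "A \<union> Z \<in> Ind E"
    using edge disj isolated by (fastforce simp: Ind_def)
  moreover have card: "card (A \<union> Z) = card A + card Z"
    using disj by (intro card_Un_disjoint) auto
  ultimately show ?thesis
    using krull_dim_SR[OF Ind_down_closed, of "A \<union> Z" E] card_Ind_le by simp
qed

text \<open>Lists instead of sets, because the weak sequence condition depends on the order and
  \<open>not_buchsbaum\<close> needs two prescribed elements in front.\<close>

definition params :: "'a list \<Rightarrow> 'a list \<Rightarrow> ('a, 'k::comm_ring_1) mpoly list" where
  "params as zs = map (\<lambda>i. var i - var (\<mu> i)) as @ map var zs"

lemma params_pos: "\<forall>t\<in>set (params as zs). homog_pos t"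
  unfolding params_def homog_pos_iff
  by (auto intro!: exI[of _ 1] simp: homog_diff homog_var[unfolded One_nat_def])

lemma edge_in_SR: "E u v \<Longrightarrow> var u * var v \<in> SR_ideal TYPE('k::comm_ring_1) (Ind E)"
  using mon_in_SR[OF Ind_down_closed, of "expv u + expv v" E, where 'k = 'k]
  by (auto simp: Ind_def var_def mon_times keys_exps_add)

text \<open>The square of \<open>var i\<close> is \<open>var i * (var i - var (\<mu> i))\<close>
  plus an edge monomial, so both ends of a matched edge are nilpotent modulo the parameters.\<close>

lemma params_par:
  assumes "set as = A" "set zs = Z"
  shows "par (SR_ideal TYPE('k::comm_ring_1) (Ind E)) (params as zs)"
proof -
  define J where "J = gen_ideal (SR_ideal TYPE('k) (Ind E) \<union> set (params as zs))"
  have J: "is_ideal J" and sup: "SR_ideal TYPE('k) (Ind E) \<union> set (params as zs) \<subseteq> J"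
    unfolding J_def by (rule is_ideal_gen, rule gen_ideal_superset)
  have d: "var i - var (\<mu> i) \<in> J" if "i \<in> A" for i
    using sup that assms by (auto simp: params_def)
  have e: "var i * var (\<mu> i) \<in> J" if "i \<in> A" for i
    using sup edge_in_SR[OF refl[OF that], where 'k = 'k] by blast
  have "var v \<in> radical J" for v
  proof -
    consider "v \<in> A" | i where "i \<in> A" "v = \<mu> i" | "v \<in> Z"
      using UNIV by blast
    then show ?thesis
    proof cases
      case 1
      have "var v * (var v - var (\<mu> v)) + var v * var (\<mu> v) \<in> J"
        using 1 by (intro ideal_add J ideal_mult d e)
      then show ?thesis
        by (intro radicalI[of _ 2]) (simp add: power2_eq_square algebra_simps)
    next
      case 2
      have "var i * var (\<mu> i) - var (\<mu> i) * (var i - var (\<mu> i)) \<in> J"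
        using 2 by (intro ideal_diff J ideal_mult d e)
      then show ?thesis
        using 2 by (intro radicalI[of _ 2]) (simp add: power2_eq_square algebra_simps)
    next
      case 3
      then show ?thesis
        using sup radical_superset[of J] assms by (auto simp: params_def)
    qed
  qed
  then show ?thesis
    by (auto simp: par_def J_def)
qed

lemma lists_exist:
  obtains as zs where "set as = A" "distinct as" "set zs = Z" "distinct zs"
    "length as = card A" "length zs = card Z"
  by (metis finite_distinct_list distinct_card finite_code)

text \<open>Modulo the differences \<open>x\<^sub>i - x\<^bsub>\<mu> i\<^esub>\<close> for \<open>i \<in> T\<close> the Stanley-Reisner ideal becomes the monomial
  ideal spanned by \<open>quot_mons\<close>; the renaming \<open>coll\<close> implements this quotient.\<close>

definition coll :: "'a set \<Rightarrow> 'a \<Rightarrow> 'a" where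
  "coll T v = (if v \<in> \<mu> ` T then inv_into A \<mu> v else v)"

text \<open>These generators need not be squarefree: for \<open>a = b\<close> in \<open>T\<close>
  the matched edge of \<open>a\<close> collapses to the square of \<open>var a\<close>.\<close>

definition quot_mons :: "'a set \<Rightarrow> 'a set \<Rightarrow> ('a \<Rightarrow>\<^sub>0 nat) set" where
  "quot_mons T Z' = {m. (\<exists>a\<in>A. \<exists>b\<in>A. \<exists>k. E a (\<mu> b) \<and> m = expv a + expv (coll T (\<mu> b)) + k) \<or>
    keys m \<inter> Z' \<noteq> {}}"

lemma coll_partner: "T \<subseteq> A \<Longrightarrow> b \<in> A \<Longrightarrow> coll T (\<mu> b) = (if b \<in> T then b else \<mu> b)"
  using inj by (auto simp: coll_def inj_on_def)

lemma coll_id: "T \<subseteq> A \<Longrightarrow> v \<notin> \<mu> ` A \<Longrightarrow> coll T v = v"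
  by (auto simp: coll_def)

lemma upset_quot_mons: "upset (quot_mons T Z')"
  unfolding upset_def
proof (intro ballI allI)
  fix m n assume "m \<in> quot_mons T Z'"
  then consider a b k where "a \<in> A" "b \<in> A" "E a (\<mu> b)" "m = expv a + expv (coll T (\<mu> b)) + k"
    | "keys m \<inter> Z' \<noteq> {}"
    unfolding quot_mons_def by blast
  then show "m + n \<in> quot_mons T Z'"
  proof cases
    case 1
    then have "m + n = expv a + expv (coll T (\<mu> b)) + (k + n)"
      by (simp add: add.assoc)
    then show ?thesis
      using 1(1-3) unfolding quot_mons_def by blast
  next
    case 2
    then show ?thesis by (auto simp: quot_mons_def keys_exps_add)
  qed
qed

lemma quot_mons_edge: "a \<in> A \<Longrightarrow> b \<in> A \<Longrightarrow> E a (\<mu> b) \<Longrightarrow> expv a + expv (coll T (\<mu> b)) + k \<in> quot_mons T Z'"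
  unfolding quot_mons_def by blast

text \<open>The renaming sends every generator of \<open>J\<close> into the monomial ideal.
  Conversely, \<open>f\<close> is congruent to its renaming modulo \<open>J\<close>, and the
  monomial ideal itself lies in \<open>J\<close>.\<close>

lemma quot_ideal:
  fixes T Z' :: "'a set"
  assumes T: "T \<subseteq> A" and Z': "Z' \<subseteq> Z"
  defines "J \<equiv> gen_ideal (SR_ideal TYPE('k::comm_ring_1) (Ind E) \<union>
    ((\<lambda>i. var i - var (\<mu> i)) ` T \<union> var ` Z'))"
  shows "f \<in> J \<longleftrightarrow> push (rename (coll T)) f \<in> mon_ideal (quot_mons T Z')"
proof -
  define \<rho> :: "('a, 'k) mpoly \<Rightarrow> ('a, 'k) mpoly" where "\<rho> = push (rename (coll T))"
  define M :: "('a, 'k) mpoly set" where "M = mon_ideal (quot_mons T Z')"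
  have M: "is_ideal M"
    unfolding M_def by (rule is_ideal_mon_ideal[OF upset_quot_mons])
  have J: "is_ideal J"
    unfolding J_def by (rule is_ideal_gen)
  have sup: "SR_ideal TYPE('k) (Ind E) \<subseteq> J" "\<And>i. i \<in> T \<Longrightarrow> var i - var (\<mu> i) \<in> J"
      "\<And>z. z \<in> Z' \<Longrightarrow> var z \<in> J"
    using gen_ideal_superset[of "SR_ideal TYPE('k) (Ind E) \<union> ((\<lambda>i. var i - var (\<mu> i)) ` T \<union> var ` Z')"]
    by (auto simp: J_def)
  have \<rho>: "\<rho> (p + q) = \<rho> p + \<rho> q" "\<rho> (p - q) = \<rho> p - \<rho> q" "\<rho> (p * q) = \<rho> p * \<rho> q" "\<rho> 0 = 0"
      "\<rho> (mon m) = mon (rename (coll T) m)" "\<rho> (var v) = var (coll T v)" for p q m v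
    by (simp_all add: \<rho>_def push_add push_diff push_mult[OF rename_add] var_def rename_expv[simplified])
  have preimage: "is_ideal {f. \<rho> f \<in> M}"
    using M by (auto simp: is_ideal_def \<rho>)
  have "J \<subseteq> {f. \<rho> f \<in> M}"
    unfolding J_def
  proof (rule gen_ideal_least[OF preimage])
    have "SR_ideal TYPE('k) (Ind E) \<subseteq> {f. \<rho> f \<in> M}"
      unfolding SR_ideal_eq[OF Ind_down_closed]
    proof (rule mon_ideal_subset_ideal[OF preimage])
      fix m :: "'a \<Rightarrow>\<^sub>0 nat" assume "m \<in> {m. keys m \<notin> Ind E}"
      then obtain u v where uv: "u \<in> keys m" "v \<in> keys m" "E u v"
        by (auto simp: Ind_def)
      then obtain a b where ab: "a \<in> keys m" "\<mu> b \<in> keys m" "a \<in> A" "b \<in> A" "E a (\<mu> b)"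
        using edge[OF uv(3)] sym by blast
      then have "a \<noteq> \<mu> b" using partner_notin by blast
      from expv_add_dvd[OF ab(1,2) this] obtain k where "m = expv a + expv (\<mu> b) + k" .
      then have "rename (coll T) m = expv a + expv (coll T (\<mu> b)) + rename (coll T) k"
        by (simp only: rename_add rename_expv coll_id[OF T notin_image[OF ab(3)]])
      then show "mon m \<in> {f. \<rho> f \<in> M}"
        using quot_mons_edge[OF ab(3-5)] by (simp add: \<rho> M_def mon_mem_mon_ideal)
    qed
    moreover have "var i - var (\<mu> i) \<in> {f. \<rho> f \<in> M}" if "i \<in> T" for i
    proof -
      have "i \<in> A" using T that by blast
      then show ?thesis
        using ideal_zero[OF M] that
        by (simp add: \<rho> coll_partner[OF T] coll_id[OF T notin_image])
    qed
    moreover have "var z \<in> {f. \<rho> f \<in> M}" if "z \<in> Z'" for z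
    proof -
      have "z \<notin> \<mu> ` A" using Z' that disj by blast
      then have "coll T z = z" by (rule coll_id[OF T])
      then show ?thesis
        using that by (simp add: \<rho>(6)) (simp add: M_def var_def mon_mem_mon_ideal quot_mons_def)
    qed
    ultimately show "SR_ideal TYPE('k) (Ind E) \<union> ((\<lambda>i. var i - var (\<mu> i)) ` T \<union> var ` Z') \<subseteq> {f. \<rho> f \<in> M}"
      by blast
  qed
  moreover have "f \<in> J" if "\<rho> f \<in> M" for f
  proof -
    have r: "var v - var (coll T v) \<in> J" for v
    proof (cases "v \<in> \<mu> ` T")
      case True
      then obtain i where i: "i \<in> T" "v = \<mu> i" by blast
      then have "coll T v = i"
        using T coll_partner[OF T, of i] by auto
      then show ?thesis
        using ideal_uminus[OF J sup(2)[OF i(1)]] i(2) by simp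
    next
      case False
      then show ?thesis
        using ideal_zero[OF J] by (simp add: coll_def)
    qed
    have "M \<subseteq> J"
      unfolding M_def
    proof (rule mon_ideal_subset_ideal[OF J])
      fix m assume "m \<in> quot_mons T Z'"
      then consider a b k where "a \<in> A" "b \<in> A" "E a (\<mu> b)" "m = expv a + expv (coll T (\<mu> b)) + k"
        | z where "z \<in> Z'" "z \<in> keys m"
        unfolding quot_mons_def by blast
      then show "(mon m :: ('a, 'k) mpoly) \<in> J"
      proof cases
        case 1
        have "var a * var (\<mu> b) - var a * (var (\<mu> b) - var (coll T (\<mu> b))) \<in> J"
          using sup(1) edge_in_SR[OF 1(3), where 'k = 'k] by (intro ideal_diff J ideal_mult[OF J r]) blast
        then have "var a * var (coll T (\<mu> b)) \<in> J"
          by (simp add: algebra_simps)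
        then have "(var a * var (coll T (\<mu> b))) * mon k \<in> J"
          by (rule ideal_mult2[OF J])
        then show ?thesis
          by (simp add: 1(4) var_def mon_times)
      next
        case 2
        obtain k where k: "m = expv z + k"
          using expv_dvd[OF 2(2)] .
        have "var z * mon k \<in> J"
          by (intro ideal_mult2[OF J] sup(3) 2(1))
        then show ?thesis
          by (simp add: k var_def mon_times)
      qed
    qed
    then have "\<rho> f \<in> J" using that by blast
    moreover have "f - \<rho> f \<in> J"
      unfolding \<rho>_def by (rule push_rename_cong[OF J r])
    ultimately show ?thesis
      by (rule ideal_diff_cancel[OF J, rotated])
  qed
  ultimately show ?thesis
    unfolding \<rho>_def M_def by blast
qed

text \<open>By \<open>nzd_var_diff\<close> it is enough to treat a monomial \<open>u\<close> whose
  products with both variables lie in the ideal. The generators responsible yield some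
  \<open>a'\<close> below \<open>i\<close> and some \<open>b\<close> above \<open>i\<close> whose
  vertices divide \<open>u\<close>, and transitivity supplies a generator dividing \<open>u\<close>
  itself.\<close>

lemma nzd_partner:
  assumes T: "T \<subseteq> A" and Z': "Z' \<subseteq> Z" and i: "i \<in> A" "i \<notin> T"
    and antisym: "\<And>i j. i \<in> A \<Longrightarrow> j \<in> A \<Longrightarrow> E i (\<mu> j) \<Longrightarrow> E j (\<mu> i) \<Longrightarrow> i = j"
  shows "nzd (mon_ideal (quot_mons T Z')) (var i - var (\<mu> i) :: ('a, 'k::comm_ring_1) mpoly)"
proof (rule nzd_var_diff[OF upset_quot_mons])
  have coll_i: "coll T (\<mu> i) = \<mu> i"
    using coll_partner[OF T i(1)] i(2) by simp
  have coll_ne: "coll T (\<mu> b) \<noteq> i" if "b \<in> A" for b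
    using coll_partner[OF T that] i partner_notin[OF that] by (auto split: if_splits)
  show "expv i + expv (\<mu> i) \<in> quot_mons T Z'"
    using quot_mons_edge[OF i(1) i(1) refl[OF i(1)], of T 0 Z'] coll_i by simp
  show "i \<noteq> \<mu> i"
    using partner_notin[OF i(1)] i(1) by auto
  have notZ: "i \<notin> Z'" "\<mu> i \<notin> Z'"
    using i(1) Z' disj by blast+
  fix u assume u1: "expv i + u \<in> quot_mons T Z'" and u2: "expv (\<mu> i) + u \<in> quot_mons T Z'"
  show "u \<in> quot_mons T Z'"
  proof (rule ccontr)
    assume u: "u \<notin> quot_mons T Z'"
    then have uZ: "keys u \<inter> Z' = {}" by (simp add: quot_mons_def)
    have no: "u \<noteq> expv a + expv (coll T (\<mu> b)) + k" if "a \<in> A" "b \<in> A" "E a (\<mu> b)" for a b k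
      using quot_mons_edge[OF that] u by metis
    have "keys (expv i + u) \<inter> Z' = {}" "keys (expv (\<mu> i) + u) \<inter> Z' = {}"
      using uZ notZ by (auto simp: keys_exps_add)
    then obtain a b k a' b' k' where
      ab: "a \<in> A" "b \<in> A" "E a (\<mu> b)" "expv i + u = expv a + expv (coll T (\<mu> b)) + k" and
      ab': "a' \<in> A" "b' \<in> A" "E a' (\<mu> b')" "expv (\<mu> i) + u = expv a' + expv (coll T (\<mu> b')) + k'"
      using u1 u2 unfolding quot_mons_def by blast
    \<comment> \<open>Otherwise the generator avoids \<open>i\<close> altogether and already divides
      \<open>u\<close>.\<close>
    have "a = i"
      by (rule ccontr, rule expv_cancel[OF ab(4)]) (use coll_ne[OF ab(2)] no[OF ab(1-3)] in auto)
    then have "expv i + u = expv i + (expv (coll T (\<mu> b)) + k)"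
      using ab(4) by (simp add: add.assoc)
    then have "u = expv (coll T (\<mu> b)) + k"
      by (rule add_left_imp_eq)
    then have b: "coll T (\<mu> b) \<in> keys u"
      by (simp add: keys_exps_add)
    have ne: "\<mu> i \<noteq> a'"
      using ab'(1) partner_notin[OF i(1)] by auto
    \<comment> \<open>For the same reason \<open>\<mu> i\<close> must occur in this generator, and
      it can only be the second factor because \<open>a'\<close> lies in \<open>A\<close>.\<close>
    have c: "coll T (\<mu> b') = \<mu> i"
      by (rule ccontr, rule expv_cancel[OF ab'(4) ne]) (use no[OF ab'(1-3)] in auto)
    then have "b' \<notin> T"
      using coll_partner[OF T ab'(2)] partner_notin[OF i(1)] ab'(2) by auto
    then have "\<mu> b' = \<mu> i"
      using c coll_partner[OF T ab'(2)] by simp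
    then have "b' = i"
      using inj ab'(2) i(1) by (auto dest: inj_onD)
    have "expv (\<mu> i) + u = expv (\<mu> i) + (expv a' + k')"
      using ab'(4) c by (simp add: add_ac)
    then have "u = expv a' + k'"
      by (rule add_left_imp_eq)
    then have a': "a' \<in> keys u"
      by (simp add: keys_exps_add)
    have a'b: "E a' (\<mu> b)"
      using trans[OF ab'(1) i(1) ab(2)] ab'(3) ab(3) \<open>a = i\<close> \<open>b' = i\<close> by simp
    \<comment> \<open>The two divisors of \<open>u\<close> give a generator unless they are the same
      vertex, when a square would be needed. This coincidence makes \<open>b\<close> and
      \<open>i\<close> equivalent, and only antisymmetry excludes it.\<close>
    show False
    proof (cases "a' = coll T (\<mu> b)")
      case True
      then have "a' = b" "b \<in> T"
        using coll_partner[OF T ab(2)] partner_notin[OF ab(2)] ab'(1) by (auto split: if_splits)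
      then have "b = i"
        using antisym[OF i(1) ab(2)] ab(3) ab'(3) \<open>a = i\<close> \<open>b' = i\<close> by simp
      then show False
        using \<open>b \<in> T\<close> i(2) by simp
    next
      case False
      then show False
        using expv_add_dvd[OF a' b] no[OF ab'(1) ab(2) a'b] by blast
    qed
  qed
qed

lemma nzd_isolated:
  assumes T: "T \<subseteq> A" and z: "z \<in> Z" "z \<notin> Z'"
  shows "nzd (mon_ideal (quot_mons T Z')) (var z :: ('a, 'k::comm_ring_1) mpoly)"
proof (rule nzd_var)
  fix u assume "expv z + u \<in> quot_mons T Z'"
  then consider a b k where "a \<in> A" "b \<in> A" "E a (\<mu> b)" "expv z + u = expv a + expv (coll T (\<mu> b)) + k"
    | "keys (expv z + u) \<inter> Z' \<noteq> {}"
    unfolding quot_mons_def by blast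
  then show "u \<in> quot_mons T Z'"
  proof cases
    case 1
    have "z \<noteq> a" "z \<noteq> coll T (\<mu> b)"
      using 1(1,2) z(1) disj coll_partner[OF T 1(2)] by auto
    from expv_cancel[OF 1(4) this] obtain k' where "u = expv a + expv (coll T (\<mu> b)) + k'" .
    then show ?thesis
      using quot_mons_edge[OF 1(1-3)] by simp
  next
    case 2
    then show ?thesis
      using z(2) by (auto simp: keys_exps_add quot_mons_def)
  qed
qed

theorem cohen_macaulay_if_antisym:
  assumes antisym: "\<And>i j. i \<in> A \<Longrightarrow> j \<in> A \<Longrightarrow> E i (\<mu> j) \<Longrightarrow> E j (\<mu> i) \<Longrightarrow> i = j"
  shows "cohen_macaulay_cx TYPE('k::field) (Ind E)"
proof -
  obtain as zs where l: "set as = A" "distinct as" "set zs = Z" "distinct zs"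
    "length as = card A" "length zs = card Z"
    by (rule lists_exist)
  define th :: "('a, 'k) mpoly list" where "th = params as zs"
  define I where "I = SR_ideal TYPE('k) (Ind E)"
  have "nzd (pre_ideal I th n) (th ! n)" if n: "n < length th" for n
  proof -
    \<comment> \<open>While \<open>n \<le> length as\<close> the subtraction truncates to 0 and
      \<open>Z'\<close> is empty, so one description covers prefixes of both halves of the
      sequence.\<close>
    define T Z' where "T = set (take n as)" and "Z' = set (take (n - length as) zs)"
    have T: "T \<subseteq> A" and Z': "Z' \<subseteq> Z"
      using set_take_subset l by (auto simp: T_def Z'_def dest: in_set_takeD)
    have "set (take n th) = (\<lambda>i. var i - var (\<mu> i)) ` T \<union> var ` Z'"
      by (simp add: th_def params_def T_def Z'_def take_map)
    then have pre: "f \<in> pre_ideal I th n \<longleftrightarrow> push (rename (coll T)) f \<in> mon_ideal (quot_mons T Z')" for f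
      using quot_ideal[OF T Z', of f] by (simp add: pre_ideal_def I_def)
    have notin: "xs ! k \<notin> set (take k xs)" if "distinct xs" "k < length xs" for xs :: "'a list" and k
      using that by (auto simp: in_set_conv_nth distinct_conv_nth)
    have "nzd (mon_ideal (quot_mons T Z')) (push (rename (coll T)) (th ! n))"
    proof (cases "n < length as")
      case True
      then have i: "as ! n \<in> A" "as ! n \<notin> T"
        using l notin by (auto simp: T_def)
      have "th ! n = var (as ! n) - var (\<mu> (as ! n))"
        using True by (simp add: th_def params_def nth_append)
      moreover have "push (rename (coll T)) (var (as ! n) - var (\<mu> (as ! n)) :: ('a, 'k) mpoly) =
          var (as ! n) - var (\<mu> (as ! n))"
        using i coll_id[OF T notin_image[OF i(1)]] coll_partner[OF T i(1)]
        by (simp add: push_diff var_def rename_expv[simplified])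
      ultimately show ?thesis
        using nzd_partner[OF T Z' i antisym, where 'k = 'k] by simp
    next
      case False
      define z where "z = zs ! (n - length as)"
      have "n - length as < length zs"
        using n False by (simp add: th_def params_def)
      then have z: "z \<in> Z" "z \<notin> Z'"
        using l notin by (auto simp: Z'_def z_def)
      have "th ! n = var z"
        using n False by (simp add: th_def params_def nth_append z_def)
      moreover have "coll T z = z"
        using z(1) disj by (intro coll_id[OF T]) blast
      then have "push (rename (coll T)) (var z :: ('a, 'k) mpoly) = var z"
        by (simp add: var_def rename_expv[simplified])
      ultimately show ?thesis
        using nzd_isolated[OF T z, where 'k = 'k] by simp
    qed
    \<comment> \<open>Membership in the partial ideal is tested after the multiplicative renaming,
      so regularity of the renamed parameter pulls back.\<close>
    then show ?thesis
      by (simp add: nzd_def pre push_mult[OF rename_add])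
  qed
  then have "reg I th"
    by (simp add: reg_iff_nth I_def is_ideal_SR)
  moreover have "length th = card A + card Z"
    using l by (simp add: th_def params_def)
  ultimately show ?thesis
    unfolding cohen_macaulay_iff[OF Ind_down_closed empty_in_Ind] krull_dim
    unfolding I_def[symmetric] using params_pos[of as zs] by (auto simp: th_def)
qed

text \<open>If \<open>i \<noteq> j\<close> are equivalent, then \<open>x\<^sub>i\<close> is killed by \<open>x\<^sub>j - x\<^bsub>\<mu> j\<^esub>\<close> modulo \<open>x\<^sub>i - x\<^bsub>\<mu> i\<^esub>\<close>. For a vertex \<open>f\<close> not
  adjacent to \<open>i\<close> and \<open>\<mu> i\<close>, the sum of the coefficients of \<open>x\<^sub>i x\<^sub>f\<close> and \<open>x\<^bsub>\<mu> i\<^esub> x\<^sub>f\<close> is a functional that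
  vanishes on \<open>I + (x\<^sub>i - x\<^bsub>\<mu> i\<^esub>)\<close>, hence \<open>x\<^sub>i x\<^sub>f\<close> is not killed.\<close>

lemma not_buchsbaum:
  assumes ij: "i \<in> A" "j \<in> A" "i \<noteq> j" "E i (\<mu> j)" "E j (\<mu> i)"
    and f: "{i, f} \<in> Ind E" "{\<mu> i, f} \<in> Ind E" "f \<noteq> i" "f \<noteq> \<mu> i"
  shows "\<not> buchsbaum_cx TYPE('k::field) (Ind E)"
proof
  assume B: "buchsbaum_cx TYPE('k) (Ind E)"
  obtain as zs where l: "set as = A" "distinct as" "set zs = Z" "distinct zs"
    "length as = card A" "length zs = card Z"
    by (rule lists_exist)
  \<comment> \<open>With \<open>i\<close> and \<open>j\<close> in front, the condition at index 1
    concerns multiplication by the difference for \<open>j\<close> modulo the difference for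
    \<open>i\<close> alone.\<close>
  define as' where "as' = i # j # filter (\<lambda>x. x \<noteq> i \<and> x \<noteq> j) as"
  have as': "set as' = A" "distinct as'"
    using l ij by (auto simp: as'_def)
  then have "length as' = card A"
    using distinct_card by fastforce
  define th :: "('a, 'k) mpoly list" where "th = params as' zs"
  define I where "I = SR_ideal TYPE('k) (Ind E)"
  have I: "is_ideal I" by (simp add: I_def is_ideal_SR)
  have "length th = card A + card Z"
    using \<open>length as' = card A\<close> l by (simp add: th_def params_def)
  then have "hsop TYPE('k) I th"
    using hsop_iff[OF SR_subset_max_homog[OF empty_in_Ind Ind_down_closed], of E th]
      params_pos[of as' zs] params_par[OF as'(1) l(3)] krull_dim[where 'k = 'k]
    by (simp add: th_def I_def)
  then have "weak_seq TYPE('k) I th"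
    using B by (auto simp: buchsbaum_cx_def buchsbaum_quot_def I_def)
  moreover have "\<forall>t\<in>set th. t \<in> max_homog TYPE('k)"
    using params_pos[of as' zs] homog_pos_in_max_homog by (auto simp: th_def)
  ultimately have weak: "\<forall>k<length th. \<forall>g. th ! k * g \<in> pre_ideal I th k \<longrightarrow> (\<forall>v. var v * g \<in> pre_ideal I th k)"
    using weak_seq_iff by blast
  have th: "1 < length th" "th ! 1 = var j - var (\<mu> j)" "th ! 0 = var i - var (\<mu> i)"
    by (simp_all add: th_def params_def as'_def)
  define t :: "('a, 'k) mpoly" where "t = var i - var (\<mu> i)"
  define J where "J = gen_ideal (insert t I)"
  have J: "is_ideal J" by (simp add: J_def is_ideal_gen)
  have pre1: "pre_ideal I th 1 = J"
    by (simp add: pre_ideal_def J_def t_def th_def params_def as'_def)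
  have inI: "u * w \<in> J" if "u * w \<in> I" for u w
    using that gen_ideal_insert_sub by (auto simp: J_def)
  have "var i * var (\<mu> j) \<in> J" "var j * var (\<mu> i) \<in> J"
    using edge_in_SR ij(4,5) by (auto intro!: inI simp: I_def)
  moreover have "t \<in> J"
    unfolding J_def by (rule gen_ideal_insert_memI)
  \<comment> \<open>This element is \<open>(var j - var (\<mu> j)) * var i\<close> in expanded
    form.\<close>
  ultimately have "var j * t + var j * var (\<mu> i) - var i * var (\<mu> j) \<in> J"
    using ideal_diff[OF J ideal_add[OF J ideal_mult[OF J]]] by blast
  then have "th ! 1 * var i \<in> pre_ideal I th 1"
    unfolding th pre1 by (simp add: t_def algebra_simps)
  then have "var f * var i \<in> J"
    using weak th(1) pre1 by auto
  then obtain p r where p: "p \<in> I" "var f * var i = p + r * t"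
    using gen_ideal_insertE[OF _ I] unfolding J_def by blast
  define \<mu>i where "\<mu>i = \<mu> i"
  have ne: "i \<noteq> \<mu>i" using partner_notin[OF ij(1)] ij(1) by (auto simp: \<mu>i_def)
  have p0: "lookup p (expv i + expv f) = 0" "lookup p (expv \<mu>i + expv f) = 0"
  proof -
    have zero: "lookup p m = 0" if "keys m \<in> Ind E" for m
      using p(1) that unfolding I_def SR_ideal_eq[OF Ind_down_closed] mon_ideal_def
      by (auto simp: in_keys_iff)
    have "keys (expv v + expv f) = {v, f}" for v
      by (auto simp: keys_exps_add)
    then show "lookup p (expv i + expv f) = 0" "lookup p (expv \<mu>i + expv f) = 0"
      using zero f(1,2) by (simp_all add: \<mu>i_def del: One_nat_def)
  qed
  have other: "lookup (var v * r) (expv w + expv f) = 0" if "v \<noteq> w" "v \<noteq> f" for v w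
    unfolding var_def
  proof (rule lookup_single_times_eq_0)
    fix m
    have "v \<in> keys (expv v + m)" "v \<notin> keys (expv w + expv f)"
      using that by (auto simp: keys_exps_add)
    then show "expv w + expv f \<noteq> expv v + m" by metis
  qed
  have same: "lookup (var v * r) (expv v + expv f) = lookup r (expv f)" for v
    unfolding var_def by (simp add: lookup_single_times)
  have "lookup (r * t) (expv i + expv f) = lookup r (expv f)"
    "lookup (r * t) (expv \<mu>i + expv f) = - lookup r (expv f)"
    using other[of \<mu>i i] other[of i \<mu>i] same f ne
    by (simp_all add: t_def right_diff_distrib lookup_minus mult.commute[of r] flip: \<mu>i_def)
  \<comment> \<open>The contradiction: on the left the functional takes the value 1, since the first
    monomial is the product itself and the second one differs from it.\<close>
  then have "lookup (var f * var i) (expv i + expv f) + lookup (var f * var i) (expv \<mu>i + expv f) = (0 :: 'k)"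
    unfolding p(2) lookup_add p0 by simp
  moreover have "expv \<mu>i + expv f \<noteq> expv i + expv f"
  proof
    assume "expv \<mu>i + expv f = expv i + expv f"
    then have "keys (expv \<mu>i) = keys (expv i)" by simp
    then show False using ne by simp
  qed
  ultimately show False
    by (simp add: var_def mon_times lookup_single when_def add.commute)
qed

text \<open>Every further vertex is adjacent to \<open>i\<close> or \<open>\<mu> i\<close>, and
  bipartiteness decides which. Hence no vertex is isolated, \<open>i\<close> is both below and above
  every element of \<open>A\<close>, and by transitivity all elements are equivalent.\<close>

theorem antisym_or_complete_if_buchsbaum:
  assumes B: "buchsbaum_cx TYPE('k::field) (Ind E)" and i: "i \<in> A" "j \<in> A" "i \<noteq> j" "E i (\<mu> j)" "E j (\<mu> i)"
  shows "\<exists>n\<ge>1. is_complete_bipartite_nn E n"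
proof -
  have not: "E i f \<or> E (\<mu> i) f" if "f \<noteq> i" "f \<noteq> \<mu> i" for f
  proof (rule ccontr)
    assume "\<not> ?thesis"
    then have "{i, f} \<in> Ind E" "{\<mu> i, f} \<in> Ind E"
      using sym irrefl by (auto simp: Ind_def)
    then show False
      using not_buchsbaum[OF i _ _ that] B by blast
  qed
  have "Z = {}"
  proof (rule ccontr)
    assume "Z \<noteq> {}"
    then obtain z where z: "z \<in> Z" by blast
    then have "z \<noteq> i" "z \<noteq> \<mu> i" using disj i(1) by auto
    then show False using not[of z] isolated[OF z] by blast
  qed
  have up: "E i (\<mu> k)" if k: "k \<in> A" for k
  proof (cases "k = i")
    case False
    then have "\<mu> k \<noteq> i" "\<mu> k \<noteq> \<mu> i"
      using k i(1) partner_notin inj by (auto dest: inj_onD)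
    moreover have "\<not> E (\<mu> i) (\<mu> k)"
      using edge[of "\<mu> i" "\<mu> k"] partner_notin i(1) k by blast
    ultimately show ?thesis using not by blast
  qed (use refl i(1) in simp)
  have down: "E k (\<mu> i)" if k: "k \<in> A" for k
  proof (cases "k = i")
    case False
    moreover have "k \<noteq> \<mu> i" using k i(1) partner_notin by blast
    moreover have "\<not> E i k"
      using edge[of i k] notin_image i(1) k by blast
    ultimately show ?thesis using not[of k] sym by blast
  qed (use refl i(1) in simp)
  have all: "E k (\<mu> l)" if "k \<in> A" "l \<in> A" for k l
    using trans[OF that(1) i(1) that(2) down[OF that(1)] up[OF that(2)]] .
  have compl: "- A = \<mu> ` A"
    using UNIV disj \<open>Z = {}\<close> by blast
  have "E u v \<longleftrightarrow> (u \<in> A \<longleftrightarrow> v \<notin> A)" for u v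
  proof
    assume "E u v"
    then show "u \<in> A \<longleftrightarrow> v \<notin> A"
      using edge[of u v] disj by blast
  next
    assume "u \<in> A \<longleftrightarrow> v \<notin> A"
    then have "u \<in> A \<and> v \<in> \<mu> ` A \<or> u \<in> \<mu> ` A \<and> v \<in> A"
      using compl by blast
    then show "E u v"
      using all sym by blast
  qed
  moreover have "card (- A) = card A"
    unfolding compl using inj by (rule card_image)
  moreover have "card A \<ge> 1"
    using i(1) by (auto simp: Suc_le_eq card_gt_0_iff)
  ultimately show ?thesis
    unfolding is_complete_bipartite_nn_def by blast
qed

end

lemma pure_if_buchsbaum:
  fixes E :: "'a::finite \<Rightarrow> 'a \<Rightarrow> bool"
  assumes E: "simple_graph E" and B: "buchsbaum_cx TYPE('k::field) (Ind E)"
  obtains d where "\<And>S. S \<in> Ind E \<Longrightarrow> \<exists>M\<in>Ind E. S \<subseteq> M \<and> card M = d" "\<And>S. S \<in> Ind E \<Longrightarrow> card S \<le> d"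
proof -
  obtain G where G: "G \<in> Ind E" "\<And>H. H \<in> Ind E \<Longrightarrow> card H \<le> card G"
    using max_face_exists[of "Ind E"] empty_in_Ind by blast
  have "\<exists>M\<in>Ind E. S \<subseteq> M \<and> card M = card G" if S: "S \<in> Ind E" for S
  proof -
    obtain M where M: "M \<in> Ind E" "S \<subseteq> M" "\<And>H. H \<in> Ind E \<Longrightarrow> M \<subseteq> H \<Longrightarrow> H = M"
      using finite_has_maximal2[of "Ind E" S] S by auto
    \<comment> \<open>The vertex type is inhabited and there are no loops, so a singleton is
      independent and the empty set is never a facet.\<close>
    have "M \<noteq> {}"
    proof
      assume "M = {}"
      then have "{undefined} = M"
        using E by (intro M(3)) (auto simp: Ind_def simple_graph_def)
      then show False using \<open>M = {}\<close> by simp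
    qed
    then have "card M = card G"
      using facet_card_if_buchsbaum[OF Ind_down_closed empty_in_Ind B G M(1)] M(3) by blast
    then show ?thesis using M by blast
  qed
  then show ?thesis
    using that[of "card G"] G(2) by blast
qed

theorem theorem4p10:
  fixes E :: "'a::finite \<Rightarrow> 'a \<Rightarrow> bool"
  assumes "simple_graph E" and "bipartite E"
  shows "buchsbaum_cx TYPE('k::field) (Ind E) \<longleftrightarrow>
           ((\<exists>n\<ge>1. is_complete_bipartite_nn E n) \<or> cohen_macaulay_cx TYPE('k) (Ind E))"
proof
  assume B: "buchsbaum_cx TYPE('k) (Ind E)"
  obtain d where "\<And>S. S \<in> Ind E \<Longrightarrow> \<exists>M\<in>Ind E. S \<subseteq> M \<and> card M = d" "\<And>S. S \<in> Ind E \<Longrightarrow> card S \<le> d"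
    using pure_if_buchsbaum[OF assms(1) B] by blast
  then obtain A Z \<mu> where "matched_graph E A Z \<mu>"
    using matched_graph_if_pure[OF assms] by metis
  then interpret matched_graph E A Z \<mu> .
  show "(\<exists>n\<ge>1. is_complete_bipartite_nn E n) \<or> cohen_macaulay_cx TYPE('k) (Ind E)"
    using cohen_macaulay_if_antisym antisym_or_complete_if_buchsbaum[OF B] by blast
next
  assume "(\<exists>n\<ge>1. is_complete_bipartite_nn E n) \<or> cohen_macaulay_cx TYPE('k) (Ind E)"
  then show "buchsbaum_cx TYPE('k) (Ind E)"
    using buchsbaum_complete_bipartite buchsbaum_if_cohen_macaulay[OF Ind_down_closed empty_in_Ind]
    by blast
qed

end
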